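(* Let $G$ be a Vilenkin group and let $T$ be a bilinear Calderón–Zygmund operator on $G$, i.e. a bilinear operator associated with a bilinear Calderón–Zygmund kernel. Assume that, for some $1\le p,q\le\infty$ and $0<r<\infty$ satisfying $$\frac1p+\frac1q=\frac1r,$$ the operator $T$ extends to a bounded bilinear mapping from $L^p(G)\times L^q(G)$ into $L^{r,\infty}(G)$. Then $T$ extends to a bounded bilinear mapping from $L^1(G)\times L^1(G)$ into $L^{1/2,\infty}(G)$.
   Context: **Vilenkin group.** $G$ is a locally compact abelian group with a strictly decreasing sequence of compact open subgroups $\{G_n\}_{n\in\mathbb Z}$ such that $\bigcup_{n\in\mathbb Z}G_n=G$, $\bigcap_{n\in\mathbb Z}G_n=\{0\}$, and $\sup_{n\in\mathbb Z}\operatorname{order}(G_n/G_{n+1})=B<\infty$. $dx$ is Haar measure on $G$ normalized so that $|G_0|=1$, where $|A|$ denotes the Haar measure of $A$. Put $m_n=|G_n|^{-1}$; then $2m_n\le m_{n+1}\le B m_n$ for all $n\in\mathbb Z$. The metric $d$ on $G$ is $d(x,y)=m_n^{-1}$ if $x-y\in G_n\setminus G_{n+1}$, and $d(x,x)=0$. **Test functions.** $\mathcal S(G)$ is the space of functions $\varphi:G\to\mathbb C$ for which there are $k,l\in\mathbb Z$ with $\operatorname{supp}\varphi\subset G_k$ and $\varphi$ constant on the cosets of $G_l$. **Spaces.** $L^p(G)$ is the usual Lebesgue space with respect to Haar measure. For $0<r<\infty$, $L^{r,\infty}(G)$ is the weak Lebesgue space with quasi-norm $\|f\|_{L^{r,\infty}(G)}=\sup_{\lambda>0}\lambda\,|\{x\in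 G:|f(x)|>\lambda\}|^{1/r}$. **Bilinear Calderón–Zygmund kernel.** A locally integrable function $K(x,y_1,y_2)$ defined away from the diagonal $x=y_1=y_2$ in $G\times G\times G$ such that, for some $C>0$ and $\varepsilon>0$ and all points off the diagonal: - $|K(x,y_1,y_2)|\le \dfrac{C}{(d(x,y_1)+d(x,y_2))^2}$; - $|K(x,y_1,y_2)-K(x',y_1,y_2)|\le \dfrac{C\,d(x,x')^\varepsilon}{(d(x,y_1)+d(x,y_2))^{2+\varepsilon}}$ whenever $d(x,x')\le\frac12\max\{d(x,y_1),d(x,y_2)\}$; - $|K(x,y_1,y_2)-K(x,y_1',y_2)|\le \dfrac{C\,d(y_1,y_1')^\varepsilon}{(d(x,y_1)+d(x,y_2))^{2+\varepsilon}}$ whenever $d(y_1,y_1')\le\frac12\max\{d(x,y_1),d(x,y_2)\}$; - $|K(x,y_1,y_2)-K(x,y_1,y_2')|\le \dfrac{C\,d(y_2,y_2')^\varepsilon}{(d(x,y_1)+d(x,y_2))^{2+\varepsilon}}$ whenever $d(y_2,y_2')\le\frac12\max\{d(x,y_1),d(x,y_2)\}$. **Associated operator.** A bilinear operator $T$ (defined on $\mathcal S(G)\times\mathcal S(G)$, with values in measurable functions on $G$) is associated with $K$ if $$T(f_1,f_2)(x)=\int_G\int_G K(x,y_1,y_2)f_1(y_1)f_2(y_2)\,dy_1\,dy_2$$ for all $f_1,f_2\in\mathcal S(G)$ and all $x\notin\operatorname{supp}(f_1)\cap\operatorname{supp}(f_2)$. *)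

theory Defs
  imports "HOL-Probability.Essential_Supremum"
begin

section \<open>Vilenkin groups\<close>

definition add_subgroup :: "'a::group_add set \<Rightarrow> bool" where
  "add_subgroup H \<longleftrightarrow> 0 \<in> H \<and> (\<forall>x\<in>H. \<forall>y\<in>H. x + y \<in> H) \<and> (\<forall>x\<in>H. - x \<in> H)"

definition cosets_of :: "'a::group_add set \<Rightarrow> 'a set \<Rightarrow> 'a set set" where
  "cosets_of A H = A // {(x, y). x \<in> A \<and> y \<in> A \<and> x - y \<in> H}"

text \<open>Finiteness of the quotients is stated separately because \<open>card\<close> is 0 on infinite sets.\<close>

definition vilenkin_group :: "(int \<Rightarrow> 'a::{topological_ab_group_add, t2_space} set) \<Rightarrow> bool" where
  "vilenkin_group G \<longleftrightarrow>
     locally_compact_space (euclidean :: 'a topology) \<and>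
     (\<forall>n. add_subgroup (G n) \<and> compact (G n) \<and> open (G n)) \<and>
     (\<forall>n. G (n + 1) \<subset> G n) \<and>
     (\<Union>n. G n) = UNIV \<and>
     (\<Inter>n. G n) = {0} \<and>
     (\<forall>n. finite (cosets_of (G n) (G (n + 1)))) \<and>
     bdd_above (range (\<lambda>n. card (cosets_of (G n) (G (n + 1)))))"

definition haar_measure :: "'a::{topological_ab_group_add, t2_space} measure \<Rightarrow> bool" where
  "haar_measure \<mu> \<longleftrightarrow>
     sets \<mu> = sets borel \<and>
     emeasure \<mu> UNIV \<noteq> 0 \<and>
     (\<forall>a. \<forall>A\<in>sets borel. emeasure \<mu> ((+) a ` A) = emeasure \<mu> A) \<and>
     (\<forall>C. compact C \<longrightarrow> emeasure \<mu> C < \<infinity>) \<and>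
     (\<forall>A\<in>sets borel. emeasure \<mu> A = (INF U\<in>{U. open U \<and> A \<subseteq> U}. emeasure \<mu> U)) \<and>
     (\<forall>U. open U \<longrightarrow> emeasure \<mu> U = (SUP C\<in>{C. compact C \<and> C \<subseteq> U}. emeasure \<mu> C))"

definition vil_m :: "(int \<Rightarrow> 'a set) \<Rightarrow> 'a measure \<Rightarrow> int \<Rightarrow> real" where
  "vil_m G \<mu> n = 1 / measure \<mu> (G n)"

definition vil_dist :: "(int \<Rightarrow> 'a::ab_group_add set) \<Rightarrow> 'a measure \<Rightarrow> 'a \<Rightarrow> 'a \<Rightarrow> real" where
  "vil_dist G \<mu> x y =
     (if x = y then 0 else 1 / vil_m G \<mu> (THE n. x - y \<in> G n - G (n + 1)))"


section \<open>Function spaces\<close>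

definition supp :: "('a::topological_space \<Rightarrow> complex) \<Rightarrow> 'a set" where
  "supp f = closure {x. f x \<noteq> 0}"

definition test_functions ::
    "(int \<Rightarrow> 'a::{topological_space, ab_group_add} set) \<Rightarrow> ('a \<Rightarrow> complex) set" where
  "test_functions G =
     {\<phi>. \<exists>k l. supp \<phi> \<subseteq> G k \<and> (\<forall>x y. x - y \<in> G l \<longrightarrow> \<phi> x = \<phi> y)}"

text \<open>Powers of extended nonnegative reals, for exponents \<open>a > 0\<close> only.\<close>

definition epowr :: "ennreal \<Rightarrow> real \<Rightarrow> ennreal" where
  "epowr x a = (if x = \<infinity> then \<infinity> else ennreal (enn2real x powr a))"

text \<open>The spaces consist of functions; elements that agree almost everywhere are not identified.
  Statements about their elements are therefore made almost everywhere.\<close>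

definition Lp_norm :: "'a measure \<Rightarrow> ennreal \<Rightarrow> ('a \<Rightarrow> complex) \<Rightarrow> ennreal" where
  "Lp_norm \<mu> p f =
     (if p = \<infinity> then esssup \<mu> (\<lambda>x. ennreal (cmod (f x)))
      else epowr (\<integral>\<^sup>+x. ennreal (cmod (f x) powr enn2real p) \<partial>\<mu>) (1 / enn2real p))"

definition Lp :: "'a measure \<Rightarrow> ennreal \<Rightarrow> ('a \<Rightarrow> complex) set" where
  "Lp \<mu> p = {f \<in> borel_measurable \<mu>. Lp_norm \<mu> p f < \<infinity>}"

definition weak_Lp_norm :: "'a measure \<Rightarrow> real \<Rightarrow> ('a \<Rightarrow> complex) \<Rightarrow> ennreal" where
  "weak_Lp_norm \<mu> r f =
     (SUP t\<in>{0<..}. ennreal t * epowr (emeasure \<mu> {x \<in> space \<mu>. cmod (f x) > t}) (1 / r))"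

definition weak_Lp :: "'a measure \<Rightarrow> real \<Rightarrow> ('a \<Rightarrow> complex) set" where
  "weak_Lp \<mu> r = {f \<in> borel_measurable \<mu>. weak_Lp_norm \<mu> r f < \<infinity>}"


section \<open>Bilinear operators\<close>

type_synonym 'a bilin_op = "('a \<Rightarrow> complex) \<Rightarrow> ('a \<Rightarrow> complex) \<Rightarrow> 'a \<Rightarrow> complex"

definition bilinear_op ::
    "'a measure \<Rightarrow> ('a \<Rightarrow> complex) set \<Rightarrow> ('a \<Rightarrow> complex) set \<Rightarrow> 'a bilin_op \<Rightarrow> bool" where
  "bilinear_op \<mu> X Y T \<longleftrightarrow>
     (\<forall>f\<in>X. \<forall>g\<in>Y. T f g \<in> borel_measurable \<mu>) \<and>
     (\<forall>f\<in>X. \<forall>f'\<in>X. \<forall>g\<in>Y. AE x in \<mu>. T (\<lambda>z. f z + f' z) g x = T f g x + T f' g x) \<and>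
     (\<forall>f\<in>X. \<forall>g\<in>Y. \<forall>g'\<in>Y. AE x in \<mu>. T f (\<lambda>z. g z + g' z) x = T f g x + T f g' x) \<and>
     (\<forall>c. \<forall>f\<in>X. \<forall>g\<in>Y. AE x in \<mu>. T (\<lambda>z. c * f z) g x = c * T f g x) \<and>
     (\<forall>c. \<forall>f\<in>X. \<forall>g\<in>Y. AE x in \<mu>. T f (\<lambda>z. c * g z) x = c * T f g x)"

text \<open>Boundedness together with bilinearity forces the extension \<open>T'\<close> to respect equality almost
  everywhere of its arguments.\<close>

definition extends_boundedly ::
    "(int \<Rightarrow> 'a::{topological_space, ab_group_add} set) \<Rightarrow> 'a measure \<Rightarrow>
      ennreal \<Rightarrow> ennreal \<Rightarrow> real \<Rightarrow> 'a bilin_op \<Rightarrow> bool" where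
  "extends_boundedly G \<mu> p q r T \<longleftrightarrow>
     (\<exists>T'. bilinear_op \<mu> (Lp \<mu> p) (Lp \<mu> q) T' \<and>
        (\<forall>f\<in>test_functions G. \<forall>g\<in>test_functions G. AE x in \<mu>. T' f g x = T f g x) \<and>
        (\<forall>f\<in>Lp \<mu> p. \<forall>g\<in>Lp \<mu> q. T' f g \<in> weak_Lp \<mu> r) \<and>
        (\<exists>A::real. \<forall>f\<in>Lp \<mu> p. \<forall>g\<in>Lp \<mu> q.
           weak_Lp_norm \<mu> r (T' f g) \<le> ennreal A * Lp_norm \<mu> p f * Lp_norm \<mu> q g))"


section \<open>Bilinear Calderon-Zygmund operators\<close>

definition off_diagonal :: "('a \<times> 'a \<times> 'a) set" where
  "off_diagonal = {(x, y1, y2). \<not> (x = y1 \<and> x = y2)}"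

text \<open>In the three regularity conditions the perturbed point is automatically off the diagonal:
  if, say, \<open>x' = y1 = y2\<close>, then \<open>d x x' \<le> d x x' / 2\<close> and hence \<open>x = x'\<close>.\<close>

definition bilinear_CZ_kernel ::
    "(int \<Rightarrow> 'a::{topological_ab_group_add, t2_space} set) \<Rightarrow> 'a measure \<Rightarrow>
      ('a \<Rightarrow> 'a \<Rightarrow> 'a \<Rightarrow> complex) \<Rightarrow> bool" where
  "bilinear_CZ_kernel G \<mu> K \<longleftrightarrow>
     (let d = vil_dist G \<mu> in
      (\<forall>D. compact D \<and> D \<subseteq> off_diagonal \<longrightarrow>
         set_integrable (\<mu> \<Otimes>\<^sub>M (\<mu> \<Otimes>\<^sub>M \<mu>)) D (\<lambda>(x, y1, y2). K x y1 y2)) \<and>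
      (\<exists>C>0. \<exists>\<epsilon>>0. \<forall>(x, y1, y2) \<in> off_diagonal.
         cmod (K x y1 y2) \<le> C / (d x y1 + d x y2)\<^sup>2 \<and>
         (\<forall>x'. d x x' \<le> 1 / 2 * max (d x y1) (d x y2) \<longrightarrow>
            cmod (K x y1 y2 - K x' y1 y2)
              \<le> C * d x x' powr \<epsilon> / (d x y1 + d x y2) powr (2 + \<epsilon>)) \<and>
         (\<forall>y1'. d y1 y1' \<le> 1 / 2 * max (d x y1) (d x y2) \<longrightarrow>
            cmod (K x y1 y2 - K x y1' y2)
              \<le> C * d y1 y1' powr \<epsilon> / (d x y1 + d x y2) powr (2 + \<epsilon>)) \<and>
         (\<forall>y2'. d y2 y2' \<le> 1 / 2 * max (d x y1) (d x y2) \<longrightarrow>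
            cmod (K x y1 y2 - K x y1 y2')
              \<le> C * d y2 y2' powr \<epsilon> / (d x y1 + d x y2) powr (2 + \<epsilon>))))"

definition associated_with ::
    "(int \<Rightarrow> 'a::{topological_space, ab_group_add} set) \<Rightarrow> 'a measure \<Rightarrow>
      'a bilin_op \<Rightarrow> ('a \<Rightarrow> 'a \<Rightarrow> 'a \<Rightarrow> complex) \<Rightarrow> bool" where
  "associated_with G \<mu> T K \<longleftrightarrow>
     (\<forall>f1\<in>test_functions G. \<forall>f2\<in>test_functions G. \<forall>x. x \<notin> supp f1 \<inter> supp f2 \<longrightarrow>
        T f1 f2 x = (LINT y1|\<mu>. (LINT y2|\<mu>. K x y1 y2 * f1 y1 * f2 y2)))"

definition bilinear_CZ_operator ::
    "(int \<Rightarrow> 'a::{topological_ab_group_add, t2_space} set) \<Rightarrow> 'a measure \<Rightarrow>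
      'a bilin_op \<Rightarrow> bool" where
  "bilinear_CZ_operator G \<mu> T \<longleftrightarrow>
     bilinear_op \<mu> (test_functions G) (test_functions G) T \<and>
     (\<exists>K. bilinear_CZ_kernel G \<mu> K \<and> associated_with G \<mu> T K)"

end

theory Submission
  imports Defs
begin

text \<open>
  The proof runs a Calderon--Zygmund decomposition in each argument of \<open>T\<close>, at heights adapted to the
  level \<open>t\<close> at which the distribution function of \<open>T f g\<close> is estimated, and then extends the estimate
  from test functions to integrable functions by density.

  Let \<open>f\<close> and \<open>g\<close> be test functions and put \<open>\<sigma> = sqrt (\<parallel>f\<parallel>\<^sub>1 \<parallel>g\<parallel>\<^sub>1 / t)\<close>. The goal is that \<open>T f g\<close> exceeds
  \<open>t\<close> in modulus on a set of measure at most a constant times \<open>\<sigma>\<close> (\<open>weak_type_estimate\<close>). Let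
  \<open>\<alpha> = \<parallel>f\<parallel>\<^sub>1 / \<sigma>\<close> and \<open>\<beta> = \<parallel>g\<parallel>\<^sub>1 / \<sigma>\<close>, so that \<open>\<alpha> \<beta> = t\<close>, and decompose \<open>f\<close> at height \<open>\<alpha>\<close> and \<open>g\<close> at
  height \<open>\<beta>\<close> (\<open>calderon_zygmund_decomposition\<close>). The union of the bad cosets of \<open>f\<close> and \<open>g\<close> has measure
  at most \<open>2 \<sigma>\<close>. The good parts \<open>f0\<close> and \<open>g0\<close> are bounded by multiples of \<open>\<alpha>\<close> and \<open>\<beta>\<close>, hence have
  \<open>L\<^sup>p\<close> and \<open>L\<^sup>q\<close> norms of order \<open>\<alpha> \<sigma> powr (1 / p)\<close> and \<open>\<beta> \<sigma> powr (1 / q)\<close>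
  (\<open>Lp_norm_le_interpolation\<close>), and because \<open>1 / p + 1 / q = 1 / r\<close> the assumed weak-type bound
  controls \<open>T f0 g0\<close> by exactly a multiple of \<open>\<sigma>\<close>.

  The remaining terms have a bad function \<open>b\<close>, of mean 0 and supported in a coset \<open>c + G n\<close>, in one of
  the arguments, and they are estimated at points \<open>x\<close> outside all bad cosets, where the kernel
  represents them. In an ultrametric space the distance from \<open>x\<close> to the points of \<open>c + G n\<close> is at
  least twice the diameter of that coset, so regularity of the kernel applies directly and yields a bound by
  \<open>V n powr \<epsilon> * d x c powr (-1 - \<epsilon>)\<close> times the \<open>L\<^sup>1\<close> norm of \<open>b\<close> times the maximal function of the
  other argument at \<open>x\<close> (\<open>first_variable_bound\<close>, \<open>second_variable_bound\<close>). The maximal functions of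
  \<open>f0\<close> and, off the bad cosets, of \<open>g\<close> are at most multiples of \<open>\<alpha>\<close> and \<open>\<beta>\<close>. Integration in \<open>x\<close>
  followed by the Markov inequality finishes the estimate (\<open>bad_part_bound\<close>).

  Treating test functions first keeps the decompositions finite, with all pieces again test
  functions, so that \<open>T\<close> is expanded over them by bilinearity alone.

  For the extension, the estimate shows that \<open>T\<close> maps \<open>L\<^sup>1\<close>-convergent sequences of test functions to
  sequences that converge in measure (\<open>limit_value_exists\<close>); by density of the test functions
  (\<open>test_functions_dense\<close>) the limits define the extension, which inherits bilinearity and the bound
  (\<open>extends_to_L1\<close>).
\<close>


section \<open>Cosets, their volumes and the ultrametric\<close>

locale vilenkin =
  fixes G :: "int \<Rightarrow> 'a::{topological_ab_group_add, t2_space} set"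
    and \<mu> :: "'a measure"
  assumes vilenkin: "vilenkin_group G"
    and haar: "haar_measure \<mu>"
    and normalized: "emeasure \<mu> (G 0) = 1"
begin

definition V :: "int \<Rightarrow> real" where
  "V n = measure \<mu> (G n)"

definition coset :: "int \<Rightarrow> 'a \<Rightarrow> 'a set" where
  "coset n x = {y. y - x \<in> G n}"

abbreviation d :: "'a \<Rightarrow> 'a \<Rightarrow> real" where
  "d \<equiv> vil_dist G \<mu>"

abbreviation S :: "('a \<Rightarrow> complex) set" where
  "S \<equiv> test_functions G"

abbreviation nrm :: "('a \<Rightarrow> complex) \<Rightarrow> real" where
  "nrm f \<equiv> (LINT x|\<mu>. cmod (f x))"

lemma sets_mu [measurable_cong, simp]: "sets \<mu> = sets borel"
  using haar by (simp add: haar_measure_def)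

lemma space_mu [simp]: "space \<mu> = UNIV"
  using sets_eq_imp_space_eq[OF sets_mu] by simp

lemma subgroup_G: "add_subgroup (G n)"
  using vilenkin by (auto simp: vilenkin_group_def)

lemma zero_in_G [simp]: "0 \<in> G n"
  using subgroup_G[of n] by (simp add: add_subgroup_def)

lemma add_in_G: "x \<in> G n \<Longrightarrow> y \<in> G n \<Longrightarrow> x + y \<in> G n"
  using subgroup_G[of n] by (simp add: add_subgroup_def)

lemma uminus_in_G: "x \<in> G n \<Longrightarrow> - x \<in> G n"
  using subgroup_G[of n] by (simp add: add_subgroup_def)

lemma diff_in_G: "x \<in> G n \<Longrightarrow> y \<in> G n \<Longrightarrow> x - y \<in> G n"
  using add_in_G[of x n "- y"] uminus_in_G[of y n] by simp

lemma diff_in_G_commute: "x - y \<in> G n \<longleftrightarrow> y - x \<in> G n"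
  using uminus_in_G[of "x - y" n] uminus_in_G[of "y - x" n] by auto

lemma diff_in_G_trans: "x - y \<in> G n \<Longrightarrow> y - z \<in> G n \<Longrightarrow> x - z \<in> G n"
  using add_in_G[of "x - y" n "y - z"] by simp

lemma G_strict_mono: "G (n + 1) \<subset> G n"
  using vilenkin by (auto simp: vilenkin_group_def)

lemma G_antimono: "m \<le> n \<Longrightarrow> G n \<subseteq> G m"
proof (induction n rule: int_ge_induct)
  case base
  show ?case by simp
next
  case (step i)
  have "G (i + 1) \<subseteq> G i" using G_strict_mono[of i] by (rule psubset_imp_subset)
  then show ?case using step.IH by (rule subset_trans)
qed

lemma G_antimonoD: "x \<in> G n \<Longrightarrow> m \<le> n \<Longrightarrow> x \<in> G m"
  using G_antimono by blast

lemma open_G: "open (G n)" and compact_G: "compact (G n)"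
  using vilenkin by (auto simp: vilenkin_group_def)

lemma closed_G: "closed (G n)"
  by (rule compact_imp_closed[OF compact_G])

lemma Union_G: "\<exists>n. x \<in> G n"
proof -
  have "(\<Union>n. G n) = UNIV" using vilenkin by (simp add: vilenkin_group_def)
  then show ?thesis by blast
qed

lemma Inter_G: "x \<noteq> 0 \<Longrightarrow> \<exists>n. x \<notin> G n"
proof -
  have *: "(\<Inter>n. G n) = {0}" using vilenkin by (simp add: vilenkin_group_def)
  show "x \<noteq> 0 \<Longrightarrow> \<exists>n. x \<notin> G n" using * by blast
qed

lemma open_coset: "open (coset n x)"
proof -
  have "continuous_on UNIV (\<lambda>y. y - x)"
    by (intro continuous_intros)
  then have "open ((\<lambda>y. y - x) -` G n)"
    using open_G by (simp add: open_vimage)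
  then show ?thesis by (simp add: coset_def vimage_def)
qed

lemma G_measurable [measurable]: "G n \<in> sets borel"
  using open_G by simp

lemma coset_measurable [measurable]: "coset n x \<in> sets borel"
  using open_coset by simp

lemma in_coset [simp]: "x \<in> coset n x"
  by (simp add: coset_def)

lemma coset_eq: "y \<in> coset n x \<Longrightarrow> m \<le> n \<Longrightarrow> coset m y = coset m x"
  unfolding coset_def using G_antimonoD diff_in_G_trans diff_in_G_commute by blast

lemma coset_antimono: "m \<le> n \<Longrightarrow> coset n x \<subseteq> coset m x"
  unfolding coset_def using G_antimono by blast

lemma coset_image: "coset n x = (+) x ` G n"
proof -
  have "y \<in> (+) x ` G n" if "y - x \<in> G n" for y
    using that by (intro image_eqI[of _ _ "y - x"]) auto
  then show ?thesis by (auto simp: coset_def)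
qed

lemma emeasure_translate: "A \<in> sets borel \<Longrightarrow> emeasure \<mu> ((+) a ` A) = emeasure \<mu> A"
proof -
  have "\<forall>a. \<forall>A\<in>sets borel. emeasure \<mu> ((+) a ` A) = emeasure \<mu> A"
    using haar unfolding haar_measure_def by (elim conjE)
  then show "A \<in> sets borel \<Longrightarrow> emeasure \<mu> ((+) a ` A) = emeasure \<mu> A" by simp
qed

lemma emeasure_compact: "compact C \<Longrightarrow> emeasure \<mu> C < \<infinity>"
proof -
  have "\<forall>C. compact C \<longrightarrow> emeasure \<mu> C < \<infinity>"
    using haar unfolding haar_measure_def by (elim conjE)
  then show "compact C \<Longrightarrow> emeasure \<mu> C < \<infinity>" by simp
qed

lemma outer_regular:
  "A \<in> sets borel \<Longrightarrow> emeasure \<mu> A = (INF U\<in>{U. open U \<and> A \<subseteq> U}. emeasure \<mu> U)"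
  using haar unfolding haar_measure_def by blast

lemma finite_measure_G: "emeasure \<mu> (G n) < \<infinity>"
  by (rule emeasure_compact[OF compact_G])

lemma emeasure_G: "emeasure \<mu> (G n) = ennreal (V n)"
  using finite_measure_G[of n] by (simp add: V_def emeasure_eq_ennreal_measure less_top)

lemma emeasure_coset: "emeasure \<mu> (coset n x) = ennreal (V n)"
  by (simp add: coset_image emeasure_translate emeasure_G)

lemma V_nonneg: "0 \<le> V n"
  by (simp add: V_def)

text \<open>A proper subgroup leaves room for at least one further coset.\<close>

lemma V_double: "2 * V (n + 1) \<le> V n"
proof -
  obtain z where z: "z \<in> G n" "z \<notin> G (n + 1)"
    using G_strict_mono[of n] by blast
  have dis: "G (n + 1) \<inter> coset (n + 1) z = {}"
  proof -
    have False if "y \<in> G (n + 1)" "y - z \<in> G (n + 1)" for y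
      using diff_in_G[OF that] z(2) by simp
    then show ?thesis by (auto simp: coset_def)
  qed
  have sub: "G (n + 1) \<union> coset (n + 1) z \<subseteq> G n"
  proof -
    have "y \<in> G n" if "y - z \<in> G (n + 1)" for y
      using add_in_G[OF G_antimonoD[OF that, of n] z(1)] by simp
    then show ?thesis using G_strict_mono[of n] by (auto simp: coset_def)
  qed
  have "emeasure \<mu> (G (n + 1) \<union> coset (n + 1) z) = ennreal (V (n + 1)) + ennreal (V (n + 1))"
    using dis by (subst plus_emeasure[symmetric]) (auto simp: emeasure_G emeasure_coset)
  moreover have "emeasure \<mu> (G (n + 1) \<union> coset (n + 1) z) \<le> ennreal (V n)"
    unfolding emeasure_G[symmetric] by (rule emeasure_mono[OF sub]) simp
  ultimately show ?thesis
    by (simp add: V_nonneg flip: ennreal_plus)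
qed

text \<open>The cosets of \<open>G (n + 1)\<close> in \<open>G n\<close> all have the volume of \<open>G (n + 1)\<close> and cover \<open>G n\<close>.\<close>

lemma V_le_card: "V n \<le> card (cosets_of (G n) (G (n + 1))) * V (n + 1)"
proof -
  let ?R = "{(x, y). x \<in> G n \<and> y \<in> G n \<and> x - y \<in> G (n + 1)}"
  let ?Q = "cosets_of (G n) (G (n + 1))"
  have fin: "finite ?Q"
    using vilenkin by (simp add: vilenkin_group_def)
  have elem: "\<exists>x. q = coset (n + 1) x" if q: "q \<in> ?Q" for q
  proof -
    obtain x where x: "x \<in> G n" "q = ?R `` {x}"
      using q unfolding cosets_of_def by (elim quotientE) blast
    have "y \<in> G n" if "y - x \<in> G (n + 1)" for y
      using add_in_G[OF G_antimonoD[OF that, of n] x(1)] by simp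
    then have "q = coset (n + 1) x"
      using x unfolding coset_def by (auto simp: diff_in_G_commute)
    then show ?thesis by blast
  qed
  have cover: "G n \<subseteq> \<Union>?Q"
  proof
    fix x assume x: "x \<in> G n"
    have "?R `` {x} \<in> ?Q"
      unfolding cosets_of_def using x by (rule quotientI)
    moreover have "x \<in> ?R `` {x}" using x by simp
    ultimately show "x \<in> \<Union>?Q" by blast
  qed
  have meas: "q \<in> sets borel" and em: "emeasure \<mu> q = ennreal (V (n + 1))" if "q \<in> ?Q" for q
    using elem[OF that] emeasure_coset by auto
  have "ennreal (V n) \<le> emeasure \<mu> (\<Union>q\<in>?Q. q)"
    unfolding emeasure_G[symmetric] using meas cover
    by (intro emeasure_mono) (auto intro!: sets.finite_Union[OF fin])
  also have "\<dots> \<le> (\<Sum>q\<in>?Q. emeasure \<mu> q)"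
    using meas by (intro emeasure_subadditive_finite fin) auto
  also have "\<dots> = (\<Sum>q\<in>?Q. ennreal (V (n + 1)))"
    using em by (intro sum.cong) auto
  also have "\<dots> = ennreal (card ?Q * V (n + 1))"
    by (simp add: ennreal_mult V_nonneg ennreal_of_nat_eq_real_of_nat)
  finally show ?thesis
    by (simp add: V_nonneg)
qed

lemma V_pos: "0 < V n"
proof -
  have V0: "V 0 = 1"
    using normalized by (simp add: V_def measure_def)
  have "0 < V n" if "0 \<le> n" for n
    using that
  proof (induction n rule: int_ge_induct)
    case (step i)
    then show ?case using V_le_card[of i] V_nonneg[of "i + 1"]
      by (metis less_eq_real_def mult_zero_right not_less)
  qed (simp add: V0)
  moreover have "V m \<ge> V 0" if "m \<le> 0" for m
    unfolding V_def using finite_measure_G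
    by (intro measure_mono_fmeasurable G_antimono that) (auto simp: fmeasurable_def)
  ultimately show ?thesis
    using V0 by (cases "0 \<le> n") (simp, smt (verit))
qed

definition doubling :: "real \<Rightarrow> bool" where
  "doubling B \<longleftrightarrow> 1 \<le> B \<and> (\<forall>n. V n \<le> B * V (n + 1))"

lemma doubling_exists: "\<exists>B. doubling B"
proof -
  obtain M where M: "\<And>n. card (cosets_of (G n) (G (n + 1))) \<le> M"
    using vilenkin unfolding vilenkin_group_def bdd_above_def by auto
  have "V n \<le> max 1 (real M) * V (n + 1)" for n
  proof -
    have "V n \<le> card (cosets_of (G n) (G (n + 1))) * V (n + 1)"
      by (rule V_le_card)
    also have "\<dots> \<le> max 1 (real M) * V (n + 1)"
      using M[of n] V_nonneg by (intro mult_right_mono) auto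
    finally show ?thesis .
  qed
  then have "doubling (max 1 (real M))"
    by (simp add: doubling_def)
  then show ?thesis by blast
qed

lemma V_antimono: "m \<le> n \<Longrightarrow> V n \<le> V m"
  unfolding V_def using finite_measure_G
  by (intro measure_mono_fmeasurable G_antimono) (auto simp: fmeasurable_def)

lemma V_grows: "2 ^ k * V n \<le> V (n - int k)"
proof (induction k)
  case (Suc k)
  have "2 ^ Suc k * V n \<le> 2 * V (n - int k)"
    using Suc by simp
  also have "\<dots> \<le> V (n - int k - 1)"
    using V_double[of "n - int k - 1"] by simp
  finally show ?case by (simp add: algebra_simps)
qed simp

text \<open>Coarse scales have arbitrarily large volume; this is why every stopping procedure that
  descends from coarse to fine scales has a first step.\<close>

lemma V_unbounded: "\<exists>n\<le>m. c < V n"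
proof -
  obtain k where k: "c / V m < 2 ^ k"
    using real_arch_pow[of 2 "c / V m"] by auto
  then have "c < 2 ^ k * V m"
    using V_pos[of m] by (simp add: divide_less_eq)
  then have "c < V (m - int k)"
    using V_grows[of k m] by simp
  then show ?thesis by (intro exI[of _ "m - int k"]) simp
qed

lemma V_small: "0 < e \<Longrightarrow> \<exists>n. V n < e"
proof -
  assume e: "0 < e"
  obtain k where "V 0 / e < 2 ^ k"
    using real_arch_pow[of 2 "V 0 / e"] by auto
  then have "V 0 < 2 ^ k * e" using e by (simp add: divide_less_eq)
  moreover have "2 ^ k * V (int k) \<le> V 0" using V_grows[of k "int k"] by simp
  ultimately have "2 ^ k * V (int k) < 2 ^ k * e" by linarith
  then have "V (int k) < e" by simp
  then show ?thesis ..
qed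

text \<open>The annuli \<open>G n - G (n + 1)\<close> partition the nonzero elements, which makes the definite
  description in \<^const>\<open>vil_dist\<close> meaningful.\<close>

lemma annulus_exists:
  assumes "z \<noteq> 0"
  shows "\<exists>n. z \<in> G n - G (n + 1)"
proof -
  obtain a b where ab: "z \<in> G a" "z \<notin> G b"
    using Union_G Inter_G[OF assms] by meson
  have "a \<le> b" using ab G_antimonoD by (meson linear)
  then show ?thesis using ab(2)
  proof (induction b rule: int_ge_induct)
    case base
    then show ?case using ab(1) by blast
  next
    case (step i)
    then show ?case by (cases "z \<in> G i") auto
  qed
qed

lemma annulus_unique:
  assumes "z \<in> G n - G (n + 1)" "z \<in> G m - G (m + 1)"
  shows "m = n"
  using assms G_antimonoD[of z n "m + 1"] G_antimonoD[of z m "n + 1"] by (auto; linarith)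

lemma dist_annulus:
  assumes "x - y \<in> G n - G (n + 1)"
  shows "d x y = V n"
proof -
  have "(THE n. x - y \<in> G n - G (n + 1)) = n"
    using assms annulus_unique by blast
  then show ?thesis
    using assms zero_in_G[of "n + 1"] unfolding vil_dist_def vil_m_def V_def by auto
qed

lemma dist_self [simp]: "d x x = 0"
  by (simp add: vil_dist_def)

lemma dist_cases:
  assumes "x \<noteq> y"
  obtains n where "x - y \<in> G n" "x - y \<notin> G (n + 1)" "d x y = V n"
  using annulus_exists[of "x - y"] dist_annulus[of x y] assms by auto

lemma dist_pos: "x \<noteq> y \<Longrightarrow> 0 < d x y"
  by (metis dist_cases V_pos)

lemma dist_nonneg: "0 \<le> d x y"
  using dist_pos[of x y] by (cases "x = y") auto

lemma dist_le: "x - y \<in> G n \<Longrightarrow> d x y \<le> V n"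
proof (cases "x = y")
  case False
  assume *: "x - y \<in> G n"
  from False obtain m where m: "x - y \<notin> G (m + 1)" "d x y = V m"
    using dist_cases by metis
  then have "n \<le> m" using * G_antimonoD[of "x - y" n "m + 1"] by linarith
  then show ?thesis using m V_antimono by simp
qed (use V_nonneg in simp)

text \<open>The factor 2 is what makes the argument work without enlarging bad cosets: two points of a coset
  \<open>c + G n\<close> are at distance at most \<open>V n\<close>, hence at most half the distance from \<open>c\<close> to any point
  outside, which is exactly the range in which the kernel is regular.\<close>

lemma dist_ge:
  assumes "x - y \<notin> G n"
  shows "2 * V n \<le> d x y"
proof -
  have "x \<noteq> y" using assms by auto
  then obtain m where m: "x - y \<in> G m" "d x y = V m"
    using dist_cases by metis
  then have "m \<le> n - 1" using assms G_antimonoD[of "x - y" m n] by linarith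
  then have "V (n - 1) \<le> V m" by (rule V_antimono)
  then show ?thesis using m V_double[of "n - 1"] by simp
qed

text \<open>The cosets form a neighbourhood base: an open set containing \<open>x\<close> leaves a decreasing
  sequence of compact remainders with empty intersection.\<close>

lemma coset_in_open:
  assumes "open U" "x \<in> U"
  shows "\<exists>n. coset n x \<subseteq> U"
proof -
  have cont: "continuous_on UNIV (\<lambda>y. x + y)" by (intro continuous_intros)
  define W where "W = (\<lambda>y. x + y) -` U"
  have W: "open W" "0 \<in> W"
    using assms cont by (auto simp: W_def open_vimage)
  have "\<exists>n. G n \<subseteq> W"
  proof (rule ccontr)
    assume no: "\<not> ?thesis"
    \<comment> \<open>Finitely many remainders \<open>G n - W\<close> meet, since the finest of them is nonempty.\<close>
    have "G 0 \<inter> \<Inter>((\<lambda>n. G n - W) ` UNIV) \<noteq> {}"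
    proof (rule compact_imp_fip_image[OF compact_G])
      fix I' :: "int set" assume fin: "finite I'"
      define M where "M = Max (insert 0 I')"
      have "i \<le> M" if "i \<in> insert 0 I'" for i
        using that fin by (auto simp: M_def)
      then have "G M \<subseteq> G i" if "i \<in> insert 0 I'" for i
        using that G_antimono by blast
      moreover obtain z where "z \<in> G M - W" using no by blast
      ultimately have "z \<in> G 0 \<inter> (\<Inter>i\<in>I'. G i - W)" by blast
      then show "G 0 \<inter> (\<Inter>i\<in>I'. G i - W) \<noteq> {}" by blast
    qed (use closed_G W in auto)
    then obtain z where z: "\<And>n. z \<in> G n" "z \<notin> W" by blast
    then have "z = 0" using Inter_G by blast
    then show False using z W by simp
  qed
  then obtain n where "G n \<subseteq> W" ..
  then have "coset n x \<subseteq> U"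
    unfolding coset_image W_def by auto
  then show ?thesis ..
qed

section \<open>Summation over scales\<close>

text \<open>Up to constants, \<open>scale_sum s n x y\<close> is the kernel \<open>d x y powr (-1 - s)\<close> truncated at distance
  \<open>V n\<close>. Writing it as a combination of indicators of cosets of \<open>x\<close> reduces integrals against it to
  averages over those cosets.\<close>

definition scale_sum :: "real \<Rightarrow> int \<Rightarrow> 'a \<Rightarrow> 'a \<Rightarrow> ennreal" where
  "scale_sum s n x y = (\<Sum>k. ennreal (V (n - int k) powr (-1 - s)) * indicator (coset (n - int k) x) y)"

lemma scale_sum_measurable [measurable]: "scale_sum s n x \<in> borel_measurable borel"
  unfolding scale_sum_def[abs_def] by measurable

lemma scale_sum_ge:
  assumes "y \<in> coset m x" "m \<le> n"
  shows "ennreal (V m powr (-1 - s)) \<le> scale_sum s n x y"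
proof -
  let ?f = "\<lambda>k. ennreal (V (n - int k) powr (-1 - s)) * indicator (coset (n - int k) x) y"
  have "sum ?f {nat (n - m)} \<le> suminf ?f"
    by (rule sum_le_suminf) auto
  then show ?thesis using assms by (simp add: scale_sum_def)
qed

text \<open>Since the volume at least doubles from each scale to the next coarser one, bounded averages turn
  the sum over scales into a geometric series with ratio \<open>2 powr -s\<close>, dominated by its finest
  term.\<close>

lemma nn_integral_scale_sum:
  assumes s: "0 < s" and \<alpha>: "0 \<le> \<alpha>" and [measurable]: "h \<in> borel_measurable borel"
    and h: "\<And>m. m \<le> n \<Longrightarrow> (\<integral>\<^sup>+y. h y * indicator (coset m x) y \<partial>\<mu>) \<le> ennreal (\<alpha> * V m)"
  shows "(\<integral>\<^sup>+y. h y * scale_sum s n x y \<partial>\<mu>) \<le> ennreal (\<alpha> * V n powr (-s) / (1 - 2 powr (-s)))"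
proof -
  have q: "0 \<le> 2 powr (-s)" "2 powr (-s) < 1"
    using s by (auto intro: powr_less_one)
  have summand: "ennreal (V (n - int k) powr (-1 - s)) * (\<integral>\<^sup>+y. h y * indicator (coset (n - int k) x) y \<partial>\<mu>)
      \<le> ennreal (\<alpha> * V n powr (-s) * (2 powr (-s)) ^ k)" for k
  proof -
    let ?v = "V (n - int k)"
    have "?v powr (-1 - s) * ?v = ?v powr (-s)"
      using V_pos[of "n - int k"] powr_add[of ?v "-1 - s" 1] by simp
    also have "?v powr (-s) \<le> (2 ^ k * V n) powr (-s)"
      using V_grows[of k n] V_pos[of n] s by (intro powr_mono2') auto
    also have "(2 ^ k * V n) powr (-s) = V n powr (-s) * (2 powr (-s)) ^ k"
      using V_pos[of n] by (simp add: powr_mult powr_realpow[symmetric] powr_powr mult_ac)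
    finally have v: "?v powr (-1 - s) * ?v \<le> V n powr (-s) * (2 powr (-s)) ^ k" .
    have "ennreal (?v powr (-1 - s)) * (\<integral>\<^sup>+y. h y * indicator (coset (n - int k) x) y \<partial>\<mu>)
        \<le> ennreal (?v powr (-1 - s)) * ennreal (\<alpha> * ?v)"
      by (intro mult_left_mono h) auto
    also have "\<dots> = ennreal (\<alpha> * (?v powr (-1 - s) * ?v))"
      using \<alpha> V_nonneg by (simp add: ennreal_mult[symmetric] mult_ac)
    also have "\<dots> \<le> ennreal (\<alpha> * (V n powr (-s) * (2 powr (-s)) ^ k))"
      by (intro ennreal_leI mult_left_mono v \<alpha>)
    finally show ?thesis by (simp only: mult.assoc)
  qed
  have "(\<integral>\<^sup>+y. h y * scale_sum s n x y \<partial>\<mu>)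
      = (\<integral>\<^sup>+y. (\<Sum>k. ennreal (V (n - int k) powr (-1 - s)) * (h y * indicator (coset (n - int k) x) y)) \<partial>\<mu>)"
    unfolding scale_sum_def
    by (intro nn_integral_cong) (simp only: ennreal_suminf_cmult[symmetric] mult.left_commute)
  also have "\<dots> = (\<Sum>k. ennreal (V (n - int k) powr (-1 - s)) * (\<integral>\<^sup>+y. h y * indicator (coset (n - int k) x) y \<partial>\<mu>))"
    by (subst nn_integral_suminf) (auto simp: nn_integral_cmult)
  also have "\<dots> \<le> (\<Sum>k. ennreal (\<alpha> * V n powr (-s) * (2 powr (-s)) ^ k))"
    by (intro suminf_le summand) auto
  also have "\<dots> = ennreal (\<alpha> * V n powr (-s) * (1 / (1 - 2 powr (-s))))"
    using q \<alpha> by (intro suminf_ennreal_eq sums_mult geometric_sums) auto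
  finally show ?thesis by simp
qed

lemma scale_sum_ge_dist:
  assumes "x \<notin> coset n c"
  shows "ennreal (d x c powr (-1 - s)) \<le> scale_sum s n c x"
proof -
  have "x \<noteq> c" using assms by auto
  then obtain m where m: "x - c \<in> G m" "d x c = V m"
    using dist_cases by metis
  then have "m \<le> n"
    using assms G_antimonoD[of "x - c" m n] by (cases "m \<le> n") (auto simp: coset_def)
  then show ?thesis
    using scale_sum_ge[of x m c n s] m by (simp add: coset_def)
qed

lemma scale_sum_ge_kernel:
  assumes "0 < s" "0 < \<rho>" "\<rho> = V j"
  shows "ennreal (1 / (\<rho> + d x y) powr (2 + s)) \<le> scale_sum (1 + s) j x y"
proof -
  obtain m where m: "m \<le> j" "y \<in> coset m x" "V m \<le> \<rho> + d x y"
  proof (cases "y \<in> coset j x")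
    case True
    then show ?thesis using that[of j] assms dist_nonneg by simp
  next
    case False
    then have "x \<noteq> y" by auto
    then obtain m where m: "x - y \<in> G m" "d x y = V m"
      using dist_cases by metis
    have "y - x \<in> G m" using m diff_in_G_commute by blast
    then have "m \<le> j"
      using False G_antimonoD[of "y - x" m j] by (cases "m \<le> j") (auto simp: coset_def)
    then show ?thesis
      using that[of m] m assms diff_in_G_commute[of x y m] by (auto simp: coset_def)
  qed
  have "1 / (\<rho> + d x y) powr (2 + s) = (\<rho> + d x y) powr (- (2 + s))"
    by (rule powr_minus_divide[symmetric])
  also have "\<dots> \<le> V m powr (- (2 + s))"
    using m V_pos[of m] assms by (intro powr_mono2') auto
  also have "- (2 + s) = -1 - (1 + s)" by simp
  finally show ?thesis
    using scale_sum_ge[OF m(2,1), of "1 + s"] by (meson ennreal_leI order_trans)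
qed

section \<open>Test functions\<close>

lemma test_function_iff:
  "f \<in> S \<longleftrightarrow> (\<exists>k l. (\<forall>x. x \<notin> G k \<longrightarrow> f x = 0) \<and> (\<forall>x y. x - y \<in> G l \<longrightarrow> f x = f y))"
proof -
  have "supp f \<subseteq> G k \<longleftrightarrow> (\<forall>x. x \<notin> G k \<longrightarrow> f x = 0)" for k
  proof -
    have "supp f \<subseteq> G k \<longleftrightarrow> {x. f x \<noteq> 0} \<subseteq> G k"
      unfolding supp_def using closed_G by (meson closure_minimal closure_subset subset_trans)
    then show ?thesis by auto
  qed
  then show ?thesis
    by (simp add: test_functions_def)
qed

lemma test_function_combine:
  assumes f: "f \<in> S" and g: "g \<in> S" and h: "h 0 0 = 0"
  shows "(\<lambda>x. h (f x) (g x)) \<in> S"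
proof -
  obtain k l k' l' where *: "\<And>x. x \<notin> G k \<Longrightarrow> f x = 0" "\<And>x y. x - y \<in> G l \<Longrightarrow> f x = f y"
      "\<And>x. x \<notin> G k' \<Longrightarrow> g x = 0" "\<And>x y. x - y \<in> G l' \<Longrightarrow> g x = g y"
    using f g unfolding test_function_iff by metis
  have "h (f x) (g x) = 0" if "x \<notin> G (min k k')" for x
  proof -
    have "x \<notin> G k" "x \<notin> G k'" using that G_antimonoD[of x k "min k k'"] G_antimonoD[of x k' "min k k'"] by auto
    then show ?thesis using * h by simp
  qed
  moreover have "h (f x) (g x) = h (f y) (g y)" if "x - y \<in> G (max l l')" for x y
  proof -
    have "x - y \<in> G l" "x - y \<in> G l'" using G_antimonoD[OF that] by auto
    then show ?thesis using * by metis
  qed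
  ultimately show ?thesis unfolding test_function_iff by blast
qed

lemma S_add: "f \<in> S \<Longrightarrow> g \<in> S \<Longrightarrow> (\<lambda>x. f x + g x) \<in> S"
  by (rule test_function_combine) auto

lemma S_diff: "f \<in> S \<Longrightarrow> g \<in> S \<Longrightarrow> (\<lambda>x. f x - g x) \<in> S"
  by (rule test_function_combine) auto

lemma S_mult: "f \<in> S \<Longrightarrow> g \<in> S \<Longrightarrow> (\<lambda>x. f x * g x) \<in> S"
  by (rule test_function_combine) auto

lemma S_cmult: "f \<in> S \<Longrightarrow> (\<lambda>x. c * f x) \<in> S"
  using test_function_combine[of f f "\<lambda>u v. c * u"] by simp

lemma S_zero: "(\<lambda>x. 0) \<in> S"
  unfolding test_function_iff by simp

lemma S_sum: "(\<And>i. i \<in> I \<Longrightarrow> f i \<in> S) \<Longrightarrow> (\<lambda>x. \<Sum>i\<in>I. f i x) \<in> S"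
  by (induction I rule: infinite_finite_induct) (auto simp: S_zero S_add)

lemma S_indicator_coset: "indicator (coset n c) \<in> S"
proof -
  obtain k where k: "c \<in> G k" using Union_G by blast
  have "indicator (coset n c) x = (0::complex)" if "x \<notin> G (min k n)" for x
  proof -
    have "x \<notin> coset n c"
    proof
      assume "x \<in> coset n c"
      then have "x - c \<in> G (min k n)" by (auto simp: coset_def intro: G_antimonoD)
      moreover have "c \<in> G (min k n)" using k by (rule G_antimonoD) simp
      ultimately show False using that add_in_G[of "x - c" "min k n" c] by simp
    qed
    then show ?thesis by simp
  qed
  moreover have "indicator (coset n c) x = (indicator (coset n c) y :: complex)" if "x - y \<in> G n" for x y
    using that diff_in_G_trans[of x y n c] diff_in_G_trans[of y x n c] diff_in_G_commute[of x y n]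
    by (auto simp: indicator_def coset_def)
  ultimately show ?thesis unfolding test_function_iff by blast
qed

lemma closed_coset: "closed (coset n x)"
proof -
  have "continuous_on UNIV (\<lambda>y. y - x)"
    by (intro continuous_intros)
  then have "closed ((\<lambda>y. y - x) -` G n)"
    using closed_G by (simp add: closed_vimage)
  then show ?thesis by (simp add: coset_def vimage_def)
qed

text \<open>Cosets are closed, so vanishing off a coset confines the closed support to it. Kernel
  representations of the operator are available exactly off such supports.\<close>

lemma supp_subset_coset:
  assumes "\<And>x. x \<notin> coset n c \<Longrightarrow> f x = 0"
  shows "supp f \<subseteq> coset n c"
  unfolding supp_def by (rule closure_minimal[OF _ closed_coset]) (use assms in blast)

lemma continuous_cosetI:
  fixes h :: "'a \<Rightarrow> 'b::metric_space"
  assumes "\<And>x e. 0 < e \<Longrightarrow> \<exists>n. \<forall>y\<in>coset n x. dist (h y) (h x) < e"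
  shows "continuous_on UNIV h"
proof -
  have "(h \<longlongrightarrow> h x) (nhds x)" for x
  proof (rule tendstoI)
    fix e :: real assume "0 < e"
    then obtain n where "\<forall>y\<in>coset n x. dist (h y) (h x) < e"
      using assms by blast
    then show "\<forall>\<^sub>F y in nhds x. dist (h y) (h x) < e"
      unfolding eventually_nhds by (intro exI[of _ "coset n x"]) (auto simp: open_coset)
  qed
  then show ?thesis
    by (simp add: continuous_on_eq_continuous_at continuous_at tendsto_at_iff_tendsto_nhds)
qed

lemma S_continuous: "f \<in> S \<Longrightarrow> continuous_on UNIV f"
proof (rule continuous_cosetI)
  fix x and e :: real assume "f \<in> S" "0 < e"
  then obtain l where "\<And>x y. x - y \<in> G l \<Longrightarrow> f x = f y"
    unfolding test_function_iff by blast
  then show "\<exists>n. \<forall>y\<in>coset n x. dist (f y) (f x) < e"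
    using \<open>0 < e\<close> by (intro exI[of _ l]) (auto simp: coset_def)
qed

lemma S_measurable [measurable_dest]: "f \<in> S \<Longrightarrow> f \<in> borel_measurable borel"
  by (rule borel_measurable_continuous_onI[OF S_continuous])

lemma S_bounded: "f \<in> S \<Longrightarrow> \<exists>M\<ge>0. \<forall>x. cmod (f x) \<le> M"
proof -
  assume f: "f \<in> S"
  then obtain k where k: "\<And>x. x \<notin> G k \<Longrightarrow> f x = 0"
    unfolding test_function_iff by blast
  have "compact (f ` G k)"
    using continuous_on_subset[OF S_continuous[OF f]] compact_G by (intro compact_continuous_image) auto
  then have "bounded (f ` G k)" by (rule compact_imp_bounded)
  then obtain M where "\<forall>z\<in>f ` G k. cmod z \<le> M"
    unfolding bounded_iff ..
  then have M: "\<And>x. x \<in> G k \<Longrightarrow> cmod (f x) \<le> M" by simp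
  have "cmod (f x) \<le> max M 0" for x
    using M[of x] k[of x] by (cases "x \<in> G k") auto
  then show ?thesis by (intro exI[of _ "max M 0"]) auto
qed

lemma S_integrable: "f \<in> S \<Longrightarrow> integrable \<mu> f"
proof -
  assume f: "f \<in> S"
  then obtain k where k: "\<And>x. x \<notin> G k \<Longrightarrow> f x = 0"
    unfolding test_function_iff by blast
  obtain M where "\<And>x. cmod (f x) \<le> M" using S_bounded[OF f] by blast
  then show "integrable \<mu> f"
    using k finite_measure_G S_measurable[OF f]
    by (intro integrableI_bounded_set[of "G k" _ _ M]) (auto simp: measurable_cong_sets[OF sets_mu refl])
qed

lemma nn_integral_nrm: "integrable \<mu> f \<Longrightarrow> (\<integral>\<^sup>+x. ennreal (cmod (f x)) \<partial>\<mu>) = ennreal (nrm f)"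
  by (intro nn_integral_eq_integral) auto

section \<open>The Calderon--Zygmund decomposition\<close>

definition mass :: "('a \<Rightarrow> complex) \<Rightarrow> int \<Rightarrow> 'a \<Rightarrow> real" where
  "mass f n x = (LINT y|\<mu>. cmod (f y) * indicator (coset n x) y)"

text \<open>The coset of \<open>x\<close> at scale \<open>n\<close> is the largest one around \<open>x\<close> on which the average of the modulus of \<open>f\<close>
  exceeds \<open>\<alpha>\<close>; recall that a smaller index means a larger subgroup.\<close>

definition stops :: "('a \<Rightarrow> complex) \<Rightarrow> real \<Rightarrow> int \<Rightarrow> 'a \<Rightarrow> bool" where
  "stops f \<alpha> n x \<longleftrightarrow> \<alpha> * V n < mass f n x \<and> (\<forall>m<n. mass f m x \<le> \<alpha> * V m)"

lemma integrable_on_coset: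
  assumes "integrable \<mu> f"
  shows "integrable \<mu> (\<lambda>y. cmod (f y) * indicator (coset n x) y)"
  using integrable_mult_indicator[OF _ integrable_norm[OF assms], of "coset n x"]
  by (simp add: mult.commute)

lemma mass_le_nrm: "integrable \<mu> f \<Longrightarrow> mass f n x \<le> nrm f"
  unfolding mass_def by (intro integral_mono integrable_on_coset) (auto simp: indicator_def)

lemma mass_mono: "integrable \<mu> f \<Longrightarrow> m \<le> n \<Longrightarrow> mass f n x \<le> mass f m x"
  unfolding mass_def using coset_antimono[of m n x]
  by (intro integral_mono integrable_on_coset) (auto simp: indicator_def)

lemma mass_coset: "y \<in> coset n x \<Longrightarrow> m \<le> n \<Longrightarrow> mass f m y = mass f m x"
  by (simp add: mass_def coset_eq)

text \<open>At scales at which \<open>f\<close> no longer varies, averages of its modulus are values of its modulus.\<close>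

lemma mass_locally_constant:
  assumes "\<And>y. y \<in> coset n x \<Longrightarrow> f y = f x"
  shows "mass f n x = cmod (f x) * V n"
proof -
  have "cmod (f y) * indicator (coset n x) y = cmod (f x) * indicator (coset n x) y" for y
    using assms[of y] by (cases "y \<in> coset n x") simp_all
  then have "mass f n x = (LINT y|\<mu>. cmod (f x) * indicator (coset n x) y)"
    unfolding mass_def by (intro arg_cong[where f="lebesgue_integral \<mu>"] ext)
  also have "\<dots> = cmod (f x) * V n"
    using emeasure_coset[of n x] V_nonneg by (simp add: measure_def)
  finally show ?thesis .
qed

text \<open>Stopping at \<open>n\<close> depends only on the cosets of scale \<open>n\<close> and coarser, which all points of
  \<open>coset n x\<close> share. Hence two stopping cosets that meet are equal.\<close>

lemma stops_coset: "stops f \<alpha> n x \<Longrightarrow> y \<in> coset n x \<Longrightarrow> stops f \<alpha> n y"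
  by (simp add: stops_def mass_coset)

lemma stops_unique: "stops f \<alpha> n x \<Longrightarrow> stops f \<alpha> m x \<Longrightarrow> m = n"
  unfolding stops_def by (meson linorder_neqE not_less)

lemma stops_exists:
  assumes f: "integrable \<mu> f" and \<alpha>: "0 < \<alpha>" and n: "\<alpha> * V n < mass f n x"
  shows "\<exists>m. stops f \<alpha> m x"
proof -
  obtain n0 where n0: "nrm f / \<alpha> < V n0" using V_unbounded by blast
  let ?A = "{m. m \<le> n \<and> \<alpha> * V m < mass f m x}"
  have low: "n0 < m" if "\<alpha> * V m < mass f m x" for m
  proof (rule ccontr)
    assume "\<not> n0 < m"
    then have "nrm f / \<alpha> < V m" using V_antimono[of m n0] n0 by simp
    then have "nrm f < \<alpha> * V m" using \<alpha> by (simp add: divide_less_eq mult.commute)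
    then show False using that mass_le_nrm[OF f, of m x] by simp
  qed
  then have "?A \<subseteq> {n0..n}" by force
  then have fin: "finite ?A" by (rule finite_subset) simp
  have ne: "n \<in> ?A" using n by simp
  have "Min ?A \<in> ?A" using Min_in[OF fin] ne by blast
  moreover have "mass f m x \<le> \<alpha> * V m" if "m < Min ?A" for m
  proof (rule ccontr)
    assume "\<not> ?thesis"
    moreover have "m \<le> n" using that Min_le[OF fin ne] by simp
    ultimately have "m \<in> ?A" by simp
    then show False using Min_le[OF fin, of m] that by simp
  qed
  ultimately show ?thesis unfolding stops_def by blast
qed

text \<open>Refining beyond the scale at which \<open>f\<close> is constant does not change averages, so it cannot make
  them exceed \<open>\<alpha>\<close> for the first time. This bounds the volume of stopping cosets from below.\<close>

lemma stops_le_scale: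
  assumes "stops f \<alpha> n x" "\<And>x y. x - y \<in> G l \<Longrightarrow> f x = f y"
  shows "n \<le> l"
proof (rule ccontr)
  assume "\<not> n \<le> l"
  then have l: "l \<le> n - 1" by simp
  have const: "f y = f x" if "y \<in> coset m x" "l \<le> m" for y m
    using that assms(2)[of y x] G_antimonoD[of "y - x" m l] by (simp add: coset_def)
  have mass: "mass f m x = cmod (f x) * V m" if "l \<le> m" for m
    using that by (intro mass_locally_constant const)
  have "\<alpha> * V n < cmod (f x) * V n"
    using assms(1) mass[of n] l by (simp add: stops_def)
  then have "\<alpha> < cmod (f x)"
    using V_pos[of n] by simp
  moreover have "cmod (f x) * V (n - 1) \<le> \<alpha> * V (n - 1)"
    using assms(1) mass[of "n - 1"] l unfolding stops_def by (metis zle_diff1_eq order_refl)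
  then have "cmod (f x) \<le> \<alpha>"
    using V_pos[of "n - 1"] by simp
  ultimately show False by simp
qed

text \<open>The next larger coset has not stopped yet, and it is at most \<open>B\<close> times as large.\<close>

lemma stops_mass_le:
  assumes "stops f \<alpha> n x" "doubling B" "0 \<le> \<alpha>" "integrable \<mu> f"
  shows "mass f n x \<le> B * \<alpha> * V n"
proof -
  have "mass f n x \<le> mass f (n - 1) x"
    using assms by (intro mass_mono) auto
  also have "\<dots> \<le> \<alpha> * V (n - 1)"
    using assms by (simp add: stops_def)
  also have "\<dots> \<le> \<alpha> * (B * V n)"
    using assms(2) unfolding doubling_def
    by (intro mult_left_mono assms(3)) (metis diff_add_cancel)
  finally show ?thesis by (simp add: mult_ac)
qed

text \<open>The bad cosets are the stopping cosets, on which \<open>f\<close> is replaced by its mean to form \<open>g\<close>. They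
  are disjoint and each carries \<open>L\<^sup>1\<close> mass at least \<open>\<alpha>\<close> times its volume, which bounds their total
  volume; as their volumes are bounded below for a test function, they are finite in number. So all
  pieces are test functions and an operator can be expanded over them by bilinearity alone.

  The last conclusion says that \<open>\<alpha>\<close> dominates the maximal function of \<open>f\<close> off the bad cosets; it is
  what controls the second argument of the operator when the first one is bad.\<close>

lemma calderon_zygmund_decomposition:
  assumes B: "doubling B" and f: "f \<in> S" and \<alpha>: "0 < \<alpha>"
  obtains J :: "'a set set" and \<nu> :: "'a set \<Rightarrow> int" and c :: "'a set \<Rightarrow> 'a"
    and b :: "'a set \<Rightarrow> 'a \<Rightarrow> complex" and g :: "'a \<Rightarrow> complex"
  where "finite J" "\<And>I. I \<in> J \<Longrightarrow> I = coset (\<nu> I) (c I)"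
    "\<And>I. I \<in> J \<Longrightarrow> b I \<in> S" "\<And>I x. I \<in> J \<Longrightarrow> x \<notin> I \<Longrightarrow> b I x = 0"
    "\<And>I. I \<in> J \<Longrightarrow> (LINT x|\<mu>. b I x) = 0"
    "\<And>I. I \<in> J \<Longrightarrow> nrm (b I) \<le> 2 * B * \<alpha> * V (\<nu> I)"
    "\<alpha> * (\<Sum>I\<in>J. V (\<nu> I)) \<le> nrm f"
    "g \<in> S" "f = (\<lambda>x. g x + (\<Sum>I\<in>J. b I x))"
    "\<And>x. cmod (g x) \<le> B * \<alpha>" "nrm g \<le> (1 + 2 * B) * nrm f"
    "\<And>x m. x \<notin> \<Union>J \<Longrightarrow> mass f m x \<le> \<alpha> * V m"
proof -
  have B1: "1 \<le> B" using B by (simp add: doubling_def)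
  have f_int: "integrable \<mu> f" by (rule S_integrable[OF f])
  obtain l where l: "\<And>x y. x - y \<in> G l \<Longrightarrow> f x = f y"
    using f unfolding test_function_iff by blast
  define J where "J = {I. \<exists>w. I = coset (fst w) (snd w) \<and> stops f \<alpha> (fst w) (snd w)}"
  have "\<exists>w. \<forall>I\<in>J. I = coset (fst (w I)) (snd (w I)) \<and> stops f \<alpha> (fst (w I)) (snd (w I))"
    by (rule bchoice) (simp add: J_def)
  then obtain w where w: "\<And>I. I \<in> J \<Longrightarrow> I = coset (fst (w I)) (snd (w I))"
      "\<And>I. I \<in> J \<Longrightarrow> stops f \<alpha> (fst (w I)) (snd (w I))"
    by blast
  define \<nu> where "\<nu> I = fst (w I)" for I
  define c where "c I = snd (w I)" for I
  have J: "I = coset (\<nu> I) (c I)" "stops f \<alpha> (\<nu> I) (c I)" if "I \<in> J" for I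
    using w[OF that] by (simp_all add: \<nu>_def c_def)
  have J_sets [measurable]: "I \<in> sets borel" if "I \<in> J" for I
    using J(1)[OF that] coset_measurable by metis
  have in_J: "stops f \<alpha> (\<nu> I) x" "I = coset (\<nu> I) x" if "I \<in> J" "x \<in> I" for I x
    using J[OF that(1)] that(2) stops_coset coset_eq by (metis, metis order_refl)
  have disj: "I = I'" if "I \<in> J" "I' \<in> J" "x \<in> I" "x \<in> I'" for I I' x
    using in_J[OF that(1,3)] in_J[OF that(2,4)] stops_unique by metis
  have emI: "emeasure \<mu> I = ennreal (V (\<nu> I))" if "I \<in> J" for I
    using J(1)[OF that] emeasure_coset by metis
  have massI: "mass f (\<nu> I) (c I) = (LINT y|\<mu>. cmod (f y) * indicator I y)" if "I \<in> J" for I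
    using J(1)[OF that] unfolding mass_def by simp
  have intI: "integrable \<mu> (\<lambda>y. cmod (f y) * indicator I y)" if "I \<in> J" for I
    using J(1)[OF that] integrable_on_coset[OF f_int] by metis
  have packing: "\<alpha> * (\<Sum>I\<in>F. V (\<nu> I)) \<le> nrm f" if F: "finite F" "F \<subseteq> J" for F
  proof -
    have "\<alpha> * (\<Sum>I\<in>F. V (\<nu> I)) \<le> (\<Sum>I\<in>F. mass f (\<nu> I) (c I))"
      unfolding sum_distrib_left using F J(2) by (intro sum_mono) (auto simp: stops_def less_imp_le)
    also have "\<dots> = (LINT y|\<mu>. (\<Sum>I\<in>F. cmod (f y) * indicator I y))"
      using F intI massI by (subst Bochner_Integration.integral_sum) (auto intro!: sum.cong)
    also have "\<dots> \<le> nrm f"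
    proof (rule integral_mono)
      show "integrable \<mu> (\<lambda>y. \<Sum>I\<in>F. cmod (f y) * indicator I y)"
        using F intI by (intro Bochner_Integration.integrable_sum) auto
      show "integrable \<mu> (\<lambda>x. cmod (f x))" using f_int by simp
      fix y
      have "disjoint_family_on (\<lambda>I. I) F"
        using disj F unfolding disjoint_family_on_def by blast
      then have "(\<Sum>I\<in>F. indicator I y) = (indicator (\<Union>I\<in>F. I) y :: real)"
        by (rule indicator_UN_disjoint[OF F(1), symmetric])
      then have "(\<Sum>I\<in>F. indicator I y) \<le> (1::real)"
        by (simp add: indicator_def)
      then show "(\<Sum>I\<in>F. cmod (f y) * indicator I y) \<le> cmod (f y)"
        unfolding sum_distrib_left[symmetric] by (intro mult_left_le) auto
    qed
    finally show ?thesis .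
  qed
  \<comment> \<open>Stopping cosets are no finer than scale \<open>l\<close>, so packing bounds their number.\<close>
  have "finite J \<and> card J \<le> nat \<lfloor>nrm f / (\<alpha> * V l)\<rfloor>"
  proof (rule finite_if_finite_subsets_card_bdd)
    fix F assume F: "F \<subseteq> J" "finite F"
    have "V l \<le> V (\<nu> I)" if "I \<in> F" for I
      using stops_le_scale[OF J(2) l] that F by (intro V_antimono) auto
    then have "real (card F) * V l \<le> (\<Sum>I\<in>F. V (\<nu> I))"
      by (rule sum_bounded_below)
    then have "\<alpha> * (real (card F) * V l) \<le> nrm f"
      using packing[OF F(2,1)] \<alpha> by (meson less_imp_le mult_left_mono order_trans)
    then have "real (card F) \<le> nrm f / (\<alpha> * V l)"
      using \<alpha> V_pos[of l] by (simp add: le_divide_eq mult_ac)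
    then show "card F \<le> nat \<lfloor>nrm f / (\<alpha> * V l)\<rfloor>"
      by (simp add: le_nat_floor)
  qed
  then have finJ: "finite J" by simp
  define av where "av I = (LINT y|\<mu>. f y * indicator I y) / of_real (V (\<nu> I))" for I
  define b where "b I = (\<lambda>x. (f x - av I) * indicator I x)" for I
  define g where "g = (\<lambda>x. f x - (\<Sum>I\<in>J. b I x))"
  have ind: "indicator I \<in> S" if "I \<in> J" for I
    using J(1)[OF that] S_indicator_coset by metis
  have fI: "(\<lambda>x. f x * indicator I x) \<in> S" if "I \<in> J" for I
    by (intro S_mult f ind that)
  have b_eq: "b I = (\<lambda>x. f x * indicator I x - av I * indicator I x)" for I
    by (auto simp: b_def algebra_simps)
  have bS: "b I \<in> S" if "I \<in> J" for I
    unfolding b_eq by (intro S_diff fI S_cmult ind that)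
  have gS: "g \<in> S"
    unfolding g_def by (intro S_diff f S_sum bS)
  have av: "cmod (av I) \<le> mass f (\<nu> I) (c I) / V (\<nu> I)" if "I \<in> J" for I
  proof -
    have "cmod (LINT y|\<mu>. f y * indicator I y) \<le> (LINT y|\<mu>. cmod (f y * indicator I y))"
      by (rule integral_norm_bound)
    also have "\<dots> = mass f (\<nu> I) (c I)"
      unfolding massI[OF that] by (simp add: norm_mult indicator_def of_bool_def if_distrib cong: if_cong)
    finally show ?thesis
      using V_pos[of "\<nu> I"] by (simp add: av_def norm_divide divide_right_mono)
  qed
  have mI: "mass f (\<nu> I) (c I) \<le> B * \<alpha> * V (\<nu> I)" if "I \<in> J" for I
    using stops_mass_le[OF J(2)[OF that] B _ f_int] \<alpha> by simp
  have av_le: "cmod (av I) \<le> B * \<alpha>" if "I \<in> J" for I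
    using av[OF that] mI[OF that] V_pos[of "\<nu> I"]
    by (meson divide_le_eq order_trans)
  have int_ind: "(LINT x|\<mu>. indicator I x :: complex) = of_real (V (\<nu> I))" if "I \<in> J" for I
  proof -
    have "(LINT x|\<mu>. indicator I x :: complex) = (LINT x|\<mu>. complex_of_real (indicator I x))"
      by (simp only: of_real_indicator)
    also have "\<dots> = of_real (LINT x|\<mu>. indicator I x)"
      by (rule integral_complex_of_real)
    also have "\<dots> = of_real (V (\<nu> I))"
      using emI[OF that] V_nonneg that by (simp add: measure_def)
    finally show ?thesis .
  qed
  have b0: "(LINT x|\<mu>. b I x) = 0" if "I \<in> J" for I
    unfolding b_eq using S_integrable[OF fI[OF that]] S_integrable[OF ind[OF that]] int_ind[OF that] V_pos[of "\<nu> I"]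
    by (simp add: av_def)
  have b1: "nrm (b I) \<le> 2 * B * \<alpha> * V (\<nu> I)" if "I \<in> J" for I
  proof -
    have i1: "integrable \<mu> (\<lambda>x. indicator I x :: real)"
      using emI[OF that] that by (simp add: integrable_indicator_iff)
    have "nrm (b I) \<le> (LINT y|\<mu>. cmod (f y) * indicator I y + cmod (av I) * indicator I y)"
    proof (rule integral_mono)
      show "integrable \<mu> (\<lambda>x. cmod (b I x))"
        using S_integrable[OF bS[OF that]] by simp
      show "integrable \<mu> (\<lambda>y. cmod (f y) * indicator I y + cmod (av I) * indicator I y)"
        by (intro Bochner_Integration.integrable_add intI that integrable_mult_right i1)
      show "cmod (b I x) \<le> cmod (f x) * indicator I x + cmod (av I) * indicator I x" for x
        using norm_triangle_ineq4[of "f x" "av I"] by (simp add: b_def norm_mult indicator_def)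
    qed
    also have "\<dots> = mass f (\<nu> I) (c I) + cmod (av I) * V (\<nu> I)"
      using intI[OF that] i1 emI[OF that] V_nonneg that
      by (simp add: massI[OF that] measure_def)
    also have "\<dots> \<le> B * \<alpha> * V (\<nu> I) + B * \<alpha> * V (\<nu> I)"
      by (intro add_mono mI mult_right_mono av_le that V_nonneg)
    finally show ?thesis by simp
  qed
  have g_le: "cmod (g x) \<le> B * \<alpha>" for x
  proof (cases "x \<in> \<Union>J")
    case True
    then obtain I where I: "I \<in> J" "x \<in> I" by blast
    have "(\<Sum>I'\<in>J. b I' x) = (\<Sum>I'\<in>{I}. b I' x)"
      using I disj by (intro sum.mono_neutral_right finJ) (auto simp: b_def indicator_def)
    then have "g x = av I" using I by (simp add: g_def b_def)
    then show ?thesis using av_le[OF I(1)] by simp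
  next
    case False
    then have "g x = f x" by (simp add: g_def b_def indicator_def)
    moreover have "\<not> stops f \<alpha> m x" for m
      using False unfolding J_def by (auto dest!: spec[of _ "coset m x"] spec[of _ "(m, x)"])
    then have "mass f l x \<le> \<alpha> * V l"
      using stops_exists[OF f_int \<alpha>] by (meson not_less)
    then have "cmod (f x) * V l \<le> \<alpha> * V l"
      using mass_locally_constant[of l x f] l by (simp add: coset_def)
    then have "cmod (f x) \<le> \<alpha>" using V_pos[of l] by simp
    moreover have "\<alpha> \<le> B * \<alpha>" using B1 \<alpha> by simp
    ultimately show ?thesis by simp
  qed
  have g1: "nrm g \<le> (1 + 2 * B) * nrm f"
  proof -
    have ib: "integrable \<mu> (\<lambda>x. cmod (b I x))" if "I \<in> J" for I
      using S_integrable[OF bS[OF that]] by simp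
    have "nrm g \<le> (LINT x|\<mu>. cmod (f x) + (\<Sum>I\<in>J. cmod (b I x)))"
    proof (rule integral_mono)
      show "integrable \<mu> (\<lambda>x. cmod (g x))" using S_integrable[OF gS] by simp
      show "integrable \<mu> (\<lambda>x. cmod (f x) + (\<Sum>I\<in>J. cmod (b I x)))"
        using f_int ib by (intro Bochner_Integration.integrable_add Bochner_Integration.integrable_sum) auto
      show "cmod (g x) \<le> cmod (f x) + (\<Sum>I\<in>J. cmod (b I x))" for x
        unfolding g_def using norm_triangle_ineq4[of "f x" "\<Sum>I\<in>J. b I x"] norm_sum[of "\<lambda>I. b I x" J] by linarith
    qed
    also have "\<dots> = nrm f + (\<Sum>I\<in>J. nrm (b I))"
      using f_int ib by (simp add: Bochner_Integration.integral_sum)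
    also have "\<dots> \<le> nrm f + (\<Sum>I\<in>J. 2 * B * \<alpha> * V (\<nu> I))"
      by (intro add_left_mono sum_mono b1)
    also have "(\<Sum>I\<in>J. 2 * B * \<alpha> * V (\<nu> I)) = 2 * B * (\<alpha> * (\<Sum>I\<in>J. V (\<nu> I)))"
      by (simp add: sum_distrib_left mult_ac)
    also have "\<dots> \<le> 2 * B * nrm f"
      using packing[OF finJ order_refl] B1 by (intro mult_left_mono) auto
    finally show ?thesis by (simp add: algebra_simps)
  qed
  have off: "mass f m x \<le> \<alpha> * V m" if "x \<notin> \<Union>J" for x m
  proof -
    have "\<not> stops f \<alpha> m x" for m
      using that unfolding J_def by (auto dest!: spec[of _ "coset m x"] spec[of _ "(m, x)"])
    then show ?thesis
      using stops_exists[OF f_int \<alpha>] by (meson not_less)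
  qed
  have f_eq: "f = (\<lambda>x. g x + (\<Sum>I\<in>J. b I x))" by (simp add: g_def)
  have b_off: "b I x = 0" if "x \<notin> I" for I x using that by (simp add: b_def)
  show thesis
    by (rule that[OF finJ J(1) bS b_off b0 b1 packing[OF finJ order_refl] gS f_eq g_le g1 off])
qed

end

section \<open>Kernel estimates away from the bad cosets\<close>

text \<open>If \<open>b F\<close> is not integrable, its integral is 0 by convention and the bound is trivial. This is
  how the inner integrals of a kernel are treated as functions of the outer variable.\<close>

lemma integral_mean_zero_bound:
  fixes b F :: "'b \<Rightarrow> complex"
  assumes b: "integrable M b" and b0: "(LINT y|M. b y) = 0" and Q: "0 \<le> Q"
    and F: "\<And>y. b y \<noteq> 0 \<Longrightarrow> cmod (F y - F0) \<le> Q"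
  shows "cmod (LINT y|M. b y * F y) \<le> Q * (LINT y|M. cmod (b y))"
proof (cases "integrable M (\<lambda>y. b y * F y)")
  case True
  have i: "integrable M (\<lambda>y. b y * F y - b y * F0)"
    using True b by simp
  have "(LINT y|M. b y * F y) = (LINT y|M. b y * F y - b y * F0)"
    using True b b0 by simp
  also have "cmod \<dots> \<le> (LINT y|M. Q * cmod (b y))"
  proof (rule order_trans[OF integral_norm_bound integral_mono])
    show "integrable M (\<lambda>y. cmod (b y * F y - b y * F0))" using i by (rule integrable_norm)
    show "integrable M (\<lambda>y. Q * cmod (b y))" using b by simp
    show "cmod (b y * F y - b y * F0) \<le> Q * cmod (b y)" for y
    proof (cases "b y = 0")
      case False
      have "cmod (b y * F y - b y * F0) = cmod (b y) * cmod (F y - F0)"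
        by (simp only: right_diff_distrib[symmetric] norm_mult)
      also have "\<dots> \<le> cmod (b y) * Q"
        using F[OF False] by (rule mult_left_mono) simp
      finally show ?thesis by (simp add: mult.commute)
    qed simp
  qed
  finally show ?thesis by simp
next
  case False
  then show ?thesis using Q by (simp add: not_integrable_integral_eq)
qed

locale calderon_zygmund_kernel = vilenkin G \<mu>
  for G :: "int \<Rightarrow> 'a::{topological_ab_group_add, t2_space} set" and \<mu> +
  fixes K :: "'a \<Rightarrow> 'a \<Rightarrow> 'a \<Rightarrow> complex" and C \<epsilon> :: real
  assumes C_pos: "0 < C" and \<epsilon>_pos: "0 < \<epsilon>"
    and kernel_size: "\<And>x y1 y2. \<not> (x = y1 \<and> x = y2) \<Longrightarrow> cmod (K x y1 y2) \<le> C / (d x y1 + d x y2)\<^sup>2"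
    and kernel_regular1: "\<And>x y1 y2 z. \<not> (x = y1 \<and> x = y2) \<Longrightarrow> d y1 z \<le> 1 / 2 * max (d x y1) (d x y2) \<Longrightarrow>
      cmod (K x y1 y2 - K x z y2) \<le> C * d y1 z powr \<epsilon> / (d x y1 + d x y2) powr (2 + \<epsilon>)"
    and kernel_regular2: "\<And>x y1 y2 z. \<not> (x = y1 \<and> x = y2) \<Longrightarrow> d y2 z \<le> 1 / 2 * max (d x y1) (d x y2) \<Longrightarrow>
      cmod (K x y1 y2 - K x y1 z) \<le> C * d y2 z powr \<epsilon> / (d x y1 + d x y2) powr (2 + \<epsilon>)"
begin

text \<open>Regularity in \<open>y2\<close> makes this section continuous, because \<open>max (d x y1) (d x y2)\<close> stays away
  from 0 when \<open>x \<noteq> y1\<close>.\<close>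

lemma kernel_measurable:
  assumes "x \<noteq> y1"
  shows "K x y1 \<in> borel_measurable borel"
proof (rule borel_measurable_continuous_onI, rule continuous_cosetI)
  fix y2 and e :: real assume e: "0 < e"
  define \<rho> where "\<rho> = d x y1"
  have \<rho>: "0 < \<rho>" using dist_pos[OF assms] by (simp add: \<rho>_def)
  \<comment> \<open>\<open>\<delta>\<close> solves \<open>C * \<delta> powr \<epsilon> / \<rho> powr (2 + \<epsilon>) = e\<close>.\<close>
  define \<delta> where "\<delta> = (e * \<rho> powr (2 + \<epsilon>) / C) powr (1 / \<epsilon>)"
  have "0 < min (\<rho> / 2) \<delta>"
    using \<rho> e C_pos by (simp add: \<delta>_def)
  then obtain n where n: "V n < min (\<rho> / 2) \<delta>" using V_small by blast
  have "dist (K x y1 y) (K x y1 y2) < e" if "y \<in> coset n y2" for y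
  proof -
    have "y2 - y \<in> G n" using that diff_in_G_commute by (auto simp: coset_def)
    then have dy: "d y2 y \<le> V n" by (rule dist_le)
    have "cmod (K x y1 y2 - K x y1 y) \<le> C * d y2 y powr \<epsilon> / (d x y1 + d x y2) powr (2 + \<epsilon>)"
      using assms dy n by (intro kernel_regular2) (auto simp: \<rho>_def)
    also have "\<dots> \<le> C * V n powr \<epsilon> / \<rho> powr (2 + \<epsilon>)"
      using dy C_pos \<epsilon>_pos \<rho> dist_nonneg
      by (intro frac_le mult_left_mono powr_mono2) (auto simp: \<rho>_def)
    also have "\<dots> < C * \<delta> powr \<epsilon> / \<rho> powr (2 + \<epsilon>)"
      using n C_pos \<epsilon>_pos \<rho> V_nonneg
      by (intro divide_strict_right_mono mult_strict_left_mono powr_less_mono2) auto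
    also have "\<delta> powr \<epsilon> = e * \<rho> powr (2 + \<epsilon>) / C"
      using e \<rho> C_pos \<epsilon>_pos by (simp add: \<delta>_def powr_powr)
    also have "C * \<dots> / \<rho> powr (2 + \<epsilon>) = e"
      using C_pos \<rho> by simp
    finally show ?thesis by (simp add: dist_norm norm_minus_commute)
  qed
  then show "\<exists>n. \<forall>y\<in>coset n y2. dist (K x y1 y) (K x y1 y2) < e" by blast
qed

lemma kernel_integrable:
  assumes "x \<noteq> y1" "f \<in> S"
  shows "integrable \<mu> (\<lambda>y2. K x y1 y2 * f y2)"
proof (rule Bochner_Integration.integrable_bound)
  show "integrable \<mu> (\<lambda>y2. complex_of_real (C / (d x y1)\<^sup>2) * f y2)"
    by (intro integrable_mult_right S_integrable assms)
  show "(\<lambda>y2. K x y1 y2 * f y2) \<in> borel_measurable \<mu>"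
    using kernel_measurable[OF assms(1)] S_measurable[OF assms(2)] by simp
  have "cmod (K x y1 y2) \<le> C / (d x y1)\<^sup>2" for y2
  proof -
    have "cmod (K x y1 y2) \<le> C / (d x y1 + d x y2)\<^sup>2"
      using assms by (intro kernel_size) auto
    also have "\<dots> \<le> C / (d x y1)\<^sup>2"
      using dist_pos[OF assms(1)] dist_nonneg C_pos
      by (intro divide_left_mono power_mono mult_pos_pos zero_less_power) (auto intro: add_pos_nonneg)
    finally show ?thesis .
  qed
  then have "cmod (K x y1 y2 * f y2) \<le> cmod (complex_of_real (C / (d x y1)\<^sup>2) * f y2)" for y2
    using C_pos mult_right_mono[of "cmod (K x y1 y2)" "C / (d x y1)\<^sup>2" "cmod (f y2)"]
    by (simp add: norm_mult norm_divide norm_power)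
  then show "AE y2 in \<mu>. cmod (K x y1 y2 * f y2) \<le> cmod (complex_of_real (C / (d x y1)\<^sup>2) * f y2)"
    by simp
qed

text \<open>The denominators of the two geometric series that arise, with exponents \<open>1 + \<epsilon>\<close> and \<open>\<epsilon>\<close>.\<close>

definition q1 :: real where "q1 = 1 - 2 powr (-1 - \<epsilon>)"
definition q0 :: real where "q0 = 1 - 2 powr (- \<epsilon>)"

lemma q_pos: "0 < q1" "0 < q0"
  using \<epsilon>_pos powr_less_one[of 2 "- \<epsilon>"] powr_less_one[of 2 "-1 - \<epsilon>"] by (auto simp: q1_def q0_def)

lemma nn_integral_mass: "f \<in> S \<Longrightarrow> (\<integral>\<^sup>+y. ennreal (cmod (f y)) * indicator (coset m x) y \<partial>\<mu>) = ennreal (mass f m x)"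
  unfolding mass_def using integrable_on_coset[OF S_integrable]
  by (subst nn_integral_eq_integral[symmetric]) (auto intro!: nn_integral_cong simp: indicator_def)

text \<open>The hypothesis on \<open>mass f m x\<close> bounds the maximal function of \<open>f\<close> at the single point \<open>x\<close> by \<open>\<alpha>\<close>.
  Integrating the kernel bound of order \<open>2 + \<epsilon>\<close> over one variable then leaves order \<open>1 + \<epsilon>\<close> in the
  other one.\<close>

lemma potential_bound:
  assumes xc: "x \<noteq> c" and f: "f \<in> S" and \<alpha>: "0 \<le> \<alpha>" "\<And>m. mass f m x \<le> \<alpha> * V m" and A: "0 \<le> A"
    and h: "\<And>y. h y \<le> A / (d x c + d x y) powr (2 + \<epsilon>) * cmod (f y)"
  shows "(\<integral>\<^sup>+y. ennreal (h y) \<partial>\<mu>) \<le> ennreal (A * (\<alpha> * d x c powr (-1 - \<epsilon>) / q1))"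
proof -
  obtain j where j: "d x c = V j" using dist_cases[OF xc] by metis
  have [measurable]: "f \<in> borel_measurable borel" by (rule S_measurable[OF f])
  have "(\<integral>\<^sup>+y. ennreal (h y) \<partial>\<mu>) \<le> (\<integral>\<^sup>+y. ennreal A * (ennreal (cmod (f y)) * scale_sum (1 + \<epsilon>) j x y) \<partial>\<mu>)"
  proof (intro nn_integral_mono)
    fix y
    have "ennreal (h y) \<le> ennreal (A * (cmod (f y) * (1 / (d x c + d x y) powr (2 + \<epsilon>))))"
      using h[of y] by (intro ennreal_leI) (simp add: mult_ac)
    also have "\<dots> = ennreal A * (ennreal (cmod (f y)) * ennreal (1 / (d x c + d x y) powr (2 + \<epsilon>)))"
      using A by (simp only: ennreal_mult' norm_ge_zero)
    also have "\<dots> \<le> ennreal A * (ennreal (cmod (f y)) * scale_sum (1 + \<epsilon>) j x y)"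
      by (intro mult_left_mono scale_sum_ge_kernel \<epsilon>_pos dist_pos xc j) auto
    finally show "ennreal (h y) \<le> ennreal A * (ennreal (cmod (f y)) * scale_sum (1 + \<epsilon>) j x y)" .
  qed
  also have "\<dots> = ennreal A * (\<integral>\<^sup>+y. ennreal (cmod (f y)) * scale_sum (1 + \<epsilon>) j x y \<partial>\<mu>)"
    by (rule nn_integral_cmult) measurable
  also have "\<dots> \<le> ennreal A * ennreal (\<alpha> * V j powr (- (1 + \<epsilon>)) / (1 - 2 powr (- (1 + \<epsilon>))))"
    using \<epsilon>_pos \<alpha>
    by (intro mult_left_mono nn_integral_scale_sum) (auto simp: nn_integral_mass[OF f] intro!: ennreal_leI)
  also have "\<dots> = ennreal (A * (\<alpha> * d x c powr (-1 - \<epsilon>) / q1))"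
    unfolding j q1_def using A by (simp flip: ennreal_mult')
  finally show ?thesis .
qed

text \<open>The mean of \<open>b\<close> vanishes, so the kernel may be replaced by its difference with the kernel at
  \<open>y1 = c\<close>. Applied at the base point \<open>c\<close>, regularity gains the factor \<open>V n powr \<epsilon>\<close>
  with a denominator that no longer depends on \<open>y1\<close>.\<close>

lemma first_variable_bound:
  assumes x: "x \<notin> coset n c" and b: "b \<in> S" "\<And>y. y \<notin> coset n c \<Longrightarrow> b y = 0" "(LINT y|\<mu>. b y) = 0"
    and f: "f \<in> S" and \<alpha>: "0 \<le> \<alpha>" "\<And>m. mass f m x \<le> \<alpha> * V m"
  shows "cmod (LINT y1|\<mu>. (LINT y2|\<mu>. K x y1 y2 * b y1 * f y2))
    \<le> C * V n powr \<epsilon> * (\<alpha> * d x c powr (-1 - \<epsilon>) / q1) * nrm b"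
proof -
  have xc: "x \<noteq> c" using x by auto
  define F where "F y1 = (LINT y2|\<mu>. K x y1 y2 * f y2)" for y1
  have "cmod (F y1 - F c) \<le> C * V n powr \<epsilon> * (\<alpha> * d x c powr (-1 - \<epsilon>) / q1)" if y1: "y1 \<in> coset n c" for y1
  proof -
    have xy1: "x \<noteq> y1" using x y1 by auto
    have "c - y1 \<in> G n" using y1 diff_in_G_commute by (auto simp: coset_def)
    then have dcy: "d c y1 \<le> V n" by (rule dist_le)
    have dxc: "2 * V n \<le> d x c" using x by (intro dist_ge) (simp add: coset_def)
    have i: "integrable \<mu> (\<lambda>y2. K x y1 y2 * f y2)" "integrable \<mu> (\<lambda>y2. K x c y2 * f y2)"
      using kernel_integrable[OF xy1 f] kernel_integrable[OF xc f] by auto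
    have "F y1 - F c = (LINT y2|\<mu>. K x y1 y2 * f y2 - K x c y2 * f y2)"
      unfolding F_def using i by simp
    then have "ennreal (cmod (F y1 - F c)) \<le> (\<integral>\<^sup>+y2. ennreal (cmod (K x y1 y2 * f y2 - K x c y2 * f y2)) \<partial>\<mu>)"
      using integral_norm_bound_ennreal[OF Bochner_Integration.integrable_diff[OF i]] by simp
    also have "\<dots> \<le> ennreal (C * V n powr \<epsilon> * (\<alpha> * d x c powr (-1 - \<epsilon>) / q1))"
    proof (rule potential_bound[OF xc f \<alpha>])
      show "0 \<le> C * V n powr \<epsilon>" using C_pos by simp
      fix y2
      have "cmod (K x y1 y2 - K x c y2) \<le> C * d c y1 powr \<epsilon> / (d x c + d x y2) powr (2 + \<epsilon>)"
        unfolding norm_minus_commute[of "K x y1 y2"] using dcy dxc xc by (intro kernel_regular1) auto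
      also have "\<dots> \<le> C * V n powr \<epsilon> / (d x c + d x y2) powr (2 + \<epsilon>)"
        using dcy C_pos \<epsilon>_pos dist_nonneg by (intro divide_right_mono mult_left_mono powr_mono2) auto
      finally show "cmod (K x y1 y2 * f y2 - K x c y2 * f y2) \<le> C * V n powr \<epsilon> / (d x c + d x y2) powr (2 + \<epsilon>) * cmod (f y2)"
        unfolding left_diff_distrib[symmetric] norm_mult by (rule mult_right_mono) simp
    qed
    finally show ?thesis
      using C_pos \<alpha> q_pos by simp
  qed
  then have "cmod (LINT y1|\<mu>. b y1 * F y1) \<le> C * V n powr \<epsilon> * (\<alpha> * d x c powr (-1 - \<epsilon>) / q1) * nrm b"
    using b C_pos \<alpha> q_pos by (intro integral_mean_zero_bound[where ?F0.0 = "F c"] S_integrable) auto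
  also have "(LINT y1|\<mu>. b y1 * F y1) = (LINT y1|\<mu>. (LINT y2|\<mu>. K x y1 y2 * b y1 * f y2))"
    unfolding F_def by (simp only: integral_mult_right_zero[symmetric] mult_ac)
  finally show ?thesis .
qed

text \<open>Here the cancellation takes place in the inner integral, separately for each \<open>y1\<close>, including
  \<open>y1 = x\<close>, where the kernel is still regular because \<open>x\<close> is away from the support of \<open>b\<close>.\<close>

lemma second_variable_bound:
  assumes x: "x \<notin> coset n c" and b: "b \<in> S" "\<And>y. y \<notin> coset n c \<Longrightarrow> b y = 0" "(LINT y|\<mu>. b y) = 0"
    and f: "f \<in> S" and \<alpha>: "0 \<le> \<alpha>" "\<And>m. mass f m x \<le> \<alpha> * V m"
  shows "cmod (LINT y1|\<mu>. (LINT y2|\<mu>. K x y1 y2 * f y1 * b y2))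
    \<le> C * V n powr \<epsilon> * (\<alpha> * d x c powr (-1 - \<epsilon>) / q1) * nrm b"
proof -
  have xc: "x \<noteq> c" using x by auto
  have nb: "0 \<le> nrm b" by simp
  define H where "H y1 = (LINT y2|\<mu>. b y2 * K x y1 y2)" for y1
  have H: "cmod (H y1) \<le> C * V n powr \<epsilon> / (d x c + d x y1) powr (2 + \<epsilon>) * nrm b" for y1
    unfolding H_def
  proof (rule integral_mean_zero_bound[where ?F0.0 = "K x y1 c"])
    fix y2 assume "b y2 \<noteq> 0"
    then have y2: "y2 \<in> coset n c" using b by blast
    have "c - y2 \<in> G n" using y2 diff_in_G_commute by (auto simp: coset_def)
    then have dcy: "d c y2 \<le> V n" by (rule dist_le)
    have dxc: "2 * V n \<le> d x c" using x by (intro dist_ge) (simp add: coset_def)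
    have "cmod (K x y1 y2 - K x y1 c) \<le> C * d c y2 powr \<epsilon> / (d x y1 + d x c) powr (2 + \<epsilon>)"
      unfolding norm_minus_commute[of "K x y1 y2"] using dcy dxc xc by (intro kernel_regular2) auto
    also have "\<dots> \<le> C * V n powr \<epsilon> / (d x y1 + d x c) powr (2 + \<epsilon>)"
      using dcy C_pos \<epsilon>_pos dist_nonneg by (intro divide_right_mono mult_left_mono powr_mono2) auto
    finally show "cmod (K x y1 y2 - K x y1 c) \<le> C * V n powr \<epsilon> / (d x c + d x y1) powr (2 + \<epsilon>)"
      by (simp add: add.commute)
  qed (use b C_pos S_integrable in auto)
  have bound_nonneg: "0 \<le> C * V n powr \<epsilon> * (\<alpha> * d x c powr (-1 - \<epsilon>) / q1) * nrm b"
    using C_pos \<alpha> q_pos nb by simp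
  have "cmod (LINT y1|\<mu>. f y1 * H y1) \<le> C * V n powr \<epsilon> * (\<alpha> * d x c powr (-1 - \<epsilon>) / q1) * nrm b"
  proof (cases "integrable \<mu> (\<lambda>y1. f y1 * H y1)")
    case True
    have "ennreal (cmod (LINT y1|\<mu>. f y1 * H y1)) \<le> (\<integral>\<^sup>+y1. ennreal (cmod (f y1 * H y1)) \<partial>\<mu>)"
      by (rule integral_norm_bound_ennreal[OF True])
    also have "\<dots> \<le> ennreal (C * V n powr \<epsilon> * nrm b * (\<alpha> * d x c powr (-1 - \<epsilon>) / q1))"
    proof (rule potential_bound[OF xc f \<alpha>])
      show "0 \<le> C * V n powr \<epsilon> * nrm b" using C_pos nb by simp
      show "cmod (f y1 * H y1) \<le> C * V n powr \<epsilon> * nrm b / (d x c + d x y1) powr (2 + \<epsilon>) * cmod (f y1)" for y1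
        using mult_left_mono[OF H[of y1] norm_ge_zero[of "f y1"]] by (simp add: norm_mult mult_ac)
    qed
    also have "C * V n powr \<epsilon> * nrm b * (\<alpha> * d x c powr (-1 - \<epsilon>) / q1)
        = C * V n powr \<epsilon> * (\<alpha> * d x c powr (-1 - \<epsilon>) / q1) * nrm b"
      by (simp only: mult_ac)
    finally show ?thesis using bound_nonneg by (simp only: ennreal_le_iff)
  next
    case False
    then show ?thesis using bound_nonneg by (simp add: not_integrable_integral_eq)
  qed
  also have "(LINT y1|\<mu>. f y1 * H y1) = (LINT y1|\<mu>. (LINT y2|\<mu>. K x y1 y2 * f y1 * b y2))"
    unfolding H_def by (simp only: integral_mult_right_zero[symmetric] mult_ac)
  finally show ?thesis .
qed

end

section \<open>Lebesgue and weak Lebesgue norms\<close>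

lemma epowr_le:
  assumes "x \<le> ennreal y" "0 \<le> y" "0 \<le> a"
  shows "epowr x a \<le> ennreal (y powr a)"
proof -
  have "x \<noteq> \<infinity>" using assms(1) by (auto simp: top_unique)
  moreover have "enn2real x \<le> y" using assms(1,2) by (rule enn2real_leI[rotated])
  ultimately show ?thesis
    using assms by (simp add: epowr_def ennreal_leI powr_mono2)
qed

lemma weak_Lp_norm_measure_le:
  assumes weak: "weak_Lp_norm M r f \<le> ennreal X" and "0 \<le> X" "0 < r" "0 < t"
  shows "emeasure M {x \<in> space M. t < cmod (f x)} \<le> ennreal ((X / t) powr r)"
proof -
  let ?m = "emeasure M {x \<in> space M. t < cmod (f x)}"
  have le: "ennreal t * epowr ?m (1 / r) \<le> ennreal X"
    using assms unfolding weak_Lp_norm_def by (auto simp: SUP_le_iff)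
  have fin: "?m \<noteq> \<infinity>"
  proof
    assume "?m = \<infinity>"
    then have "ennreal t * epowr ?m (1 / r) = \<infinity>"
      using assms by (simp add: epowr_def ennreal_mult_top)
    then show False using le by (simp add: top_unique)
  qed
  then obtain m where m: "?m = ennreal m" "0 \<le> m" by (cases ?m) auto
  have "ennreal (t * m powr (1 / r)) \<le> ennreal X"
    using le m assms by (simp add: epowr_def ennreal_mult)
  then have "m powr (1 / r) \<le> X / t"
    using assms by (simp add: field_simps)
  then have "(m powr (1 / r)) powr r \<le> (X / t) powr r"
    using assms by (intro powr_mono2) auto
  then have "m \<le> (X / t) powr r"
    using m assms by (simp add: powr_powr)
  then show ?thesis using m by (simp add: ennreal_leI)
qed

lemma weak_Lp_norm_leI:
  assumes "0 \<le> X" "0 < r"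
    and "\<And>t. 0 < t \<Longrightarrow> emeasure M {x \<in> space M. t < cmod (f x)} \<le> ennreal ((X / t) powr r)"
  shows "weak_Lp_norm M r f \<le> ennreal X"
  unfolding weak_Lp_norm_def
proof (intro SUP_least)
  fix t :: real assume "t \<in> {0<..}"
  then have t: "0 < t" by simp
  have "epowr (emeasure M {x \<in> space M. t < cmod (f x)}) (1 / r) \<le> ennreal (((X / t) powr r) powr (1 / r))"
    using assms t by (intro epowr_le) auto
  also have "((X / t) powr r) powr (1 / r) = X / t"
    using assms t by (simp add: powr_powr)
  finally have "ennreal t * epowr (emeasure M {x \<in> space M. t < cmod (f x)}) (1 / r) \<le> ennreal t * ennreal (X / t)"
    by (rule mult_left_mono) simp
  also have "\<dots> = ennreal X"
    using assms t by (simp add: ennreal_mult[symmetric])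
  finally show "ennreal t * epowr (emeasure M {x \<in> space M. t < cmod (f x)}) (1 / r) \<le> ennreal X" .
qed

text \<open>The bounds behave as if \<open>f\<close> were at most \<open>Q\<close> on a set of measure \<open>\<sigma>\<close>. For \<open>p = \<infinity>\<close> the exponent
  \<open>enn2real (1 / p)\<close> is 0.\<close>

lemma Lp_norm_le_interpolation:
  assumes f: "integrable M f" and p: "1 \<le> p" and Q: "0 < Q" "\<And>x. cmod (f x) \<le> Q"
    and \<sigma>: "0 < \<sigma>" "(LINT x|M. cmod (f x)) \<le> Q * \<sigma>"
  shows "Lp_norm M p f \<le> ennreal (Q * \<sigma> powr enn2real (1 / p))"
proof (cases "p = \<infinity>")
  case True
  have "esssup M (\<lambda>x. ennreal (cmod (f x))) \<le> ennreal Q"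
    using f Q by (intro esssup_I) (auto simp: ennreal_leI)
  then show ?thesis using True \<sigma> by (simp add: Lp_norm_def)
next
  case False
  then obtain s where s: "p = ennreal s" "0 \<le> s" by (cases p) auto
  then have s1: "1 \<le> s" using p by (simp flip: ennreal_1)
  have "(\<integral>\<^sup>+x. ennreal (cmod (f x) powr s) \<partial>M) \<le> (\<integral>\<^sup>+x. ennreal (Q powr (s - 1) * cmod (f x)) \<partial>M)"
  proof (intro nn_integral_mono ennreal_leI)
    fix x
    have "cmod (f x) powr s = cmod (f x) powr (s - 1) * cmod (f x)"
      using powr_add[of "cmod (f x)" "s - 1" 1] by simp
    also have "\<dots> \<le> Q powr (s - 1) * cmod (f x)"
      using Q s1 by (intro mult_right_mono powr_mono2) auto
    finally show "cmod (f x) powr s \<le> Q powr (s - 1) * cmod (f x)" .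
  qed
  also have "\<dots> = ennreal (LINT x|M. Q powr (s - 1) * cmod (f x))"
    using f by (intro nn_integral_eq_integral) auto
  also have "\<dots> \<le> ennreal (Q powr (s - 1) * (Q * \<sigma>))"
    using \<sigma> by (intro ennreal_leI) (simp add: mult_left_mono)
  also have "Q powr (s - 1) * (Q * \<sigma>) = Q powr s * \<sigma>"
    using Q powr_add[of Q "s - 1" 1] by simp
  finally have "epowr (\<integral>\<^sup>+x. ennreal (cmod (f x) powr s) \<partial>M) (1 / s) \<le> ennreal ((Q powr s * \<sigma>) powr (1 / s))"
    using \<sigma> s1 by (intro epowr_le) auto
  also have "(Q powr s * \<sigma>) powr (1 / s) = Q * \<sigma> powr (1 / s)"
    using Q \<sigma> s1 by (simp add: powr_mult powr_powr)
  finally have "epowr (\<integral>\<^sup>+x. ennreal (cmod (f x) powr s) \<partial>M) (1 / s) \<le> ennreal (Q * \<sigma> powr (1 / s))" .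
  moreover have "enn2real (1 / p) = 1 / s"
    using s s1 by (simp add: divide_ennreal flip: ennreal_1)
  ultimately show ?thesis
    using False s by (simp add: Lp_norm_def)
qed

lemma exponents_real:
  assumes "1 \<le> p" "1 \<le> q" "0 < r" "1 / p + 1 / q = 1 / ennreal r"
  shows "enn2real (1 / p) + enn2real (1 / q) = 1 / r"
proof -
  have fin: "1 / p < top" if "1 \<le> p" for p :: ennreal
  proof (cases p)
    case (real s)
    then have "1 \<le> s" using that by (simp flip: ennreal_1)
    then show ?thesis using real by (simp add: divide_ennreal flip: ennreal_1)
  qed simp
  have "enn2real (1 / p) + enn2real (1 / q) = enn2real (1 / p + 1 / q)"
    using fin assms by (subst enn2real_plus) auto
  also have "\<dots> = 1 / r"
    using assms by (simp add: divide_ennreal flip: ennreal_1)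
  finally show ?thesis .
qed

section \<open>The weak-type estimate on test functions\<close>

context calderon_zygmund_kernel begin

text \<open>Integrating \<open>d x c powr (-1 - \<epsilon>)\<close> off a coset of volume \<open>V n\<close> costs \<open>V n powr -\<epsilon>\<close>, which exactly
  cancels the gain from regularity. Each bad piece thus contributes a multiple of its \<open>L\<^sup>1\<close> norm,
  and the Markov inequality concludes.\<close>

lemma bad_part_bound:
  assumes J: "finite J" and [measurable]: "E \<in> sets borel" "\<And>I. I \<in> J \<Longrightarrow> u I \<in> borel_measurable borel"
    and E: "\<And>I x. I \<in> J \<Longrightarrow> x \<in> E \<Longrightarrow> x \<notin> coset (\<nu> I) (c I)"
    and \<alpha>: "0 \<le> \<alpha>" and N: "\<And>I. I \<in> J \<Longrightarrow> 0 \<le> N I" and t: "0 < t"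
    and u: "\<And>I x. I \<in> J \<Longrightarrow> x \<in> E \<Longrightarrow>
      cmod (u I x) \<le> C * V (\<nu> I) powr \<epsilon> * (\<alpha> * d x (c I) powr (-1 - \<epsilon>) / q1) * N I"
  shows "emeasure \<mu> {x \<in> E. t < (\<Sum>I\<in>J. cmod (u I x))} \<le> ennreal (C * \<alpha> / (q1 * q0) * (\<Sum>I\<in>J. N I) / t)"
proof -
  let ?U = "\<lambda>x. ennreal (\<Sum>I\<in>J. cmod (u I x))"
  have one: "(\<integral>\<^sup>+x. ennreal (cmod (u I x)) * indicator E x \<partial>\<mu>) \<le> ennreal (C * \<alpha> / (q1 * q0) * N I)" if I: "I \<in> J" for I
  proof -
    let ?A = "C * V (\<nu> I) powr \<epsilon> * \<alpha> / q1 * N I"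
    have A: "0 \<le> ?A" using C_pos \<alpha> q_pos N[OF I] by simp
    have "(\<integral>\<^sup>+x. ennreal (cmod (u I x)) * indicator E x \<partial>\<mu>)
        \<le> (\<integral>\<^sup>+x. ennreal ?A * scale_sum \<epsilon> (\<nu> I) (c I) x \<partial>\<mu>)"
    proof (intro nn_integral_mono)
      fix x
      show "ennreal (cmod (u I x)) * indicator E x \<le> ennreal ?A * scale_sum \<epsilon> (\<nu> I) (c I) x"
      proof (cases "x \<in> E")
        case True
        have "ennreal (cmod (u I x)) \<le> ennreal (?A * d x (c I) powr (-1 - \<epsilon>))"
          using u[OF I True] by (intro ennreal_leI) (simp add: mult_ac)
        also have "\<dots> = ennreal ?A * ennreal (d x (c I) powr (-1 - \<epsilon>))"
          by (rule ennreal_mult'[OF A])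
        also have "\<dots> \<le> ennreal ?A * scale_sum \<epsilon> (\<nu> I) (c I) x"
          by (intro mult_left_mono scale_sum_ge_dist E I True) auto
        finally show ?thesis using True by simp
      qed simp
    qed
    also have "\<dots> = ennreal ?A * (\<integral>\<^sup>+x. 1 * scale_sum \<epsilon> (\<nu> I) (c I) x \<partial>\<mu>)"
      by (simp add: nn_integral_cmult)
    also have "\<dots> \<le> ennreal ?A * ennreal (1 * V (\<nu> I) powr (-\<epsilon>) / (1 - 2 powr (-\<epsilon>)))"
      by (intro mult_left_mono nn_integral_scale_sum \<epsilon>_pos) (auto simp: emeasure_coset)
    also have "\<dots> = ennreal (?A * (1 * V (\<nu> I) powr (-\<epsilon>) / q0))"
      unfolding q0_def by (rule ennreal_mult'[OF A, symmetric])
    also have "?A * (1 * V (\<nu> I) powr (-\<epsilon>) / q0) = C * \<alpha> / (q1 * q0) * N I"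
      using V_pos[of "\<nu> I"] by (simp add: powr_minus field_simps)
    finally show ?thesis .
  qed
  have U: "(\<integral>\<^sup>+x. ?U x * indicator E x \<partial>\<mu>) \<le> ennreal (C * \<alpha> / (q1 * q0) * (\<Sum>I\<in>J. N I))"
  proof -
    have "(\<integral>\<^sup>+x. ?U x * indicator E x \<partial>\<mu>) = (\<integral>\<^sup>+x. (\<Sum>I\<in>J. ennreal (cmod (u I x)) * indicator E x) \<partial>\<mu>)"
      by (simp add: sum_distrib_right flip: sum_ennreal)
    also have "\<dots> = (\<Sum>I\<in>J. \<integral>\<^sup>+x. ennreal (cmod (u I x)) * indicator E x \<partial>\<mu>)"
      by (rule nn_integral_sum) measurable
    also have "\<dots> \<le> (\<Sum>I\<in>J. ennreal (C * \<alpha> / (q1 * q0) * N I))"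
      by (intro sum_mono one)
    also have "\<dots> = ennreal (C * \<alpha> / (q1 * q0) * (\<Sum>I\<in>J. N I))"
      unfolding sum_distrib_left using C_pos \<alpha> q_pos N by (intro sum_ennreal) auto
    finally show ?thesis .
  qed
  have "emeasure \<mu> {x \<in> E. t < (\<Sum>I\<in>J. cmod (u I x))} \<le> emeasure \<mu> {x \<in> E. 1 \<le> ennreal (1 / t) * ?U x}"
  proof (rule emeasure_mono)
    have "1 \<le> ennreal (1 / t) * ?U x" if "t < (\<Sum>I\<in>J. cmod (u I x))" for x
      using that t by (simp add: ennreal_mult[symmetric] sum_nonneg flip: ennreal_1)
    then show "{x \<in> E. t < (\<Sum>I\<in>J. cmod (u I x))} \<subseteq> {x \<in> E. 1 \<le> ennreal (1 / t) * ?U x}" by blast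
    show "{x \<in> E. 1 \<le> ennreal (1 / t) * ?U x} \<in> sets \<mu>" by measurable
  qed
  also have "\<dots> \<le> ennreal (1 / t) * (\<integral>\<^sup>+x. ?U x * indicator E x \<partial>\<mu>)"
    by (rule nn_integral_Markov_inequality) measurable
  also have "\<dots> \<le> ennreal (1 / t) * ennreal (C * \<alpha> / (q1 * q0) * (\<Sum>I\<in>J. N I))"
    by (intro mult_left_mono U) auto
  also have "\<dots> = ennreal (C * \<alpha> / (q1 * q0) * (\<Sum>I\<in>J. N I) / t)"
    using t by (simp add: mult_ac flip: ennreal_mult')
  finally show ?thesis .
qed

lemma mass_bounded:
  assumes "f \<in> S" "\<And>x. cmod (f x) \<le> Q"
  shows "mass f m x \<le> Q * V m"
proof -
  have i: "integrable \<mu> (indicator (coset m x) :: 'a \<Rightarrow> real)"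
    using emeasure_coset[of m x] by (simp add: integrable_indicator_iff)
  have "mass f m x \<le> (LINT y|\<mu>. Q * indicator (coset m x) y)"
    unfolding mass_def using assms
    by (intro integral_mono integrable_on_coset S_integrable integrable_mult_right i mult_right_mono) auto
  also have "\<dots> = Q * V m"
    using emeasure_coset[of m x] V_nonneg by (simp add: measure_def)
  finally show ?thesis .
qed

end

lemma bilinear_opD:
  assumes "bilinear_op M X Y T"
  shows "f \<in> X \<Longrightarrow> g \<in> Y \<Longrightarrow> T f g \<in> borel_measurable M"
    and "f \<in> X \<Longrightarrow> f' \<in> X \<Longrightarrow> g \<in> Y \<Longrightarrow> AE x in M. T (\<lambda>z. f z + f' z) g x = T f g x + T f' g x"
    and "f \<in> X \<Longrightarrow> g \<in> Y \<Longrightarrow> g' \<in> Y \<Longrightarrow> AE x in M. T f (\<lambda>z. g z + g' z) x = T f g x + T f g' x"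
    and "f \<in> X \<Longrightarrow> g \<in> Y \<Longrightarrow> AE x in M. T (\<lambda>z. a * f z) g x = a * T f g x"
    and "f \<in> X \<Longrightarrow> g \<in> Y \<Longrightarrow> AE x in M. T f (\<lambda>z. a * g z) x = a * T f g x"
  using assms by (simp_all add: bilinear_op_def)

context vilenkin begin

lemma bilinear_AE_zero:
  assumes "bilinear_op \<mu> X Y T" "f \<in> X" "g \<in> Y"
  shows "AE x in \<mu>. T (\<lambda>z. 0) g x = 0" "AE x in \<mu>. T f (\<lambda>z. 0) x = 0"
proof -
  have "AE x in \<mu>. T (\<lambda>z. 0 * f z) g x = 0 * T f g x" "AE x in \<mu>. T f (\<lambda>z. 0 * g z) x = 0 * T f g x"
    by (rule bilinear_opD(4)[OF assms] bilinear_opD(5)[OF assms])+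
  then show "AE x in \<mu>. T (\<lambda>z. 0) g x = 0" "AE x in \<mu>. T f (\<lambda>z. 0) x = 0" by auto
qed

lemma bilinear_AE_sum1:
  assumes T: "bilinear_op \<mu> S S T" and "finite J" and g: "g \<in> S" and "\<And>I. I \<in> J \<Longrightarrow> b I \<in> S"
  shows "AE x in \<mu>. T (\<lambda>z. \<Sum>I\<in>J. b I z) g x = (\<Sum>I\<in>J. T (b I) g x)"
  using assms(2,4)
proof (induction J rule: finite_induct)
  case empty
  then show ?case using bilinear_AE_zero(1)[OF T g g] by simp
next
  case (insert I J)
  have "AE x in \<mu>. T (\<lambda>z. b I z + (\<Sum>I\<in>J. b I z)) g x = T (b I) g x + T (\<lambda>z. \<Sum>I\<in>J. b I z) g x"
    using insert.prems by (intro bilinear_opD(2)[OF T] S_sum g) auto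
  moreover have "AE x in \<mu>. T (\<lambda>z. \<Sum>I\<in>J. b I z) g x = (\<Sum>I\<in>J. T (b I) g x)"
    using insert by auto
  ultimately show ?case
    unfolding sum.insert[OF insert.hyps] by eventually_elim simp
qed

lemma bilinear_AE_sum2:
  assumes T: "bilinear_op \<mu> S S T" and "finite J" and f: "f \<in> S" and "\<And>I. I \<in> J \<Longrightarrow> b I \<in> S"
  shows "AE x in \<mu>. T f (\<lambda>z. \<Sum>I\<in>J. b I z) x = (\<Sum>I\<in>J. T f (b I) x)"
  using assms(2,4)
proof (induction J rule: finite_induct)
  case empty
  then show ?case using bilinear_AE_zero(2)[OF T f f] by simp
next
  case (insert I J)
  have "AE x in \<mu>. T f (\<lambda>z. b I z + (\<Sum>I\<in>J. b I z)) x = T f (b I) x + T f (\<lambda>z. \<Sum>I\<in>J. b I z) x"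
    using insert.prems by (intro bilinear_opD(3)[OF T] S_sum f) auto
  moreover have "AE x in \<mu>. T f (\<lambda>z. \<Sum>I\<in>J. b I z) x = (\<Sum>I\<in>J. T f (b I) x)"
    using insert by auto
  ultimately show ?case
    unfolding sum.insert[OF insert.hyps] by eventually_elim simp
qed

lemma nrm_zero_imp_zero:
  assumes f: "f \<in> S" and 0: "nrm f = 0"
  shows "f = (\<lambda>x. 0)"
proof
  fix x
  obtain l where l: "\<And>x y. x - y \<in> G l \<Longrightarrow> f x = f y"
    using f unfolding test_function_iff by blast
  have "mass f l x = cmod (f x) * V l"
    using l by (intro mass_locally_constant) (simp add: coset_def)
  moreover have "mass f l x \<le> 0"
    using mass_le_nrm[OF S_integrable[OF f], of l x] 0 by simp
  ultimately show "f x = 0" using V_pos[of l] by (simp add: mult_le_0_iff)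
qed

end

context calderon_zygmund_kernel begin

text \<open>The heights of the two decompositions are chosen for the exponent \<open>1 / 2\<close> on the right: with
  \<open>\<sigma> = sqrt (nrm f * nrm g / t)\<close>, cutting \<open>f\<close> at \<open>nrm f / \<sigma>\<close> and \<open>g\<close> at \<open>nrm g / \<sigma>\<close> makes both
  bad sets have measure at most \<open>\<sigma>\<close>, while the product of the heights is \<open>t\<close>. The operator then splits
  as \<open>T f g = T f0 g0 + T f0 (bad part of g) + T (bad part of f) g\<close>. Keeping the full \<open>g\<close> in the last
  term avoids a separate treatment of two bad arguments: off the bad set of \<open>g\<close> the maximal function
  of \<open>g\<close> is at most the height at which \<open>g\<close> was cut.\<close>

lemma weak_type_estimate:
  assumes T: "bilinear_op \<mu> S S T" and assoc: "associated_with G \<mu> T K"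
    and pqr: "1 \<le> p" "1 \<le> q" "0 < r" "1 / p + 1 / q = 1 / ennreal r"
    and ext: "extends_boundedly G \<mu> p q r T"
  shows "\<exists>A\<ge>0. \<forall>f\<in>S. \<forall>g\<in>S. \<forall>t>0.
    emeasure \<mu> {x. t < cmod (T f g x)} \<le> ennreal (A * sqrt (nrm f * nrm g / t))"
proof -
  obtain B where B: "doubling B" using doubling_exists by blast
  have B1: "1 \<le> B" using B by (simp add: doubling_def)
  obtain T' A where T'S: "\<And>f g. f \<in> S \<Longrightarrow> g \<in> S \<Longrightarrow> AE x in \<mu>. T' f g x = T f g x"
    and T'm: "bilinear_op \<mu> (Lp \<mu> p) (Lp \<mu> q) T'"
    and T'A: "\<And>f g. f \<in> Lp \<mu> p \<Longrightarrow> g \<in> Lp \<mu> q \<Longrightarrow>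
        weak_Lp_norm \<mu> r (T' f g) \<le> ennreal A * Lp_norm \<mu> p f * Lp_norm \<mu> q g"
    using ext unfolding extends_boundedly_def by blast
  define A' where "A' = max A 0"
  define D where "D = 1 + 2 * B"
  have D: "0 < D" "B \<le> D" using B1 by (simp_all add: D_def)
  \<comment> \<open>The summands belong to the good part, to the two bad sets, and to the two bad parts.\<close>
  define A0 where "A0 = (3 * A' * D\<^sup>2) powr r + 2 + 6 * C * B / (q1 * q0) + 6 * C * B\<^sup>2 / (q1 * q0)"
  have A0: "0 \<le> A0"
    using C_pos B1 q_pos by (simp add: A0_def)
  have Tm: "T f g \<in> borel_measurable borel" if "f \<in> S" "g \<in> S" for f g
    using bilinear_opD(1)[OF T that] by simp
  have main: "emeasure \<mu> {x. t < cmod (T f g x)} \<le> ennreal (A0 * sqrt (nrm f * nrm g / t))"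
    if f: "f \<in> S" and g: "g \<in> S" and t: "0 < t" and pos: "0 < nrm f" "0 < nrm g" for f g t
  proof -
    \<comment> \<open>\<open>\<sigma>\<close> is the measure that the level set may have, up to a constant.\<close>
    define \<sigma> where "\<sigma> = sqrt (nrm f * nrm g / t)"
    have \<sigma>: "0 < \<sigma>" "\<sigma>\<^sup>2 = nrm f * nrm g / t" using t pos by (simp_all add: \<sigma>_def)
    define \<alpha> where "\<alpha> = nrm f / \<sigma>"
    define \<beta> where "\<beta> = nrm g / \<sigma>"
    have ab: "0 < \<alpha>" "0 < \<beta>" "\<alpha> * \<sigma> = nrm f" "\<beta> * \<sigma> = nrm g"
      using \<sigma> pos by (simp_all add: \<alpha>_def \<beta>_def)
    have prod: "\<alpha> * \<beta> = t"
    proof -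
      have "(\<alpha> * \<beta>) * \<sigma>\<^sup>2 = nrm f * nrm g"
        unfolding ab(3,4)[symmetric] by (simp add: power2_eq_square mult_ac)
      also have "\<dots> = t * \<sigma>\<^sup>2" using \<sigma> t by simp
      finally have "\<alpha> * \<beta> * \<sigma>\<^sup>2 = t * \<sigma>\<^sup>2" .
      moreover have "\<sigma>\<^sup>2 \<noteq> 0" using \<sigma>(1) by simp
      ultimately show ?thesis by (metis mult_right_cancel)
    qed
    obtain J \<nu> c b f0 where J: "finite J" "\<And>I. I \<in> J \<Longrightarrow> I = coset (\<nu> I) (c I)"
      and b: "\<And>I. I \<in> J \<Longrightarrow> b I \<in> S" "\<And>I x. I \<in> J \<Longrightarrow> x \<notin> I \<Longrightarrow> b I x = 0"
        "\<And>I. I \<in> J \<Longrightarrow> (LINT x|\<mu>. b I x) = 0" "\<And>I. I \<in> J \<Longrightarrow> nrm (b I) \<le> 2 * B * \<alpha> * V (\<nu> I)"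
      and JV: "\<alpha> * (\<Sum>I\<in>J. V (\<nu> I)) \<le> nrm f"
      and f0: "f0 \<in> S" "f = (\<lambda>x. f0 x + (\<Sum>I\<in>J. b I x))" "\<And>x. cmod (f0 x) \<le> B * \<alpha>" "nrm f0 \<le> (1 + 2 * B) * nrm f"
      and offJ: "\<And>x m. x \<notin> \<Union>J \<Longrightarrow> mass f m x \<le> \<alpha> * V m"
      by (rule calderon_zygmund_decomposition[OF B f ab(1)]) blast
    obtain J' \<nu>' c' b' g0 where J': "finite J'" "\<And>I. I \<in> J' \<Longrightarrow> I = coset (\<nu>' I) (c' I)"
      and b': "\<And>I. I \<in> J' \<Longrightarrow> b' I \<in> S" "\<And>I x. I \<in> J' \<Longrightarrow> x \<notin> I \<Longrightarrow> b' I x = 0"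
        "\<And>I. I \<in> J' \<Longrightarrow> (LINT x|\<mu>. b' I x) = 0" "\<And>I. I \<in> J' \<Longrightarrow> nrm (b' I) \<le> 2 * B * \<beta> * V (\<nu>' I)"
      and JV': "\<beta> * (\<Sum>I\<in>J'. V (\<nu>' I)) \<le> nrm g"
      and g0: "g0 \<in> S" "g = (\<lambda>x. g0 x + (\<Sum>I\<in>J'. b' I x))" "\<And>x. cmod (g0 x) \<le> B * \<beta>" "nrm g0 \<le> (1 + 2 * B) * nrm g"
      and offJ': "\<And>x m. x \<notin> \<Union>J' \<Longrightarrow> mass g m x \<le> \<beta> * V m"
      by (rule calderon_zygmund_decomposition[OF B g ab(2)]) blast
    have J_sets: "I \<in> sets borel" "emeasure \<mu> I = ennreal (V (\<nu> I))" if "I \<in> J" for I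
      using J(2)[OF that] coset_measurable emeasure_coset by (metis, metis)
    have J'_sets: "I \<in> sets borel" "emeasure \<mu> I = ennreal (V (\<nu>' I))" if "I \<in> J'" for I
      using J'(2)[OF that] coset_measurable emeasure_coset by (metis, metis)
    define E where "E = - (\<Union>J \<union> \<Union>J')"
    have UJ [measurable]: "\<Union>J \<in> sets borel" "\<Union>J' \<in> sets borel"
      using J J' J_sets J'_sets by (auto intro!: sets.finite_Union)
    have E [measurable]: "E \<in> sets borel"
      unfolding E_def by (intro borel_comp sets.Un UJ)
    have sumV: "(\<Sum>I\<in>J. V (\<nu> I)) \<le> \<sigma>" "(\<Sum>I\<in>J'. V (\<nu>' I)) \<le> \<sigma>"
      using JV JV' ab by (metis mult_le_cancel_left_pos)+
    have emJ: "emeasure \<mu> (\<Union>J) \<le> ennreal \<sigma>"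
    proof -
      have "emeasure \<mu> (\<Union>I\<in>J. I) \<le> (\<Sum>I\<in>J. emeasure \<mu> I)"
        using J J_sets by (intro emeasure_subadditive_finite) auto
      also have "\<dots> = ennreal (\<Sum>I\<in>J. V (\<nu> I))"
        using J_sets V_nonneg by (simp add: sum_ennreal)
      also have "\<dots> \<le> ennreal \<sigma>" using sumV by (intro ennreal_leI)
      finally show ?thesis by simp
    qed
    have emJ': "emeasure \<mu> (\<Union>J') \<le> ennreal \<sigma>"
    proof -
      have "emeasure \<mu> (\<Union>I\<in>J'. I) \<le> (\<Sum>I\<in>J'. emeasure \<mu> I)"
        using J' J'_sets by (intro emeasure_subadditive_finite) auto
      also have "\<dots> = ennreal (\<Sum>I\<in>J'. V (\<nu>' I))"
        using J'_sets V_nonneg by (simp add: sum_ennreal)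
      also have "\<dots> \<le> ennreal \<sigma>" using sumV by (intro ennreal_leI)
      finally show ?thesis by simp
    qed
    have sumb: "(\<Sum>I\<in>J. nrm (b I)) \<le> 2 * B * nrm f"
    proof -
      have "(\<Sum>I\<in>J. nrm (b I)) \<le> (\<Sum>I\<in>J. 2 * B * \<alpha> * V (\<nu> I))" by (intro sum_mono b)
      also have "\<dots> = 2 * B * (\<alpha> * (\<Sum>I\<in>J. V (\<nu> I)))" by (simp add: sum_distrib_left mult_ac)
      also have "\<dots> \<le> 2 * B * nrm f" using JV B1 by (intro mult_left_mono) auto
      finally show ?thesis .
    qed
    have sumb': "(\<Sum>I\<in>J'. nrm (b' I)) \<le> 2 * B * nrm g"
    proof -
      have "(\<Sum>I\<in>J'. nrm (b' I)) \<le> (\<Sum>I\<in>J'. 2 * B * \<beta> * V (\<nu>' I))" by (intro sum_mono b')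
      also have "\<dots> = 2 * B * (\<beta> * (\<Sum>I\<in>J'. V (\<nu>' I)))" by (simp add: sum_distrib_left mult_ac)
      also have "\<dots> \<le> 2 * B * nrm g" using JV' B1 by (intro mult_left_mono) auto
      finally show ?thesis .
    qed
    have notin: "x \<notin> coset (\<nu> I) (c I)" if "I \<in> J" "x \<in> E" for I x
      using J(2)[OF that(1)] that unfolding E_def by blast
    have notin': "x \<notin> coset (\<nu>' I) (c' I)" if "I \<in> J'" "x \<in> E" for I x
      using J'(2)[OF that(1)] that unfolding E_def by blast
    have t3: "0 < t / 3" using t by simp
    have bad1: "emeasure \<mu> {x \<in> E. t / 3 < (\<Sum>I\<in>J. cmod (T (b I) g x))} \<le> ennreal (6 * C * B / (q1 * q0) * \<sigma>)"
    proof -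
      have "emeasure \<mu> {x \<in> E. t / 3 < (\<Sum>I\<in>J. cmod (T (b I) g x))}
          \<le> ennreal (C * \<beta> / (q1 * q0) * (\<Sum>I\<in>J. nrm (b I)) / (t / 3))"
      proof (rule bad_part_bound[OF J(1) E _ notin _ _ t3])
        show "T (b I) g \<in> borel_measurable borel" if "I \<in> J" for I using that b g by (intro Tm)
        fix I x assume I: "I \<in> J" and x: "x \<in> E"
        have off: "b I y = 0" if "y \<notin> coset (\<nu> I) (c I)" for y
          using b(2)[OF I] J(2)[OF I] that by blast
        have "supp (b I) \<subseteq> coset (\<nu> I) (c I)" by (rule supp_subset_coset) (rule off)
        then have "x \<notin> supp (b I)" using notin[OF I x] by blast
        then have "T (b I) g x = (LINT y1|\<mu>. (LINT y2|\<mu>. K x y1 y2 * b I y1 * g y2))"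
          using assoc b(1)[OF I] g unfolding associated_with_def by blast
        moreover have "mass g m x \<le> \<beta> * V m" for m using x by (intro offJ') (simp add: E_def)
        ultimately show "cmod (T (b I) g x) \<le> C * V (\<nu> I) powr \<epsilon> * (\<beta> * d x (c I) powr (-1 - \<epsilon>) / q1) * nrm (b I)"
          using first_variable_bound[where b = "b I", OF notin[OF I x] b(1)[OF I] off b(3)[OF I] g] ab by simp
      qed (use ab in auto)
      also have "C * \<beta> / (q1 * q0) * (\<Sum>I\<in>J. nrm (b I)) / (t / 3) \<le> C * \<beta> / (q1 * q0) * (2 * B * nrm f) / (t / 3)"
        using sumb C_pos ab q_pos t by (intro divide_right_mono mult_left_mono) auto
      also have "\<dots> = 6 * C * B / (q1 * q0) * \<sigma>"
        unfolding ab(3)[symmetric] prod[symmetric] using ab(1,2) by simp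
      finally show ?thesis by (simp add: ennreal_leI)
    qed
    have bad2: "emeasure \<mu> {x \<in> E. t / 3 < (\<Sum>I\<in>J'. cmod (T f0 (b' I) x))} \<le> ennreal (6 * C * B\<^sup>2 / (q1 * q0) * \<sigma>)"
    proof -
      have "emeasure \<mu> {x \<in> E. t / 3 < (\<Sum>I\<in>J'. cmod (T f0 (b' I) x))}
          \<le> ennreal (C * (B * \<alpha>) / (q1 * q0) * (\<Sum>I\<in>J'. nrm (b' I)) / (t / 3))"
      proof (rule bad_part_bound[OF J'(1) E _ notin' _ _ t3])
        show "T f0 (b' I) \<in> borel_measurable borel" if "I \<in> J'" for I using that b' f0 by (intro Tm)
        fix I x assume I: "I \<in> J'" and x: "x \<in> E"
        have off: "b' I y = 0" if "y \<notin> coset (\<nu>' I) (c' I)" for y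
          using b'(2)[OF I] J'(2)[OF I] that by blast
        have "supp (b' I) \<subseteq> coset (\<nu>' I) (c' I)" by (rule supp_subset_coset) (rule off)
        then have "x \<notin> supp (b' I)" using notin'[OF I x] by blast
        then have "T f0 (b' I) x = (LINT y1|\<mu>. (LINT y2|\<mu>. K x y1 y2 * f0 y1 * b' I y2))"
          using assoc b'(1)[OF I] f0(1) unfolding associated_with_def by blast
        moreover have "mass f0 m x \<le> B * \<alpha> * V m" for m by (rule mass_bounded[OF f0(1,3)])
        ultimately show "cmod (T f0 (b' I) x) \<le> C * V (\<nu>' I) powr \<epsilon> * (B * \<alpha> * d x (c' I) powr (-1 - \<epsilon>) / q1) * nrm (b' I)"
          using second_variable_bound[where b = "b' I", OF notin'[OF I x] b'(1)[OF I] off b'(3)[OF I] f0(1)] ab B1 by simp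
      qed (use ab B1 in auto)
      also have "C * (B * \<alpha>) / (q1 * q0) * (\<Sum>I\<in>J'. nrm (b' I)) / (t / 3) \<le> C * (B * \<alpha>) / (q1 * q0) * (2 * B * nrm g) / (t / 3)"
        using sumb' C_pos ab q_pos t B1 by (intro divide_right_mono mult_left_mono) auto
      also have "\<dots> = 6 * C * B\<^sup>2 / (q1 * q0) * \<sigma>"
        unfolding ab(4)[symmetric] prod[symmetric] using ab(1,2) by (simp add: power2_eq_square)
      finally show ?thesis by (simp add: ennreal_leI)
    qed
    have good: "emeasure \<mu> {x. t / 3 < cmod (T' f0 g0 x)} \<le> ennreal ((3 * A' * D\<^sup>2) powr r * \<sigma>)"
      and T'_meas: "T' f0 g0 \<in> borel_measurable borel"
    proof -
      have Da: "0 < D * \<alpha>" "0 < D * \<beta>" using D ab by simp_all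
      have f0D: "cmod (f0 x) \<le> D * \<alpha>" for x
        using f0(3)[of x] D ab by (meson less_imp_le mult_right_mono order_trans)
      have g0D: "cmod (g0 x) \<le> D * \<beta>" for x
        using g0(3)[of x] D ab by (meson less_imp_le mult_right_mono order_trans)
      have f0_1: "nrm f0 \<le> D * \<alpha> * \<sigma>" using f0(4) ab by (simp add: D_def mult.assoc)
      have g0_1: "nrm g0 \<le> D * \<beta> * \<sigma>" using g0(4) ab by (simp add: D_def mult.assoc)
      have Lf: "Lp_norm \<mu> p f0 \<le> ennreal (D * \<alpha> * \<sigma> powr enn2real (1 / p))"
        by (rule Lp_norm_le_interpolation[OF S_integrable[OF f0(1)] pqr(1) Da(1) f0D \<sigma>(1) f0_1])
      have Lg: "Lp_norm \<mu> q g0 \<le> ennreal (D * \<beta> * \<sigma> powr enn2real (1 / q))"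
        by (rule Lp_norm_le_interpolation[OF S_integrable[OF g0(1)] pqr(2) Da(2) g0D \<sigma>(1) g0_1])
      have mem: "f0 \<in> Lp \<mu> p" "g0 \<in> Lp \<mu> q"
        using Lf Lg S_measurable[OF f0(1)] S_measurable[OF g0(1)]
        by (auto simp: Lp_def less_top[symmetric] top_unique)
      show "T' f0 g0 \<in> borel_measurable borel"
        using bilinear_opD(1)[OF T'm mem] by simp
      define X where "X = A' * (D * \<alpha> * \<sigma> powr enn2real (1 / p)) * (D * \<beta> * \<sigma> powr enn2real (1 / q))"
      have X: "X = A' * D\<^sup>2 * t * \<sigma> powr (1 / r)"
        unfolding exponents_real[OF pqr, symmetric] powr_add prod[symmetric] X_def by (simp add: power2_eq_square)
      have X0: "0 \<le> X" unfolding X using t by (simp add: A'_def)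
      have "weak_Lp_norm \<mu> r (T' f0 g0) \<le> ennreal A * Lp_norm \<mu> p f0 * Lp_norm \<mu> q g0"
        by (rule T'A[OF mem])
      also have "\<dots> \<le> ennreal A' * ennreal (D * \<alpha> * \<sigma> powr enn2real (1 / p)) * ennreal (D * \<beta> * \<sigma> powr enn2real (1 / q))"
        by (intro mult_mono Lf Lg) (auto simp: A'_def intro: ennreal_leI)
      also have "\<dots> = ennreal X"
        using Da \<sigma> by (simp add: X_def A'_def ennreal_mult)
      finally have "emeasure \<mu> {x \<in> space \<mu>. t / 3 < cmod (T' f0 g0 x)} \<le> ennreal ((X / (t / 3)) powr r)"
        by (rule weak_Lp_norm_measure_le) (use X0 pqr t in auto)
      also have "X / (t / 3) = 3 * A' * D\<^sup>2 * \<sigma> powr (1 / r)"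
        using t by (simp add: X)
      also have "(3 * A' * D\<^sup>2 * \<sigma> powr (1 / r)) powr r = (3 * A' * D\<^sup>2) powr r * \<sigma>"
        using pqr \<sigma> by (simp add: powr_mult powr_powr A'_def)
      finally show "emeasure \<mu> {x. t / 3 < cmod (T' f0 g0 x)} \<le> ennreal ((3 * A' * D\<^sup>2) powr r * \<sigma>)" by simp
    qed
    define bsum where "bsum = (\<lambda>z. \<Sum>I\<in>J. b I z)"
    define bsum' where "bsum' = (\<lambda>z. \<Sum>I\<in>J'. b' I z)"
    have bsumS: "bsum \<in> S" "bsum' \<in> S"
      unfolding bsum_def bsum'_def using b b' by (auto intro!: S_sum)
    have "AE x in \<mu>. T f g x = T f0 g x + T bsum g x"
      using bilinear_opD(2)[OF T f0(1) bsumS(1) g] unfolding bsum_def f0(2)[symmetric] .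
    moreover have "AE x in \<mu>. T f0 g x = T f0 g0 x + T f0 bsum' x"
      using bilinear_opD(3)[OF T f0(1) g0(1) bsumS(2)] unfolding bsum'_def g0(2)[symmetric] .
    moreover have "AE x in \<mu>. T bsum g x = (\<Sum>I\<in>J. T (b I) g x)"
      unfolding bsum_def by (rule bilinear_AE_sum1[OF T J(1) g b(1)])
    moreover have "AE x in \<mu>. T f0 bsum' x = (\<Sum>I\<in>J'. T f0 (b' I) x)"
      unfolding bsum'_def by (rule bilinear_AE_sum2[OF T J'(1) f0(1) b'(1)])
    moreover have "AE x in \<mu>. T' f0 g0 x = T f0 g0 x" by (rule T'S[OF f0(1) g0(1)])
    ultimately have split: "AE x in \<mu>. cmod (T f g x) \<le> cmod (T' f0 g0 x)
        + (\<Sum>I\<in>J. cmod (T (b I) g x)) + (\<Sum>I\<in>J'. cmod (T f0 (b' I) x))"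
    proof eventually_elim
      case (elim x)
      have eq: "T f g x = T' f0 g0 x + (\<Sum>I\<in>J. T (b I) g x) + (\<Sum>I\<in>J'. T f0 (b' I) x)"
        using elim by simp
      show ?case
        unfolding eq
        using norm_triangle_ineq[of "T' f0 g0 x + (\<Sum>I\<in>J. T (b I) g x)" "\<Sum>I\<in>J'. T f0 (b' I) x"]
          norm_triangle_ineq[of "T' f0 g0 x" "\<Sum>I\<in>J. T (b I) g x"]
          norm_sum[of "\<lambda>I. T (b I) g x" J] norm_sum[of "\<lambda>I. T f0 (b' I) x" J']
        by linarith
    qed
    let ?P1 = "{x. t / 3 < cmod (T' f0 g0 x)}" and ?P2 = "\<Union>J" and ?P3 = "\<Union>J'"
      and ?P4 = "{x \<in> E. t / 3 < (\<Sum>I\<in>J. cmod (T (b I) g x))}"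
      and ?P5 = "{x \<in> E. t / 3 < (\<Sum>I\<in>J'. cmod (T f0 (b' I) x))}"
    have m: "?P1 \<in> sets \<mu>" "?P2 \<in> sets \<mu>" "?P3 \<in> sets \<mu>" "?P4 \<in> sets \<mu>" "?P5 \<in> sets \<mu>"
    proof -
      have [measurable]: "T (b I) g \<in> borel_measurable borel" if "I \<in> J" for I using that b g by (intro Tm)
      have [measurable]: "T f0 (b' I) \<in> borel_measurable borel" if "I \<in> J'" for I using that b' f0 by (intro Tm)
      have "{x \<in> space borel. t / 3 < cmod (T' f0 g0 x)} \<in> sets borel"
        using T'_meas by measurable
      then show "?P1 \<in> sets \<mu>" by simp
      have "{x \<in> space borel. t / 3 < (\<Sum>I\<in>J. cmod (T (b I) g x))} \<in> sets borel" by measurable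
      then have "E \<inter> {x \<in> space borel. t / 3 < (\<Sum>I\<in>J. cmod (T (b I) g x))} \<in> sets borel" using E by (rule sets.Int[rotated])
      then show "?P4 \<in> sets \<mu>" by (simp add: Int_def)
      have "{x \<in> space borel. t / 3 < (\<Sum>I\<in>J'. cmod (T f0 (b' I) x))} \<in> sets borel" by measurable
      then have "E \<inter> {x \<in> space borel. t / 3 < (\<Sum>I\<in>J'. cmod (T f0 (b' I) x))} \<in> sets borel" using E by (rule sets.Int[rotated])
      then show "?P5 \<in> sets \<mu>" by (simp add: Int_def)
    qed (use UJ in auto)
    have "emeasure \<mu> {x. t < cmod (T f g x)} \<le> emeasure \<mu> (?P1 \<union> ?P2 \<union> ?P3 \<union> ?P4 \<union> ?P5)"
    proof (rule emeasure_mono_AE)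
      show "AE x in \<mu>. x \<in> {x. t < cmod (T f g x)} \<longrightarrow> x \<in> ?P1 \<union> ?P2 \<union> ?P3 \<union> ?P4 \<union> ?P5"
        using split
      proof eventually_elim
        case (elim x)
        have "x \<in> ?P1 \<union> ?P2 \<union> ?P3 \<union> ?P4 \<union> ?P5" if gt: "t < cmod (T f g x)"
        proof (cases "x \<in> E")
          case True
          have "t / 3 < cmod (T' f0 g0 x) \<or> t / 3 < (\<Sum>I\<in>J. cmod (T (b I) g x)) \<or> t / 3 < (\<Sum>I\<in>J'. cmod (T f0 (b' I) x))"
            using elim gt by linarith
          then show ?thesis using True by blast
        next
          case False
          then show ?thesis unfolding E_def by blast
        qed
        then show ?case by blast
      qed
      show "?P1 \<union> ?P2 \<union> ?P3 \<union> ?P4 \<union> ?P5 \<in> sets \<mu>" by (intro sets.Un m)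
    qed
    also have "\<dots> \<le> emeasure \<mu> ?P1 + emeasure \<mu> ?P2 + emeasure \<mu> ?P3 + emeasure \<mu> ?P4 + emeasure \<mu> ?P5"
      by (intro order_trans[OF emeasure_subadditive] add_mono order_refl sets.Un m)
    also have "\<dots> \<le> ennreal ((3 * A' * D\<^sup>2) powr r * \<sigma>) + ennreal \<sigma> + ennreal \<sigma>
        + ennreal (6 * C * B / (q1 * q0) * \<sigma>) + ennreal (6 * C * B\<^sup>2 / (q1 * q0) * \<sigma>)"
      by (intro add_mono good emJ emJ' bad1 bad2)
    also have "\<dots> = ennreal (A0 * \<sigma>)"
      using \<sigma> C_pos B1 q_pos by (simp add: A0_def distrib_right flip: ennreal_plus)
    finally show ?thesis by (simp add: \<sigma>_def)
  qed
  have zero: "emeasure \<mu> {x. t < cmod (T f g x)} \<le> ennreal (A0 * sqrt (nrm f * nrm g / t))"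
    if f: "f \<in> S" and g: "g \<in> S" and t: "0 < t" and z: "nrm f = 0 \<or> nrm g = 0" for f g t
  proof -
    have "AE x in \<mu>. T f g x = 0"
      using z bilinear_AE_zero[OF T f g] nrm_zero_imp_zero[OF f] nrm_zero_imp_zero[OF g] by auto
    then have "emeasure \<mu> {x \<in> space \<mu>. t < cmod (T f g x)} = emeasure \<mu> {}"
      using t bilinear_opD(1)[OF T f g] by (intro emeasure_eq_AE) auto
    then show ?thesis by simp
  qed
  have "emeasure \<mu> {x. t < cmod (T f g x)} \<le> ennreal (A0 * sqrt (nrm f * nrm g / t))"
    if "f \<in> S" "g \<in> S" "0 < t" for f g t
  proof (cases "nrm f = 0 \<or> nrm g = 0")
    case False
    have "0 \<le> nrm f" "0 \<le> nrm g" by simp_all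
    then have "0 < nrm f" "0 < nrm g" using False by linarith+
    then show ?thesis by (rule main[OF that])
  qed (rule zero[OF that])
  then show ?thesis using A0 by blast
qed

end

section \<open>Density of the test functions\<close>

lemma ennreal_less_add:
  assumes "a < \<infinity>" "0 < e"
  shows "a < a + ennreal e"
proof (cases a)
  case (real r)
  have "a + ennreal e = ennreal (r + e)" using real assms by (simp add: ennreal_plus)
  then show ?thesis using real assms by (simp add: ennreal_lessI)
qed (use assms in simp)

lemma ennreal_tendsto_0_le:
  fixes f g :: "nat \<Rightarrow> ennreal"
  assumes "\<And>n. f n \<le> g n" "g \<longlonglongrightarrow> 0"
  shows "f \<longlonglongrightarrow> 0"
  by (rule tendsto_sandwich[of "\<lambda>_. 0" f _ g]) (use assms in auto)

context vilenkin begin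

lemma nrm_triangle: "integrable \<mu> f \<Longrightarrow> integrable \<mu> g \<Longrightarrow> nrm (\<lambda>x. f x + g x) \<le> nrm f + nrm g"
proof -
  assume i: "integrable \<mu> f" "integrable \<mu> g"
  have "nrm (\<lambda>x. f x + g x) \<le> (LINT x|\<mu>. cmod (f x) + cmod (g x))"
    using i by (intro integral_mono norm_triangle_ineq) auto
  also have "\<dots> = nrm f + nrm g" using i by simp
  finally show ?thesis .
qed

text \<open>An open set \<open>U\<close> slightly larger than \<open>A\<close> is exhausted by the sets of those points of \<open>G (- n)\<close> whose
  coset of scale \<open>n\<close> lies in \<open>U\<close>, because cosets form a neighbourhood base.\<close>

lemma test_indicator_approximation:
  assumes A: "A \<in> sets borel" "emeasure \<mu> A < \<infinity>" and e: "0 < e"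
  shows "\<exists>W. (indicator W :: 'a \<Rightarrow> complex) \<in> S \<and> (\<integral>\<^sup>+x. ennreal (cmod (indicator W x - indicator A x)) \<partial>\<mu>) \<le> ennreal e"
proof -
  have "emeasure \<mu> A < emeasure \<mu> A + ennreal (e / 2)"
    using A e by (intro ennreal_less_add) auto
  then obtain U where U: "open U" "A \<subseteq> U" "emeasure \<mu> U < emeasure \<mu> A + ennreal (e / 2)"
    using outer_regular[OF A(1)] by (auto simp: INF_less_iff)
  have Um [measurable]: "U \<in> sets borel" using U by simp
  have Ufin: "emeasure \<mu> U < \<infinity>"
    using U(3) A by (metis ennreal_add_less_top ennreal_less_top infinity_ennreal_def less_trans)
  define W where "W n = {x. coset (int n) x \<subseteq> U} \<inter> G (- int n)" for n
  have WS: "(indicator (W n) :: 'a \<Rightarrow> complex) \<in> S" for n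
  proof -
    have "x \<in> W n \<longleftrightarrow> y \<in> W n" if xy: "x - y \<in> G (int n)" for x y
    proof -
      have "coset (int n) x = coset (int n) y"
        by (rule coset_eq) (use xy in \<open>auto simp: coset_def\<close>)
      moreover have "x - y \<in> G (- int n)" using xy by (rule G_antimonoD) simp
      then have "x \<in> G (- int n) \<longleftrightarrow> y \<in> G (- int n)"
        using add_in_G[of "x - y" "- int n" y] diff_in_G[of x "- int n" "x - y"] by auto
      ultimately show ?thesis by (simp add: W_def)
    qed
    then have "indicator (W n) x = (indicator (W n) y :: complex)" if "x - y \<in> G (int n)" for x y
      using that by (simp add: indicator_def)
    moreover have "indicator (W n) x = (0::complex)" if "x \<notin> G (- int n)" for x
      using that by (simp add: W_def)
    ultimately show ?thesis unfolding test_function_iff by blast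
  qed
  have Wm [measurable]: "W n \<in> sets borel" for n
  proof -
    have "W n = (indicator (W n) :: 'a \<Rightarrow> complex) -` {1} \<inter> space borel"
      by (auto simp: indicator_def)
    then show ?thesis using S_measurable[OF WS[of n]] measurable_sets[of _ borel borel "{1::complex}"] by (metis borel_singleton sets.empty_sets)
  qed
  have inc: "incseq W"
  proof (rule incseq_SucI)
    fix n
    show "W n \<subseteq> W (Suc n)"
      unfolding W_def using coset_antimono[of "int n" "int (Suc n)"] G_antimono[of "- int (Suc n)" "- int n"] by force
  qed
  have WU: "W n \<subseteq> U" for n
    unfolding W_def using in_coset by blast
  have un: "(\<Union>n. W n) = U"
  proof (intro equalityI subsetI)
    fix x assume "x \<in> U"
    then obtain k where k: "coset k x \<subseteq> U" using coset_in_open[OF U(1)] by blast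
    obtain j where j: "x \<in> G j" using Union_G by blast
    let ?n = "nat (max k (- j))"
    have "coset (int ?n) x \<subseteq> U"
      using k coset_antimono[of k "int ?n" x] by (rule order_trans[rotated]) linarith
    moreover have "x \<in> G (- int ?n)" using j by (rule G_antimonoD) linarith
    ultimately show "x \<in> (\<Union>n. W n)" unfolding W_def by blast
  qed (use WU in blast)
  have "(\<lambda>n. emeasure \<mu> (W n)) \<longlonglongrightarrow> emeasure \<mu> U"
    using Lim_emeasure_incseq[of W \<mu>] inc Wm unfolding un by (simp add: image_subset_iff)
  then have "(\<lambda>n. emeasure \<mu> (W n) + ennreal (e / 2)) \<longlonglongrightarrow> emeasure \<mu> U + ennreal (e / 2)"
    by (intro tendsto_add) auto
  moreover have "emeasure \<mu> U < emeasure \<mu> U + ennreal (e / 2)"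
    using Ufin e by (intro ennreal_less_add) auto
  ultimately have "\<forall>\<^sub>F n in sequentially. emeasure \<mu> U < emeasure \<mu> (W n) + ennreal (e / 2)"
    by (rule order_tendstoD)
  then obtain n where n: "emeasure \<mu> U < emeasure \<mu> (W n) + ennreal (e / 2)"
    unfolding eventually_sequentially by blast
  have UW: "emeasure \<mu> (U - W n) \<le> ennreal (e / 2)"
    using n Ufin WU[of n] emeasure_mono[OF WU[of n], of \<mu>]
    by (subst emeasure_Diff) (auto simp: ennreal_minus_le_iff less_imp_le top_unique)
  have UA: "emeasure \<mu> (U - A) \<le> ennreal (e / 2)"
    using U A by (subst emeasure_Diff) (auto simp: ennreal_minus_le_iff less_imp_le)
  have "(\<integral>\<^sup>+x. ennreal (cmod (indicator (W n) x - indicator A x)) \<partial>\<mu>) \<le> (\<integral>\<^sup>+x. indicator (U - W n) x + indicator (U - A) x \<partial>\<mu>)"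
    using WU[of n] U(2) by (intro nn_integral_mono) (auto simp: indicator_def)
  also have "\<dots> = emeasure \<mu> (U - W n) + emeasure \<mu> (U - A)"
    using A by (subst nn_integral_add) auto
  also have "\<dots> \<le> ennreal (e / 2) + ennreal (e / 2)"
    by (rule add_mono[OF UW UA])
  also have "\<dots> = ennreal e" using e by (simp flip: ennreal_plus)
  finally show ?thesis using WS[of n] by blast
qed

lemma test_functions_dense:
  assumes "integrable \<mu> f" "0 < e"
  shows "\<exists>\<phi>\<in>S. nrm (\<lambda>x. \<phi> x - f x) < e"
  using assms
proof (induction f arbitrary: e rule: integrable_induct)
  case (base A c)
  define e' where "e' = e / (2 * (cmod c + 1))"
  have e': "0 < e'" using base.prems by (simp add: e'_def add_nonneg_pos)
  obtain W where W: "(indicator W :: 'a \<Rightarrow> complex) \<in> S"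
      "(\<integral>\<^sup>+x. ennreal (cmod (indicator W x - indicator A x)) \<partial>\<mu>) \<le> ennreal e'"
    using test_indicator_approximation[of A e'] base e' by auto
  have iA: "integrable \<mu> (indicator A :: 'a \<Rightarrow> complex)"
  proof -
    have "integrable \<mu> (\<lambda>x. complex_of_real (indicator A x))"
      using base by (intro integrable_of_real integrable_real_indicator) auto
    then show ?thesis by (simp only: of_real_indicator)
  qed
  have i: "integrable \<mu> (\<lambda>x. indicator W x - indicator A x :: complex)"
    using S_integrable[OF W(1)] iA by simp
  have "ennreal (nrm (\<lambda>x. indicator W x - indicator A x)) \<le> ennreal e'"
    using W(2) nn_integral_nrm[OF i] by simp
  then have n: "nrm (\<lambda>x. indicator W x - indicator A x) \<le> e'"
    using e' by simp
  have eq: "c * indicator W x - indicator A x *\<^sub>R c = c * (indicator W x - indicator A x)" for x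
    by (simp add: indicator_def)
  have "nrm (\<lambda>x. c * indicator W x - indicator A x *\<^sub>R c) = cmod c * nrm (\<lambda>x. indicator W x - indicator A x)"
    unfolding eq norm_mult by simp
  also have "\<dots> \<le> (cmod c + 1) * e'"
    using n e' by (intro mult_mono) auto
  also have "\<dots> = e / 2"
    using norm_ge_zero[of c] by (simp add: e'_def field_simps del: norm_ge_zero; linarith)
  also have "\<dots> < e" using base.prems by simp
  finally show ?case using S_cmult[OF W(1), of c] by (intro bexI)
next
  case (add f g)
  obtain \<phi> \<psi> where *: "\<phi> \<in> S" "nrm (\<lambda>x. \<phi> x - f x) < e / 2" "\<psi> \<in> S" "nrm (\<lambda>x. \<psi> x - g x) < e / 2"
    using add.IH(1)[of "e / 2"] add.IH(2)[of "e / 2"] add.prems by auto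
  have "nrm (\<lambda>x. (\<phi> x - f x) + (\<psi> x - g x)) \<le> nrm (\<lambda>x. \<phi> x - f x) + nrm (\<lambda>x. \<psi> x - g x)"
    using add.hyps * S_integrable by (intro nrm_triangle) auto
  then have "nrm (\<lambda>x. (\<phi> x + \<psi> x) - (f x + g x)) < e"
    using * by (simp add: algebra_simps)
  then show ?case using S_add[OF *(1,3)] by (intro bexI)
next
  case (lim f s)
  have "(\<lambda>i. nrm (\<lambda>x. s i x - f x)) \<longlonglongrightarrow> (LINT x|\<mu>. 0)"
  proof (rule integral_dominated_convergence)
    show "integrable \<mu> (\<lambda>x. 3 * cmod (f x))" using lim.hyps by simp
    show "AE x in \<mu>. (\<lambda>i. cmod (s i x - f x)) \<longlonglongrightarrow> 0"
      using lim.hyps(2) by (auto intro!: tendsto_norm_zero LIM_zero)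
    show "AE x in \<mu>. norm (cmod (s i x - f x)) \<le> 3 * cmod (f x)" for i
    proof (intro AE_I2)
      fix x assume "x \<in> space \<mu>"
      then show "norm (cmod (s i x - f x)) \<le> 3 * cmod (f x)"
        using lim.hyps(3)[of x i] norm_triangle_ineq4[of "s i x" "f x"] by simp
    qed
  qed (use lim.hyps in \<open>auto intro!: borel_measurable_norm borel_measurable_diff\<close>)
  then have "\<forall>\<^sub>F i in sequentially. nrm (\<lambda>x. s i x - f x) < e / 2"
    using lim.prems by (intro order_tendstoD(2)) auto
  then obtain i where i: "nrm (\<lambda>x. s i x - f x) < e / 2"
    unfolding eventually_sequentially by blast
  obtain \<phi> where \<phi>: "\<phi> \<in> S" "nrm (\<lambda>x. \<phi> x - s i x) < e / 2"
    using lim.IH[of "e / 2" i] lim.prems by auto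
  have "nrm (\<lambda>x. (\<phi> x - s i x) + (s i x - f x)) \<le> nrm (\<lambda>x. \<phi> x - s i x) + nrm (\<lambda>x. s i x - f x)"
    using lim.hyps \<phi> S_integrable by (intro nrm_triangle) auto
  then have "nrm (\<lambda>x. \<phi> x - f x) < e" using i \<phi> by simp
  then show ?case using \<phi> by blast
qed

end

section \<open>Convergence in measure\<close>

definition tends_in_measure :: "'b measure \<Rightarrow> (nat \<Rightarrow> 'b \<Rightarrow> complex) \<Rightarrow> ('b \<Rightarrow> complex) \<Rightarrow> bool" where
  "tends_in_measure M u h \<longleftrightarrow>
     (\<forall>t>0. (\<lambda>n. emeasure M {x \<in> space M. t < cmod (u n x - h x)}) \<longlonglongrightarrow> 0)"

lemma tends_in_measureD:
  "tends_in_measure M u h \<Longrightarrow> 0 < t \<Longrightarrow> (\<lambda>n. emeasure M {x \<in> space M. t < cmod (u n x - h x)}) \<longlonglongrightarrow> 0"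
  by (simp add: tends_in_measure_def)

lemma emeasure_le_add_AE:
  assumes "AE x in M. x \<in> A \<longrightarrow> x \<in> B \<or> x \<in> C" "A \<in> sets M" "B \<in> sets M" "C \<in> sets M"
  shows "emeasure M A \<le> emeasure M B + emeasure M C"
proof -
  have "emeasure M A \<le> emeasure M (B \<union> C)"
    using assms by (intro emeasure_mono_AE) auto
  also have "\<dots> \<le> emeasure M B + emeasure M C"
    using assms by (intro emeasure_subadditive) auto
  finally show ?thesis .
qed

lemma half_less_norm_diff: "t < cmod (a - c) \<Longrightarrow> t / 2 < cmod (a - b) \<or> t / 2 < cmod (b - c)"
  using norm_triangle_ineq[of "a - b" "b - c"] by auto

lemma tends_in_measure_unique:
  assumes u: "tends_in_measure M u h" "tends_in_measure M u k"
    and [measurable]: "\<And>n. u n \<in> borel_measurable M" "h \<in> borel_measurable M" "k \<in> borel_measurable M"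
  shows "AE x in M. h x = k x"
proof -
  have 0: "emeasure M {x \<in> space M. t < cmod (h x - k x)} = 0" if t: "0 < t" for t
  proof -
    have le: "emeasure M {x \<in> space M. t < cmod (h x - k x)}
      \<le> emeasure M {x \<in> space M. t / 2 < cmod (u n x - h x)} + emeasure M {x \<in> space M. t / 2 < cmod (u n x - k x)}" for n
      using half_less_norm_diff[of t "h _" "k _" "u n _"]
      by (intro emeasure_le_add_AE) (auto simp: norm_minus_commute)
    have "(\<lambda>n. emeasure M {x \<in> space M. t / 2 < cmod (u n x - h x)} + emeasure M {x \<in> space M. t / 2 < cmod (u n x - k x)}) \<longlonglongrightarrow> 0 + 0"
      using u t by (intro tendsto_add tends_in_measureD) auto
    then have "emeasure M {x \<in> space M. t < cmod (h x - k x)} \<le> 0 + 0"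
      using le by (intro LIMSEQ_le_const) auto
    then show ?thesis by simp
  qed
  have "AE x in M. \<forall>n. \<not> 1 / real (Suc n) < cmod (h x - k x)"
    unfolding AE_all_countable using 0 by (auto intro!: AE_I[OF _ 0[of "1 / real (Suc _)"]])
  then show ?thesis
  proof eventually_elim
    case (elim x)
    show ?case
    proof (rule ccontr)
      assume "h x \<noteq> k x"
      then have "0 < cmod (h x - k x)" by simp
      then obtain n where "inverse (real (Suc n)) < cmod (h x - k x)"
        using reals_Archimedean by blast
      then show False using elim by (auto simp: inverse_eq_divide)
    qed
  qed
qed

lemma tends_in_measure_add:
  assumes u: "tends_in_measure M u h" and v: "tends_in_measure M v k"
    and w: "\<And>n. AE x in M. w n x = u n x + v n x"
    and [measurable]: "\<And>n. u n \<in> borel_measurable M" "\<And>n. v n \<in> borel_measurable M" "\<And>n. w n \<in> borel_measurable M"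
      "h \<in> borel_measurable M" "k \<in> borel_measurable M"
  shows "tends_in_measure M w (\<lambda>x. h x + k x)"
  unfolding tends_in_measure_def
proof (intro allI impI)
  fix t :: real assume t: "0 < t"
  have "emeasure M {x \<in> space M. t < cmod (w n x - (h x + k x))}
    \<le> emeasure M {x \<in> space M. t / 2 < cmod (u n x - h x)} + emeasure M {x \<in> space M. t / 2 < cmod (v n x - k x)}" for n
  proof (rule emeasure_le_add_AE)
    show "AE x in M. x \<in> {x \<in> space M. t < cmod (w n x - (h x + k x))} \<longrightarrow>
        x \<in> {x \<in> space M. t / 2 < cmod (u n x - h x)} \<or> x \<in> {x \<in> space M. t / 2 < cmod (v n x - k x)}"
      using w[of n]
    proof eventually_elim
      case (elim x)
      have eq: "w n x - (h x + k x) = (u n x - h x) + (v n x - k x)" using elim by simp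
      have "cmod (w n x - (h x + k x)) \<le> cmod (u n x - h x) + cmod (v n x - k x)"
        unfolding eq by (rule norm_triangle_ineq)
      then show ?case by auto
    qed
  qed measurable
  moreover have "(\<lambda>n. emeasure M {x \<in> space M. t / 2 < cmod (u n x - h x)} + emeasure M {x \<in> space M. t / 2 < cmod (v n x - k x)}) \<longlonglongrightarrow> 0 + 0"
    using u v t by (intro tendsto_add tends_in_measureD) auto
  ultimately show "(\<lambda>n. emeasure M {x \<in> space M. t < cmod (w n x - (h x + k x))}) \<longlonglongrightarrow> 0"
    unfolding add_0_left by (rule ennreal_tendsto_0_le)
qed

lemma tends_in_measure_cmult:
  assumes u: "tends_in_measure M u h" and w: "\<And>n. AE x in M. w n x = a * u n x"
    and [measurable]: "\<And>n. u n \<in> borel_measurable M" "\<And>n. w n \<in> borel_measurable M" "h \<in> borel_measurable M"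
  shows "tends_in_measure M w (\<lambda>x. a * h x)"
  unfolding tends_in_measure_def
proof (intro allI impI)
  fix t :: real assume t: "0 < t"
  have "emeasure M {x \<in> space M. t < cmod (w n x - a * h x)}
    \<le> emeasure M {x \<in> space M. t / (cmod a + 1) < cmod (u n x - h x)}" for n
  proof (rule emeasure_mono_AE)
    show "AE x in M. x \<in> {x \<in> space M. t < cmod (w n x - a * h x)} \<longrightarrow> x \<in> {x \<in> space M. t / (cmod a + 1) < cmod (u n x - h x)}"
      using w[of n]
    proof eventually_elim
      case (elim x)
      have "cmod (w n x - a * h x) = cmod a * cmod (u n x - h x)"
        using elim by (simp only: right_diff_distrib[symmetric] norm_mult)
      also have "\<dots> \<le> (cmod a + 1) * cmod (u n x - h x)" by (intro mult_right_mono) auto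
      finally have le: "cmod (w n x - a * h x) \<le> (cmod a + 1) * cmod (u n x - h x)" .
      have "0 < cmod a + 1" by (rule add_nonneg_pos) auto
      then have "t / (cmod a + 1) < cmod (u n x - h x)" if "t < cmod (w n x - a * h x)"
        using less_le_trans[OF that le] by (simp only: pos_divide_less_eq[OF \<open>0 < cmod a + 1\<close>] mult.commute)
      then show ?case by blast
    qed
  qed measurable
  moreover have "(\<lambda>n. emeasure M {x \<in> space M. t / (cmod a + 1) < cmod (u n x - h x)}) \<longlonglongrightarrow> 0"
    using u t by (intro tends_in_measureD divide_pos_pos add_nonneg_pos) auto
  ultimately show "(\<lambda>n. emeasure M {x \<in> space M. t < cmod (w n x - a * h x)}) \<longlonglongrightarrow> 0"
    by (rule ennreal_tendsto_0_le)
qed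

lemma tends_in_measure_const:
  assumes "\<And>n. AE x in M. u n x = h x" "\<And>n. u n \<in> borel_measurable M" "h \<in> borel_measurable M"
  shows "tends_in_measure M u h"
proof -
  have "emeasure M {x \<in> space M. t < cmod (u n x - h x)} = 0" if "0 < t" for n t
  proof -
    have "emeasure M {x \<in> space M. t < cmod (u n x - h x)} = emeasure M {}"
      using assms(1)[of n] assms(2,3) that by (intro emeasure_eq_AE) auto
    then show ?thesis by simp
  qed
  then show ?thesis by (simp add: tends_in_measure_def)
qed

text \<open>The lemma of Fatou for sets: \<open>A\<close> is almost contained in the lower limit of the \<open>B n\<close>.\<close>

lemma emeasure_le_eventually:
  assumes A: "A \<in> sets M" and B: "\<And>n. B n \<in> sets M"
    and ev: "AE x in M. x \<in> A \<longrightarrow> (\<forall>\<^sub>F n in sequentially. x \<in> B n)"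
    and le: "\<And>n. N \<le> n \<Longrightarrow> emeasure M (B n) \<le> c"
  shows "emeasure M A \<le> c"
proof -
  define D where "D n = (\<Inter>m\<in>{n..}. B m)" for n
  have Dm: "D n \<in> sets M" for n
    unfolding D_def using B by (intro sets.countable_INT) auto
  have inc: "incseq D" unfolding D_def by (intro incseq_SucI) auto
  have "emeasure M A \<le> emeasure M (\<Union>n. D n)"
  proof (rule emeasure_mono_AE)
    show "AE x in M. x \<in> A \<longrightarrow> x \<in> (\<Union>n. D n)"
      using ev by eventually_elim (auto simp: D_def eventually_sequentially)
  qed (use Dm in auto)
  also have "\<dots> = (SUP n. emeasure M (D n))"
    using Dm inc by (intro SUP_emeasure_incseq[symmetric]) auto
  also have "\<dots> \<le> c"
  proof (rule SUP_least)
    fix n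
    have "emeasure M (D n) \<le> emeasure M (B (max n N))"
      using B by (intro emeasure_mono) (auto simp: D_def)
    also have "\<dots> \<le> c" by (rule le) simp
    finally show "emeasure M (D n) \<le> c" .
  qed
  finally show ?thesis .
qed

section \<open>Extension to integrable functions\<close>

lemma real_tendsto_0_le:
  fixes f g :: "nat \<Rightarrow> real"
  assumes "\<And>n. 0 \<le> f n" "\<And>n. f n \<le> g n" "g \<longlonglongrightarrow> 0"
  shows "f \<longlonglongrightarrow> 0"
  by (rule tendsto_sandwich[of "\<lambda>_. 0" f _ g]) (use assms in auto)

context vilenkin begin

definition approximates :: "(nat \<Rightarrow> 'a \<Rightarrow> complex) \<Rightarrow> ('a \<Rightarrow> complex) \<Rightarrow> bool" where
  "approximates \<phi> f \<longleftrightarrow> (\<forall>n. \<phi> n \<in> S) \<and> (\<lambda>n. nrm (\<lambda>x. \<phi> n x - f x)) \<longlonglongrightarrow> 0"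

text \<open>Quantifying over all approximating sequences, rather than asking for one of them, allows limits
  for different arguments to be compared along common sequences, which is how bilinearity passes to
  the limit.\<close>

definition limit_value :: "'a bilin_op \<Rightarrow> ('a \<Rightarrow> complex) \<Rightarrow> ('a \<Rightarrow> complex) \<Rightarrow> ('a \<Rightarrow> complex) \<Rightarrow> bool" where
  "limit_value T f g h \<longleftrightarrow> h \<in> borel_measurable \<mu> \<and>
     (\<forall>\<phi> \<psi>. approximates \<phi> f \<longrightarrow> approximates \<psi> g \<longrightarrow> tends_in_measure \<mu> (\<lambda>n. T (\<phi> n) (\<psi> n)) h)"

lemma approximatesD:
  "approximates \<phi> f \<Longrightarrow> \<phi> n \<in> S" "approximates \<phi> f \<Longrightarrow> (\<lambda>n. nrm (\<lambda>x. \<phi> n x - f x)) \<longlonglongrightarrow> 0"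
  by (auto simp: approximates_def)

lemma approximates_const: "f \<in> S \<Longrightarrow> approximates (\<lambda>n. f) f"
  by (simp add: approximates_def)

lemma approximates_add:
  assumes f: "integrable \<mu> f" "approximates \<phi> f" and g: "integrable \<mu> g" "approximates \<psi> g"
  shows "approximates (\<lambda>n x. \<phi> n x + \<psi> n x) (\<lambda>x. f x + g x)"
  unfolding approximates_def
proof
  show "\<forall>n. (\<lambda>x. \<phi> n x + \<psi> n x) \<in> S"
    using approximatesD(1) f g by (auto intro!: S_add)
  have le: "nrm (\<lambda>x. \<phi> n x + \<psi> n x - (f x + g x)) \<le> nrm (\<lambda>x. \<phi> n x - f x) + nrm (\<lambda>x. \<psi> n x - g x)" for n
    unfolding add_diff_add
    by (rule nrm_triangle[OF Bochner_Integration.integrable_diff[OF S_integrable[OF approximatesD(1)[OF f(2)]] f(1)]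
          Bochner_Integration.integrable_diff[OF S_integrable[OF approximatesD(1)[OF g(2)]] g(1)]])
  have "(\<lambda>n. nrm (\<lambda>x. \<phi> n x - f x) + nrm (\<lambda>x. \<psi> n x - g x)) \<longlonglongrightarrow> 0 + 0"
    using f g by (intro tendsto_add approximatesD)
  then show "(\<lambda>n. nrm (\<lambda>x. \<phi> n x + \<psi> n x - (f x + g x))) \<longlonglongrightarrow> 0"
    unfolding add_0_left by (rule real_tendsto_0_le[rotated 2]) (rule Bochner_Integration.integral_nonneg norm_ge_zero le)+
qed

lemma approximates_cmult:
  assumes "approximates \<phi> f"
  shows "approximates (\<lambda>n x. a * \<phi> n x) (\<lambda>x. a * f x)"
  unfolding approximates_def
proof
  show "\<forall>n. (\<lambda>x. a * \<phi> n x) \<in> S" using approximatesD(1)[OF assms] by (auto intro!: S_cmult)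
  have "nrm (\<lambda>x. a * \<phi> n x - a * f x) = cmod a * nrm (\<lambda>x. \<phi> n x - f x)" for n
    unfolding right_diff_distrib[symmetric] norm_mult by simp
  then show "(\<lambda>n. nrm (\<lambda>x. a * \<phi> n x - a * f x)) \<longlonglongrightarrow> 0"
    using tendsto_mult_right_zero[OF approximatesD(2)[OF assms], of "cmod a"] by simp
qed

lemma approximates_exists:
  assumes f: "integrable \<mu> f" and \<delta>: "\<And>n. 0 < \<delta> n" "\<delta> \<longlonglongrightarrow> 0"
  shows "\<exists>\<phi>. approximates \<phi> f \<and> (\<forall>n. nrm (\<lambda>x. \<phi> n x - f x) < \<delta> n)"
proof -
  have "\<forall>n. \<exists>\<phi>. \<phi> \<in> S \<and> nrm (\<lambda>x. \<phi> x - f x) < \<delta> n"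
    using test_functions_dense[OF f \<delta>(1)] by blast
  then obtain \<phi> where \<phi>: "\<And>n. \<phi> n \<in> S" "\<And>n. nrm (\<lambda>x. \<phi> n x - f x) < \<delta> n"
    by metis
  have "(\<lambda>n. nrm (\<lambda>x. \<phi> n x - f x)) \<longlonglongrightarrow> 0"
    by (rule real_tendsto_0_le[OF _ less_imp_le[OF \<phi>(2)] \<delta>(2)]) simp
  then show ?thesis using \<phi> by (auto simp: approximates_def)
qed

lemma nrm_diff_le:
  assumes "integrable \<mu> u" "integrable \<mu> v" "integrable \<mu> f"
  shows "nrm (\<lambda>x. u x - v x) \<le> nrm (\<lambda>x. u x - f x) + nrm (\<lambda>x. v x - f x)"
proof -
  have "nrm (\<lambda>x. (u x - f x) + (f x - v x)) \<le> nrm (\<lambda>x. u x - f x) + nrm (\<lambda>x. f x - v x)"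
    using assms by (intro nrm_triangle[OF Bochner_Integration.integrable_diff Bochner_Integration.integrable_diff])
  then show ?thesis by (simp add: norm_minus_commute[of "f _" "v _"])
qed

lemma nrm_le_nrm_add:
  assumes "integrable \<mu> u" "integrable \<mu> f"
  shows "nrm u \<le> nrm f + nrm (\<lambda>x. u x - f x)"
proof -
  have "nrm (\<lambda>x. f x + (u x - f x)) \<le> nrm f + nrm (\<lambda>x. u x - f x)"
    using assms by (intro nrm_triangle[OF _ Bochner_Integration.integrable_diff])
  then show ?thesis by simp
qed

lemma nrm_tendsto:
  assumes "integrable \<mu> f" "approximates \<phi> f"
  shows "(\<lambda>n. nrm (\<phi> n)) \<longlonglongrightarrow> nrm f"
proof -
  have "\<bar>nrm (\<phi> n) - nrm f\<bar> \<le> nrm (\<lambda>x. \<phi> n x - f x)" for n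
  proof -
    have i: "integrable \<mu> (\<phi> n)" by (rule S_integrable[OF approximatesD(1)[OF assms(2)]])
    have "nrm (\<lambda>x. f x - \<phi> n x) = nrm (\<lambda>x. \<phi> n x - f x)"
      by (simp only: norm_minus_commute)
    then show ?thesis
      using nrm_le_nrm_add[OF i assms(1)] nrm_le_nrm_add[OF assms(1) i] by linarith
  qed
  then have "(\<lambda>n. nrm (\<phi> n) - nrm f) \<longlonglongrightarrow> 0"
    by (intro Lim_null_comparison[OF _ approximatesD(2)[OF assms(2)]] always_eventually allI) (simp only: real_norm_def)
  then show ?thesis by (rule LIM_zero_cancel)
qed

end

locale weak_type_operator = vilenkin G \<mu>
  for G :: "int \<Rightarrow> 'a::{topological_ab_group_add, t2_space} set" and \<mu> +
  fixes T :: "'a bilin_op" and A :: real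
  assumes bilinear: "bilinear_op \<mu> S S T" and A_nonneg: "0 \<le> A"
    and weak_type: "\<And>f g t. f \<in> S \<Longrightarrow> g \<in> S \<Longrightarrow> 0 < t \<Longrightarrow>
      emeasure \<mu> {x. t < cmod (T f g x)} \<le> ennreal (A * sqrt (nrm f * nrm g / t))"
begin

lemma T_measurable: "f \<in> S \<Longrightarrow> g \<in> S \<Longrightarrow> T f g \<in> borel_measurable \<mu>"
  by (rule bilinear_opD(1)[OF bilinear])

text \<open>The two increments \<open>T (\<phi> - \<phi>') \<psi>\<close> and \<open>T \<phi>' (\<psi> - \<psi>')\<close> are estimated separately, each at height \<open>t / 2\<close>.\<close>

lemma emeasure_T_diff:
  assumes S: "\<phi> \<in> S" "\<phi>' \<in> S" "\<psi> \<in> S" "\<psi>' \<in> S" and t: "0 < t"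
    and bd: "nrm \<psi> \<le> Q" "nrm \<phi>' \<le> Q" "nrm (\<lambda>x. \<phi> x - \<phi>' x) \<le> \<delta>" "nrm (\<lambda>x. \<psi> x - \<psi>' x) \<le> \<delta>"
  shows "emeasure \<mu> {x. t < cmod (T \<phi> \<psi> x - T \<phi>' \<psi>' x)} \<le> ennreal (2 * A * sqrt (2 * Q * \<delta> / t))"
proof -
  have dS: "(\<lambda>x. \<phi> x - \<phi>' x) \<in> S" "(\<lambda>x. \<psi> x - \<psi>' x) \<in> S" using S by (auto intro: S_diff)
  have Q0: "0 \<le> Q" "0 \<le> \<delta>"
    using bd by (meson order_trans Bochner_Integration.integral_nonneg norm_ge_zero)+
  let ?B = "{x. t / 2 < cmod (T (\<lambda>x. \<phi> x - \<phi>' x) \<psi> x)}" and ?C = "{x. t / 2 < cmod (T \<phi>' (\<lambda>x. \<psi> x - \<psi>' x) x)}"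
  have "emeasure \<mu> {x. t < cmod (T \<phi> \<psi> x - T \<phi>' \<psi>' x)} \<le> emeasure \<mu> ?B + emeasure \<mu> ?C"
  proof (rule emeasure_le_add_AE)
    have "AE x in \<mu>. T (\<lambda>z. (\<phi> z - \<phi>' z) + \<phi>' z) \<psi> x = T (\<lambda>x. \<phi> x - \<phi>' x) \<psi> x + T \<phi>' \<psi> x"
      by (rule bilinear_opD(2)[OF bilinear dS(1) S(2,3)])
    moreover have "AE x in \<mu>. T \<phi>' (\<lambda>z. (\<psi> z - \<psi>' z) + \<psi>' z) x = T \<phi>' (\<lambda>x. \<psi> x - \<psi>' x) x + T \<phi>' \<psi>' x"
      by (rule bilinear_opD(3)[OF bilinear S(2) dS(2) S(4)])
    ultimately show "AE x in \<mu>. x \<in> {x. t < cmod (T \<phi> \<psi> x - T \<phi>' \<psi>' x)} \<longrightarrow> x \<in> ?B \<or> x \<in> ?C"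
    proof eventually_elim
      case (elim x)
      have eq: "T \<phi> \<psi> x - T \<phi>' \<psi>' x = T (\<lambda>x. \<phi> x - \<phi>' x) \<psi> x + T \<phi>' (\<lambda>x. \<psi> x - \<psi>' x) x"
        using elim by simp
      have "cmod (T \<phi> \<psi> x - T \<phi>' \<psi>' x) \<le> cmod (T (\<lambda>x. \<phi> x - \<phi>' x) \<psi> x) + cmod (T \<phi>' (\<lambda>x. \<psi> x - \<psi>' x) x)"
        unfolding eq by (rule norm_triangle_ineq)
      then show ?case by auto
    qed
    have [measurable]: "T \<phi> \<psi> \<in> borel_measurable \<mu>" "T \<phi>' \<psi>' \<in> borel_measurable \<mu>"
      "T (\<lambda>x. \<phi> x - \<phi>' x) \<psi> \<in> borel_measurable \<mu>" "T \<phi>' (\<lambda>x. \<psi> x - \<psi>' x) \<in> borel_measurable \<mu>"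
      using S dS by (auto intro!: T_measurable)
    have "{x \<in> space \<mu>. t < cmod (T \<phi> \<psi> x - T \<phi>' \<psi>' x)} \<in> sets \<mu>"
      "{x \<in> space \<mu>. t / 2 < cmod (T (\<lambda>x. \<phi> x - \<phi>' x) \<psi> x)} \<in> sets \<mu>"
      "{x \<in> space \<mu>. t / 2 < cmod (T \<phi>' (\<lambda>x. \<psi> x - \<psi>' x) x)} \<in> sets \<mu>"
      by measurable
    then show "{x. t < cmod (T \<phi> \<psi> x - T \<phi>' \<psi>' x)} \<in> sets \<mu>" "?B \<in> sets \<mu>" "?C \<in> sets \<mu>"
      by simp_all
  qed
  also have "\<dots> \<le> ennreal (A * sqrt (2 * Q * \<delta> / t)) + ennreal (A * sqrt (2 * Q * \<delta> / t))"
  proof (rule add_mono)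
    have "emeasure \<mu> ?B \<le> ennreal (A * sqrt (nrm (\<lambda>x. \<phi> x - \<phi>' x) * nrm \<psi> / (t / 2)))"
      using dS S t by (intro weak_type) auto
    also have "nrm (\<lambda>x. \<phi> x - \<phi>' x) * nrm \<psi> / (t / 2) \<le> \<delta> * Q / (t / 2)"
      using bd t Q0 by (intro divide_right_mono mult_mono) auto
    also have "\<delta> * Q / (t / 2) = 2 * Q * \<delta> / t" by simp
    finally show "emeasure \<mu> ?B \<le> ennreal (A * sqrt (2 * Q * \<delta> / t))"
      using A_nonneg by (simp add: ennreal_leI mult_left_mono)
    have "emeasure \<mu> ?C \<le> ennreal (A * sqrt (nrm \<phi>' * nrm (\<lambda>x. \<psi> x - \<psi>' x) / (t / 2)))"
      using dS S t by (intro weak_type) auto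
    also have "nrm \<phi>' * nrm (\<lambda>x. \<psi> x - \<psi>' x) / (t / 2) \<le> Q * \<delta> / (t / 2)"
      using bd t Q0 by (intro divide_right_mono mult_mono) auto
    also have "Q * \<delta> / (t / 2) = 2 * Q * \<delta> / t" by simp
    finally show "emeasure \<mu> ?C \<le> ennreal (A * sqrt (2 * Q * \<delta> / t))"
      using A_nonneg by (simp add: ennreal_leI mult_left_mono)
  qed
  also have "\<dots> = ennreal (2 * A * sqrt (2 * Q * \<delta> / t))"
    using A_nonneg Q0 t by (simp flip: ennreal_plus)
  finally show ?thesis .
qed

end

lemma Lp_1:
  fixes M :: "'b measure"
  shows "f \<in> Lp M 1 \<longleftrightarrow> integrable M f"
    and "integrable M f \<Longrightarrow> Lp_norm M 1 f = ennreal (LINT x|M. cmod (f x))"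
proof -
  have "epowr x 1 = x" for x by (auto simp: epowr_def less_top)
  then have *: "Lp_norm M 1 f = (\<integral>\<^sup>+x. ennreal (cmod (f x)) \<partial>M)" for f :: "'b \<Rightarrow> complex"
    by (simp add: Lp_norm_def)
  show "f \<in> Lp M 1 \<longleftrightarrow> integrable M f"
    by (simp add: Lp_def * integrable_iff_bounded)
  show "integrable M f \<Longrightarrow> Lp_norm M 1 f = ennreal (LINT x|M. cmod (f x))"
    unfolding * by (intro nn_integral_eq_integral) auto
qed

context weak_type_operator begin

text \<open>Along rapidly converging sequences the values of \<open>T\<close> converge almost everywhere, by the lemma of
  Borel and Cantelli. Comparing with these sequences gives convergence in measure to the same limit
  along any others.\<close>

lemma limit_value_exists:
  assumes f: "integrable \<mu> f" and g: "integrable \<mu> g"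
  shows "\<exists>h. limit_value T f g h"
proof -
  have nn: "0 \<le> nrm u" for u :: "'a \<Rightarrow> complex" by simp
  define Q where "Q = nrm f + nrm g + 1"
  have Q: "1 \<le> Q" "nrm f + 1 \<le> Q" "nrm g + 1 \<le> Q" using nn[of f] nn[of g] by (simp_all add: Q_def)
  \<comment> \<open>\<open>\<kappa>\<close> and the ratio \<open>1 / 8\<close> are such that consecutive values of \<open>T\<close> differ by more than
    \<open>(1 / 2) ^ n\<close> on a set of measure at most \<open>(1 / 2) ^ n\<close> only: in the square root, dividing by
    \<open>(1 / 2) ^ n\<close> leaves the ratio \<open>1 / 4\<close>.\<close>
  define \<kappa> where "\<kappa> = 1 / (16 * Q * (A + 1)\<^sup>2)"
  have \<kappa>: "0 < \<kappa>" "\<kappa> \<le> 1"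
  proof -
    have "1 \<le> (A + 1)\<^sup>2" using A_nonneg by (simp add: one_le_power)
    then have "1 * 1 \<le> (16 * Q) * (A + 1)\<^sup>2" using Q by (intro mult_mono) auto
    then show "0 < \<kappa>" "\<kappa> \<le> 1" by (simp_all add: \<kappa>_def)
  qed
  define \<delta> where "\<delta> n = \<kappa> * (1 / 8) ^ n" for n
  have \<delta>: "0 < \<delta> n" "\<delta> n \<le> 1" for n
    using \<kappa> by (auto simp: \<delta>_def intro!: mult_le_one power_le_one)
  have \<delta>_mono: "\<delta> m \<le> \<delta> n" if "n \<le> m" for m n
    unfolding \<delta>_def using \<kappa> that by (intro mult_left_mono power_decreasing) auto
  have \<delta>0: "\<delta> \<longlonglongrightarrow> 0"
    unfolding \<delta>_def by (intro tendsto_mult_right_zero LIMSEQ_realpow_zero) auto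
  obtain \<phi> where \<phi>: "approximates \<phi> f" "\<And>n. nrm (\<lambda>x. \<phi> n x - f x) < \<delta> n"
    using approximates_exists[OF f \<delta>(1) \<delta>0] by blast
  obtain \<psi> where \<psi>: "approximates \<psi> g" "\<And>n. nrm (\<lambda>x. \<psi> n x - g x) < \<delta> n"
    using approximates_exists[OF g \<delta>(1) \<delta>0] by blast
  note \<phi>S = approximatesD(1)[OF \<phi>(1)] and \<psi>S = approximatesD(1)[OF \<psi>(1)]
  have \<phi>Q: "nrm (\<phi> n) \<le> Q" for n
    using nrm_le_nrm_add[OF S_integrable[OF \<phi>S] f, of n] \<phi>(2)[of n] \<delta>(2)[of n] Q by linarith
  have \<psi>Q: "nrm (\<psi> n) \<le> Q" for n
    using nrm_le_nrm_add[OF S_integrable[OF \<psi>S] g, of n] \<psi>(2)[of n] \<delta>(2)[of n] Q by linarith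
  define U where "U n = T (\<phi> n) (\<psi> n)" for n
  have Um [measurable]: "U n \<in> borel_measurable \<mu>" for n
    unfolding U_def by (intro T_measurable \<phi>S \<psi>S)
  define D where "D n = {x. (1 / 2) ^ n < cmod (U (Suc n) x - U n x)}" for n
  have Dm: "D n \<in> sets \<mu>" for n
  proof -
    have "{x \<in> space \<mu>. (1 / 2) ^ n < cmod (U (Suc n) x - U n x)} \<in> sets \<mu>" by measurable
    then show ?thesis by (simp add: D_def)
  qed
  have Dle: "emeasure \<mu> (D n) \<le> ennreal ((1 / 2) ^ n)" for n
  proof -
    have "emeasure \<mu> (D n) \<le> ennreal (2 * A * sqrt (2 * Q * (2 * \<delta> n) / (1 / 2) ^ n))"
      unfolding D_def U_def
    proof (rule emeasure_T_diff[OF \<phi>S \<phi>S \<psi>S \<psi>S _ \<psi>Q \<phi>Q])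
      have "\<delta> (Suc n) \<le> \<delta> n" by (rule \<delta>_mono) simp
      then show "nrm (\<lambda>x. \<phi> (Suc n) x - \<phi> n x) \<le> 2 * \<delta> n" "nrm (\<lambda>x. \<psi> (Suc n) x - \<psi> n x) \<le> 2 * \<delta> n"
        using nrm_diff_le[OF S_integrable[OF \<phi>S] S_integrable[OF \<phi>S] f, of "Suc n" n] \<phi>(2)[of n] \<phi>(2)[of "Suc n"]
          nrm_diff_le[OF S_integrable[OF \<psi>S] S_integrable[OF \<psi>S] g, of "Suc n" n] \<psi>(2)[of n] \<psi>(2)[of "Suc n"]
        by linarith+
    qed simp
    also have "2 * Q * (2 * \<delta> n) / (1 / 2) ^ n = ((1 / 2) ^ n / (2 * (A + 1)))\<^sup>2"
    proof -
      have "(1 / 8 :: real) ^ n = (1 / 2) ^ n * (1 / 2) ^ n * (1 / 2) ^ n"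
        by (simp flip: power_mult_distrib)
      then show ?thesis using Q by (simp add: \<delta>_def \<kappa>_def power2_eq_square; simp add: algebra_simps)
    qed
    also have "sqrt (((1 / 2) ^ n / (2 * (A + 1)))\<^sup>2) = (1 / 2) ^ n / (2 * (A + 1))"
      using A_nonneg by (intro real_sqrt_unique) auto
    also have "2 * A * ((1 / 2) ^ n / (2 * (A + 1))) = (A / (A + 1)) * (1 / 2) ^ n"
    proof -
      have "2 * A * (z / (2 * w)) = A / w * z" for z w :: real by simp
      then show ?thesis .
    qed
    also have "\<dots> \<le> (1 / 2) ^ n"
      using A_nonneg by (intro mult_left_le_one_le) auto
    finally show ?thesis by (simp add: ennreal_leI)
  qed
  have "AE x in \<mu>. eventually (\<lambda>n. x \<in> space \<mu> - D n) sequentially"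
  proof (rule borel_cantelli_AE1[OF Dm])
    show "emeasure \<mu> (D n) < \<infinity>" for n
      using Dle[of n] by (rule le_less_trans) simp
    have "measure \<mu> (D n) \<le> (1 / 2) ^ n" for n
      using Dle[of n] unfolding measure_def by (intro enn2real_leI) auto
    then show "summable (\<lambda>n. measure \<mu> (D n))"
      by (intro summable_comparison_test'[OF summable_geometric[of "1 / 2 :: real"], of 0]) auto
  qed
  then have conv: "AE x in \<mu>. convergent (\<lambda>n. U n x)"
  proof eventually_elim
    case (elim x)
    have "\<forall>\<^sub>F n in sequentially. norm (U (Suc n) x - U n x) \<le> (1 / 2) ^ n"
      using elim by eventually_elim (auto simp: D_def)
    then have "summable (\<lambda>n. U (Suc n) x - U n x)"
      by (rule summable_comparison_test_ev) (rule summable_geometric, simp)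
    then have "(\<lambda>n. (\<Sum>k<n. U (Suc k) x - U k x)) \<longlonglongrightarrow> (\<Sum>k. U (Suc k) x - U k x)"
      by (rule summable_LIMSEQ)
    then have "(\<lambda>n. U n x - U 0 x) \<longlonglongrightarrow> (\<Sum>k. U (Suc k) x - U k x)"
      by (simp only: sum_lessThan_telescope[of "\<lambda>k. U k x"])
    then have "(\<lambda>n. (U n x - U 0 x) + U 0 x) \<longlonglongrightarrow> (\<Sum>k. U (Suc k) x - U k x) + U 0 x"
      by (intro tendsto_add tendsto_const)
    then show ?case by (auto simp: convergent_def)
  qed
  define h where "h x = lim (\<lambda>n. U n x)" for x
  have hm [measurable]: "h \<in> borel_measurable \<mu>"
    unfolding h_def[abs_def] by (rule borel_measurable_lim_metric[OF Um])
  have lim: "AE x in \<mu>. (\<lambda>n. U n x) \<longlonglongrightarrow> h x"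
    using conv by eventually_elim (simp add: h_def convergent_LIMSEQ_iff)
  have "tends_in_measure \<mu> (\<lambda>n. T (\<phi>' n) (\<psi>' n)) h" if \<phi>': "approximates \<phi>' f" and \<psi>': "approximates \<psi>' g" for \<phi>' \<psi>'
    unfolding tends_in_measure_def
  proof (intro allI impI)
    fix t :: real assume t: "0 < t"
    note \<phi>'S = approximatesD(1)[OF \<phi>'] and \<psi>'S = approximatesD(1)[OF \<psi>']
    define a where "a n = nrm (\<lambda>x. \<phi>' n x - f x)" for n
    define b where "b n = nrm (\<lambda>x. \<psi>' n x - g x)" for n
    have ab0: "0 \<le> a n" "0 \<le> b n" for n by (simp_all add: a_def b_def)
    let ?c = "\<lambda>n. 2 * A * sqrt (2 * (Q + a n + b n) * (a n + b n + \<delta> n) / t)"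
    have le: "emeasure \<mu> {x \<in> space \<mu>. t < cmod (T (\<phi>' n) (\<psi>' n) x - h x)} \<le> ennreal (?c n)" for n
    \<comment> \<open>\<open>\<delta>\<close> decreases, so the bound for the difference with \<open>U n\<close> serves for all later \<open>U m\<close>.\<close>
    proof (rule emeasure_le_eventually[where N = n and B = "\<lambda>m. {x \<in> space \<mu>. t < cmod (T (\<phi>' n) (\<psi>' n) x - U m x)}"])
      have [measurable]: "T (\<phi>' n) (\<psi>' n) \<in> borel_measurable \<mu>" by (intro T_measurable \<phi>'S \<psi>'S)
      show "{x \<in> space \<mu>. t < cmod (T (\<phi>' n) (\<psi>' n) x - h x)} \<in> sets \<mu>"
        "{x \<in> space \<mu>. t < cmod (T (\<phi>' n) (\<psi>' n) x - U m x)} \<in> sets \<mu>" for m by measurable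
      show "AE x in \<mu>. x \<in> {x \<in> space \<mu>. t < cmod (T (\<phi>' n) (\<psi>' n) x - h x)} \<longrightarrow>
          (\<forall>\<^sub>F m in sequentially. x \<in> {x \<in> space \<mu>. t < cmod (T (\<phi>' n) (\<psi>' n) x - U m x)})"
        using lim
      proof eventually_elim
        case (elim x)
        have "(\<lambda>m. cmod (T (\<phi>' n) (\<psi>' n) x - U m x)) \<longlonglongrightarrow> cmod (T (\<phi>' n) (\<psi>' n) x - h x)"
          using elim by (intro tendsto_intros)
        then show ?case using order_tendstoD(1) by fastforce
      qed
      show "emeasure \<mu> {x \<in> space \<mu>. t < cmod (T (\<phi>' n) (\<psi>' n) x - U m x)} \<le> ennreal (?c n)" if m: "n \<le> m" for m
      proof -
        have "emeasure \<mu> {x. t < cmod (T (\<phi>' n) (\<psi>' n) x - T (\<phi> m) (\<psi> m) x)} \<le> ennreal (?c n)"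
        proof (rule emeasure_T_diff[OF \<phi>'S \<phi>S \<psi>'S \<psi>S t])
          show "nrm (\<psi>' n) \<le> Q + a n + b n"
            using nrm_le_nrm_add[OF S_integrable[OF \<psi>'S] g, of n] Q ab0[of n] by (simp add: b_def)
          show "nrm (\<phi> m) \<le> Q + a n + b n" using \<phi>Q[of m] ab0[of n] by linarith
          show "nrm (\<lambda>x. \<phi>' n x - \<phi> m x) \<le> a n + b n + \<delta> n"
            using nrm_diff_le[OF S_integrable[OF \<phi>'S] S_integrable[OF \<phi>S] f, of n m] \<phi>(2)[of m] \<delta>_mono[OF m] ab0[of n]
            unfolding a_def by linarith
          show "nrm (\<lambda>x. \<psi>' n x - \<psi> m x) \<le> a n + b n + \<delta> n"
            using nrm_diff_le[OF S_integrable[OF \<psi>'S] S_integrable[OF \<psi>S] g, of n m] \<psi>(2)[of m] \<delta>_mono[OF m] ab0[of n]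
            unfolding b_def by linarith
        qed
        then show ?thesis by (simp add: U_def)
      qed
    qed
    have a0: "a \<longlonglongrightarrow> 0" "b \<longlonglongrightarrow> 0"
      unfolding a_def[abs_def] b_def[abs_def] by (rule approximatesD(2)[OF \<phi>'], rule approximatesD(2)[OF \<psi>'])
    have "?c \<longlonglongrightarrow> 2 * A * sqrt (2 * (Q + 0 + 0) * (0 + 0 + 0) / t)"
      by (intro tendsto_intros a0 \<delta>0) (use t in auto)
    then have "?c \<longlonglongrightarrow> 0" by simp
    then have "(\<lambda>n. ennreal (?c n)) \<longlonglongrightarrow> ennreal 0" by (rule tendsto_ennrealI)
    then show "(\<lambda>n. emeasure \<mu> {x \<in> space \<mu>. t < cmod (T (\<phi>' n) (\<psi>' n) x - h x)}) \<longlonglongrightarrow> 0"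
      unfolding ennreal_0 by (rule ennreal_tendsto_0_le[OF le])
  qed
  then show ?thesis using hm unfolding limit_value_def by blast
qed

lemma approximating_sequence: "integrable \<mu> f \<Longrightarrow> \<exists>\<phi>. approximates \<phi> f"
  using approximates_exists[of f "\<lambda>n. inverse (real (Suc n))"] LIMSEQ_inverse_real_of_nat by auto

lemma limit_value_bound:
  assumes f: "integrable \<mu> f" and g: "integrable \<mu> g" and h: "limit_value T f g h" and t: "0 < t"
  shows "emeasure \<mu> {x. t < cmod (h x)} \<le> ennreal ((2 * A\<^sup>2 * nrm f * nrm g / t) powr (1 / 2))"
proof -
  obtain \<phi> where \<phi>: "approximates \<phi> f" using approximating_sequence[OF f] by blast
  obtain \<psi> where \<psi>: "approximates \<psi> g" using approximating_sequence[OF g] by blast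
  note \<phi>S = approximatesD(1)[OF \<phi>] and \<psi>S = approximatesD(1)[OF \<psi>]
  have [measurable]: "h \<in> borel_measurable \<mu>" using h by (simp add: limit_value_def)
  have [measurable]: "T (\<phi> n) (\<psi> n) \<in> borel_measurable \<mu>" for n by (intro T_measurable \<phi>S \<psi>S)
  have tim: "tends_in_measure \<mu> (\<lambda>n. T (\<phi> n) (\<psi> n)) h" using h \<phi> \<psi> by (simp add: limit_value_def)
  let ?e = "\<lambda>n. emeasure \<mu> {x \<in> space \<mu>. t / 2 < cmod (T (\<phi> n) (\<psi> n) x - h x)}"
  let ?b = "\<lambda>n. A * sqrt (nrm (\<phi> n) * nrm (\<psi> n) / (t / 2))"
  have le: "emeasure \<mu> {x. t < cmod (h x)} \<le> ?e n + ennreal (?b n)" for n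
  proof -
    have m: "{x \<in> space \<mu>. t < cmod (h x)} \<in> sets \<mu>"
        "{x \<in> space \<mu>. t / 2 < cmod (T (\<phi> n) (\<psi> n) x)} \<in> sets \<mu>" by measurable
    have "emeasure \<mu> {x. t < cmod (h x)} \<le> ?e n + emeasure \<mu> {x. t / 2 < cmod (T (\<phi> n) (\<psi> n) x)}"
    proof (rule emeasure_le_add_AE)
      have "t / 2 < cmod (T (\<phi> n) (\<psi> n) x - h x) \<or> t / 2 < cmod (T (\<phi> n) (\<psi> n) x)" if "t < cmod (h x)" for x
        using norm_triangle_ineq4[of "T (\<phi> n) (\<psi> n) x" "T (\<phi> n) (\<psi> n) x - h x"] that by auto
      then show "AE x in \<mu>. x \<in> {x. t < cmod (h x)} \<longrightarrow>
          x \<in> {x \<in> space \<mu>. t / 2 < cmod (T (\<phi> n) (\<psi> n) x - h x)} \<or> x \<in> {x. t / 2 < cmod (T (\<phi> n) (\<psi> n) x)}"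
        unfolding mem_Collect_eq space_mu by (intro AE_I2) blast
      show "{x \<in> space \<mu>. t / 2 < cmod (T (\<phi> n) (\<psi> n) x - h x)} \<in> sets \<mu>" by measurable
    qed (use m in auto)
    also have "\<dots> \<le> ?e n + ennreal (?b n)"
      using t by (intro add_left_mono weak_type \<phi>S \<psi>S) auto
    finally show ?thesis .
  qed
  have "?b \<longlonglongrightarrow> A * sqrt (nrm f * nrm g / (t / 2))"
    by (intro tendsto_intros nrm_tendsto f g \<phi> \<psi>) (use t in auto)
  then have "(\<lambda>n. ?e n + ennreal (?b n)) \<longlonglongrightarrow> 0 + ennreal (A * sqrt (nrm f * nrm g / (t / 2)))"
    using t by (intro tendsto_add tendsto_ennrealI tends_in_measureD[OF tim]) auto
  then have "emeasure \<mu> {x. t < cmod (h x)} \<le> 0 + ennreal (A * sqrt (nrm f * nrm g / (t / 2)))"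
    by (rule LIMSEQ_le_const) (use le in blast)
  also have "A * sqrt (nrm f * nrm g / (t / 2)) = sqrt (2 * A\<^sup>2 * nrm f * nrm g / t)"
    using A_nonneg by (simp add: real_sqrt_mult real_sqrt_divide field_simps)
  also have "\<dots> = (2 * A\<^sup>2 * nrm f * nrm g / t) powr (1 / 2)"
    using t by (intro powr_half_sqrt[symmetric]) auto
  finally show ?thesis by simp
qed

text \<open>The extension is only determined almost everywhere, so any limit in measure may be chosen;
  its uniqueness gives bilinearity and agreement with \<open>T\<close> on test functions.\<close>

lemma extends_to_L1: "extends_boundedly G \<mu> 1 1 (1 / 2) T"
proof -
  define T' where "T' f g = (SOME h. limit_value T f g h)" for f g
  have T': "limit_value T f g (T' f g)" if "integrable \<mu> f" "integrable \<mu> g" for f g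
    unfolding T'_def by (rule someI_ex[OF limit_value_exists[OF that]])
  have T'm [measurable]: "T' f g \<in> borel_measurable \<mu>" if "integrable \<mu> f" "integrable \<mu> g" for f g
    using T'[OF that] by (simp add: limit_value_def)
  have T'lim: "tends_in_measure \<mu> (\<lambda>n. T (\<phi> n) (\<psi> n)) (T' f g)"
    if "integrable \<mu> f" "integrable \<mu> g" "approximates \<phi> f" "approximates \<psi> g" for f g \<phi> \<psi>
    using T'[OF that(1,2)] that(3,4) by (simp add: limit_value_def)
  have "bilinear_op \<mu> (Lp \<mu> 1) (Lp \<mu> 1) T'"
    unfolding bilinear_op_def Lp_1 Ball_def
  proof (intro conjI allI impI)
    show "T' f g \<in> borel_measurable \<mu>" if "integrable \<mu> f" "integrable \<mu> g" for f g
      by (rule T'm[OF that])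
  next
    fix f f' g :: "'a \<Rightarrow> complex" assume i: "integrable \<mu> f" "integrable \<mu> f'" "integrable \<mu> g"
    obtain \<phi> \<phi>' \<psi> where a: "approximates \<phi> f" "approximates \<phi>' f'" "approximates \<psi> g"
      using approximating_sequence i by meson
    note s = approximatesD(1)[OF a(1)] approximatesD(1)[OF a(2)] approximatesD(1)[OF a(3)]
    have i': "integrable \<mu> (\<lambda>x. f x + f' x)" using i by simp
    have "tends_in_measure \<mu> (\<lambda>n. T (\<lambda>x. \<phi> n x + \<phi>' n x) (\<psi> n)) (\<lambda>x. T' f g x + T' f' g x)"
      by (rule tends_in_measure_add[OF T'lim[OF i(1,3) a(1,3)] T'lim[OF i(2,3) a(2,3)]])
         (use s i in \<open>auto intro!: bilinear_opD(2)[OF bilinear] T_measurable T'm S_add\<close>)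
    then show "AE x in \<mu>. T' (\<lambda>z. f z + f' z) g x = T' f g x + T' f' g x"
      using s i i'
      by (intro tends_in_measure_unique[OF T'lim[OF i' i(3) approximates_add[OF i(1) a(1) i(2) a(2)] a(3)]]
          borel_measurable_add T_measurable T'm S_add)
  next
    fix f g g' :: "'a \<Rightarrow> complex" assume i: "integrable \<mu> f" "integrable \<mu> g" "integrable \<mu> g'"
    obtain \<phi> \<psi> \<psi>' where a: "approximates \<phi> f" "approximates \<psi> g" "approximates \<psi>' g'"
      using approximating_sequence i by meson
    note s = approximatesD(1)[OF a(1)] approximatesD(1)[OF a(2)] approximatesD(1)[OF a(3)]
    have i': "integrable \<mu> (\<lambda>x. g x + g' x)" using i by simp
    have "tends_in_measure \<mu> (\<lambda>n. T (\<phi> n) (\<lambda>x. \<psi> n x + \<psi>' n x)) (\<lambda>x. T' f g x + T' f g' x)"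
      by (rule tends_in_measure_add[OF T'lim[OF i(1,2) a(1,2)] T'lim[OF i(1,3) a(1,3)]])
         (use s i in \<open>auto intro!: bilinear_opD(3)[OF bilinear] T_measurable T'm S_add\<close>)
    then show "AE x in \<mu>. T' f (\<lambda>z. g z + g' z) x = T' f g x + T' f g' x"
      using s i i'
      by (intro tends_in_measure_unique[OF T'lim[OF i(1) i' a(1) approximates_add[OF i(2) a(2) i(3) a(3)]]]
          borel_measurable_add T_measurable T'm S_add)
  next
    fix c and f g :: "'a \<Rightarrow> complex" assume i: "integrable \<mu> f" "integrable \<mu> g"
    obtain \<phi> \<psi> where a: "approximates \<phi> f" "approximates \<psi> g"
      using approximating_sequence i by meson
    note s = approximatesD(1)[OF a(1)] approximatesD(1)[OF a(2)]
    have i': "integrable \<mu> (\<lambda>x. c * f x)" "integrable \<mu> (\<lambda>x. c * g x)" using i by simp_all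
    have "tends_in_measure \<mu> (\<lambda>n. T (\<lambda>x. c * \<phi> n x) (\<psi> n)) (\<lambda>x. c * T' f g x)"
      by (rule tends_in_measure_cmult[OF T'lim[OF i a]])
         (use s i in \<open>auto intro!: bilinear_opD(4)[OF bilinear] T_measurable T'm S_cmult\<close>)
    then show "AE x in \<mu>. T' (\<lambda>z. c * f z) g x = c * T' f g x"
      using s i i'
      by (intro tends_in_measure_unique[OF T'lim[OF i'(1) i(2) approximates_cmult[OF a(1)] a(2)]]
          borel_measurable_times borel_measurable_const T_measurable T'm S_cmult)
    have "tends_in_measure \<mu> (\<lambda>n. T (\<phi> n) (\<lambda>x. c * \<psi> n x)) (\<lambda>x. c * T' f g x)"
      by (rule tends_in_measure_cmult[OF T'lim[OF i a]])
         (use s i in \<open>auto intro!: bilinear_opD(5)[OF bilinear] T_measurable T'm S_cmult\<close>)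
    then show "AE x in \<mu>. T' f (\<lambda>z. c * g z) x = c * T' f g x"
      using s i i'
      by (intro tends_in_measure_unique[OF T'lim[OF i(1) i'(2) a(1) approximates_cmult[OF a(2)]]]
          borel_measurable_times borel_measurable_const T_measurable T'm S_cmult)
  qed
  moreover have "AE x in \<mu>. T' f g x = T f g x" if S: "f \<in> S" "g \<in> S" for f g
  proof -
    note i = S_integrable[OF S(1)] S_integrable[OF S(2)]
    have "tends_in_measure \<mu> (\<lambda>n. T f g) (T f g)"
      using S by (intro tends_in_measure_const T_measurable) auto
    then show ?thesis
      using S i by (intro tends_in_measure_unique[OF T'lim[OF i approximates_const approximates_const]] T_measurable T'm)
  qed
  moreover have bound: "weak_Lp_norm \<mu> (1 / 2) (T' f g) \<le> ennreal (2 * A\<^sup>2) * Lp_norm \<mu> 1 f * Lp_norm \<mu> 1 g"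
    if i: "integrable \<mu> f" "integrable \<mu> g" for f g
  proof -
    have "weak_Lp_norm \<mu> (1 / 2) (T' f g) \<le> ennreal (2 * A\<^sup>2 * nrm f * nrm g)"
    proof (rule weak_Lp_norm_leI)
      show "0 \<le> 2 * A\<^sup>2 * nrm f * nrm g" by simp
      show "emeasure \<mu> {x \<in> space \<mu>. t < cmod (T' f g x)} \<le> ennreal ((2 * A\<^sup>2 * nrm f * nrm g / t) powr (1 / 2))" if "0 < t" for t
        using limit_value_bound[OF i T'[OF i] that] by simp
    qed simp
    also have "\<dots> = ennreal (2 * A\<^sup>2) * Lp_norm \<mu> 1 f * Lp_norm \<mu> 1 g"
      using i by (simp add: Lp_1 ennreal_mult)
    finally show ?thesis .
  qed
  moreover have "T' f g \<in> weak_Lp \<mu> (1 / 2)" if i: "integrable \<mu> f" "integrable \<mu> g" for f g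
  proof -
    have "ennreal (2 * A\<^sup>2) * Lp_norm \<mu> 1 f * Lp_norm \<mu> 1 g < \<infinity>"
      using i by (simp add: Lp_1 ennreal_mult_less_top)
    then show ?thesis
      using bound[OF i] T'm[OF i] by (simp add: weak_Lp_def)
  qed
  ultimately show ?thesis
    unfolding extends_boundedly_def Lp_1 Ball_def by blast
qed

end

theorem theorem1:
  fixes G :: "int \<Rightarrow> 'a::{topological_ab_group_add, t2_space} set"
    and \<mu> :: "'a measure"
    and T :: "('a \<Rightarrow> complex) \<Rightarrow> ('a \<Rightarrow> complex) \<Rightarrow> 'a \<Rightarrow> complex"
    and p q :: ennreal and r :: real
  assumes "vilenkin_group G"
    and "haar_measure \<mu>" and "emeasure \<mu> (G 0) = 1"
    and "bilinear_CZ_operator G \<mu> T"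
    and "1 \<le> p" and "1 \<le> q" and "0 < r"
    and "1 / p + 1 / q = 1 / ennreal r"
    and "extends_boundedly G \<mu> p q r T"
  shows "extends_boundedly G \<mu> 1 1 (1 / 2) T"
proof -
  interpret vilenkin G \<mu> by unfold_locales fact+
  obtain K where T: "bilinear_op \<mu> S S T" and K: "bilinear_CZ_kernel G \<mu> K" and assoc: "associated_with G \<mu> T K"
    using assms(4) unfolding bilinear_CZ_operator_def by blast
  obtain C \<epsilon> where C: "0 < C" "0 < \<epsilon>" and bounds: "\<forall>(x, y1, y2) \<in> off_diagonal.
         cmod (K x y1 y2) \<le> C / (d x y1 + d x y2)\<^sup>2 \<and>
         (\<forall>x'. d x x' \<le> 1 / 2 * max (d x y1) (d x y2) \<longrightarrow>
            cmod (K x y1 y2 - K x' y1 y2)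
              \<le> C * d x x' powr \<epsilon> / (d x y1 + d x y2) powr (2 + \<epsilon>)) \<and>
         (\<forall>y1'. d y1 y1' \<le> 1 / 2 * max (d x y1) (d x y2) \<longrightarrow>
            cmod (K x y1 y2 - K x y1' y2)
              \<le> C * d y1 y1' powr \<epsilon> / (d x y1 + d x y2) powr (2 + \<epsilon>)) \<and>
         (\<forall>y2'. d y2 y2' \<le> 1 / 2 * max (d x y1) (d x y2) \<longrightarrow>
            cmod (K x y1 y2 - K x y1 y2')
              \<le> C * d y2 y2' powr \<epsilon> / (d x y1 + d x y2) powr (2 + \<epsilon>))"
    using K unfolding bilinear_CZ_kernel_def Let_def by (elim exE conjE) (rule that)
  interpret calderon_zygmund_kernel G \<mu> K C \<epsilon>
  proof unfold_locales
    fix x y1 y2 z :: 'a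
    assume "\<not> (x = y1 \<and> x = y2)"
    then have "(x, y1, y2) \<in> off_diagonal" by (simp add: off_diagonal_def)
    note * = bspec[OF bounds this, unfolded prod.case]
    show "cmod (K x y1 y2) \<le> C / (d x y1 + d x y2)\<^sup>2"
      using * by (elim conjE)
    show "cmod (K x y1 y2 - K x z y2) \<le> C * d y1 z powr \<epsilon> / (d x y1 + d x y2) powr (2 + \<epsilon>)"
      if "d y1 z \<le> 1 / 2 * max (d x y1) (d x y2)"
      by (rule *[THEN conjunct2, THEN conjunct2, THEN conjunct1, rule_format, OF that])
    show "cmod (K x y1 y2 - K x y1 z) \<le> C * d y2 z powr \<epsilon> / (d x y1 + d x y2) powr (2 + \<epsilon>)"
      if "d y2 z \<le> 1 / 2 * max (d x y1) (d x y2)"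
      by (rule *[THEN conjunct2, THEN conjunct2, THEN conjunct2, rule_format, OF that])
  qed (fact C)+
  obtain A where A: "0 \<le> A" "\<And>f g t. f \<in> S \<Longrightarrow> g \<in> S \<Longrightarrow> 0 < t \<Longrightarrow>
      emeasure \<mu> {x. t < cmod (T f g x)} \<le> ennreal (A * sqrt (nrm f * nrm g / t))"
    using weak_type_estimate[OF T assoc assms(5-9)] by blast
  interpret weak_type_operator G \<mu> T A
    by unfold_locales (fact T A)+
  show ?thesis by (rule extends_to_L1)
qed

end
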